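(* Let $\mathcal{H}$ be a complex Hilbert space, let $\rho$ be a density operator on $\mathcal{H}$, let $\bm{A}=\{A_1,\dots,A_n\}$ be a set of bounded self-adjoint operators on $\mathcal{H}$ with $R_j:=\|A_j\|<\infty$, let $N\ge 1$ be a fixed integer, and let $w:S_n\to\mathbb{C}$ be a normalized weight, $\sum_{\sigma\in S_n}w(\sigma)=1$, satisfying $\sum_{\sigma\in S_n}|w(\sigma)|=1$. Let $$\mathscr{C}_{\bm A}(\bm\theta,\rho)=\mathrm{Tr}\big[\tilde f^{(N,w)}_{\bm A}(\bm\theta)\,\rho\big],\qquad \tilde f^{(N,w)}_{\bm A}(\bm\theta)=\Big[\sum_{\sigma\in S_n}w(\sigma)\prod_{j=1}^{n}e^{\frac{i\theta_{\sigma(j)}}{N}A_{\sigma(j)}}\Big]^N,\qquad \bm\theta\in\mathbb{R}^n .$$ Then the function $\bm\theta\mapsto\mathscr{C}_{\bm A}(\bm\theta,\rho)$ is bounded and $C^\infty$ on $\mathbb{R}^n$, and there is a unique quasiprobability distribution $\mathrm{Pr}_{\bm A}(\cdot,\rho)\in\mathcal{E}'(\mathbb{R}^n)$, with support in $\prod_{j=1}^n[-R_j,R_j]$, whose Fourier transform it is: $$\mathscr{C}_{\bm A}(\bm\theta,\rho)=\int_{\mathbb{R}^n}d^nx\,\mathrm{Pr}_{\bm A}(\bm x,\rho)\,e^{i\bm\theta\cdot\bm x}.$$ This distribution has the following properties. 1. (Normalization) $\int d^nx\,\mathrm{Pr}_{\bm A}(\bm x,\rho)=\langle \mathrm{Pr}_{\bm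 A}(\cdot,\rho),1\rangle=\mathscr{C}_{\bm A}(\bm 0,\rho)=1$. 2. (Moment generation) For every multi-index $\alpha=(\alpha_1,\dots,\alpha_n)\in\mathbb{N}_0^n$, $$\int d^nx\,\bm x^\alpha\,\mathrm{Pr}_{\bm A}(\bm x,\rho)=\frac{1}{i^{|\alpha|}}\,\frac{\partial^{|\alpha|}}{\partial\theta_1^{\alpha_1}\cdots\partial\theta_n^{\alpha_n}}\mathscr{C}_{\bm A}(\bm\theta,\rho)\Big|_{\bm\theta=\bm 0}.$$ 3. (Reality) $\mathrm{Pr}_{\bm A}(\cdot,\rho)$ is a real (signed) distribution if and only if $\mathscr{C}_{\bm A}(-\bm\theta,\rho)=\overline{\mathscr{C}_{\bm A}(\bm\theta,\rho)}$ for all $\bm\theta\in\mathbb{R}^n$. 4. (Non-negativity) $\mathrm{Pr}_{\bm A}(\cdot,\rho)$ is a non-negative (hence genuine) probability measure if and only if $\mathscr{C}_{\bm A}(\cdot,\rho)$ is a positive definite function on $\mathbb{R}^n$.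
   Context: A density operator is a positive semidefinite operator of unit trace. $S_n$ is the group of permutations of $\{1,\dots,n\}$. Products $\prod_{j=1}^{n}T_j$ of operators are ordered as $T_1T_2\cdots T_n$. The function $\mathscr{C}_{\bm A}$ is called the multivariable quantum characteristic function. $\mathcal{S}(\mathbb{R}^n)$ is the Schwartz space, $\mathcal{S}'(\mathbb{R}^n)$ its dual (tempered distributions), and $\mathcal{E}'(\mathbb{R}^n)\subset\mathcal{S}'(\mathbb{R}^n)$ the space of distributions with compact support, i.e. the dual of $C^\infty(\mathbb{R}^n)$. The Fourier transform convention is $\hat u(\bm\theta)=\int_{\mathbb{R}^n}d^nx\,u(\bm x)e^{i\bm\theta\cdot\bm x}$, understood in the distributional sense; for $u\in\mathcal{E}'(\mathbb{R}^n)$ this is $\langle u,e^{i\bm\theta\cdot(\,\cdot\,)}\rangle$, and likewise $\int d^nx\,\varphi(\bm x)u(\bm x)$ denotes the pairing $\langle u,\varphi\rangle$ for $\varphi\in C^\infty(\mathbb{R}^n)$. A distribution $u\in\mathcal{E}'(\mathbb{R}^n)$ is real if $\langle u,\varphi\rangle\in\mathbb{R}$ for every real-valued $\varphi\in C^\infty(\mathbb{R}^n)$, and non-negative (a positive measure) if $\langle u,\varphi\rangle\ge 0$ for every $\varphi\ge 0$. A distribution $u\in\mathcal{E}'(\mathbb{R}^n)$ is called a quasiprobability distribution if it is real-valued only in the signed sense, i.e., it need not be non-negative, and satisfies $\langle u,1\rangle=1$. A continuous function $g:\mathbb{R}^n\to\mathbb{C}$ is positive definite if $\sum_{j,k=1}^{m}c_j\overline{c_k}\,g(\bm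 t_j-\bm t_k)\ge 0$ for every finite family $\{\bm t_k\}_{k=1}^m\subset\mathbb{R}^n$ and $\{c_k\}_{k=1}^m\subset\mathbb{C}$. *)

theory Defs
  imports "HOL-Analysis.Analysis" "HOL-Combinatorics.Permutations"
begin

section \<open>Complex Hilbert spaces and bounded operators\<close>

text \<open>
  The norm, the metric, completeness and the real vector space structure come from \<^class>\<open>banach\<close>.
  The inner product is linear in its second argument.  Positive definiteness is contained in
  \<open>cinner_self\<close>, and \<open>1 *\<^sub>C x = x\<close> in \<open>scaleR_eq_scaleC\<close>.
\<close>

class complex_hilbert_space = banach +
  fixes scaleC :: "complex \<Rightarrow> 'a \<Rightarrow> 'a" (infixr \<open>*\<^sub>C\<close> 75)
    and cinner :: "'a \<Rightarrow> 'a \<Rightarrow> complex"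
  assumes scaleC_add_right: "c *\<^sub>C (x + y) = c *\<^sub>C x + c *\<^sub>C y"
    and scaleC_add_left: "(c + d) *\<^sub>C x = c *\<^sub>C x + d *\<^sub>C x"
    and scaleC_scaleC: "c *\<^sub>C (d *\<^sub>C x) = (c * d) *\<^sub>C x"
    and scaleR_eq_scaleC: "r *\<^sub>R x = complex_of_real r *\<^sub>C x"
    and cinner_commute: "cinner x y = cnj (cinner y x)"
    and cinner_add_right: "cinner x (y + z) = cinner x y + cinner x z"
    and cinner_scaleC_right: "cinner x (c *\<^sub>C y) = c * cinner x y"
    and cinner_self: "cinner x x = complex_of_real ((norm x)\<^sup>2)"

text \<open>
  Elements of \<^typ>\<open>'h \<Rightarrow>\<^sub>L 'h\<close> are bounded real-linear maps, and their norm is the operator norm;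
  complex linearity is a separate requirement.
\<close>

definition clinear_op :: "('h::complex_hilbert_space \<Rightarrow>\<^sub>L 'h) \<Rightarrow> bool" where
  "clinear_op T \<longleftrightarrow> (\<forall>c x. blinfun_apply T (c *\<^sub>C x) = c *\<^sub>C blinfun_apply T x)"

definition selfadjoint_op :: "('h::complex_hilbert_space \<Rightarrow>\<^sub>L 'h) \<Rightarrow> bool" where
  "selfadjoint_op T \<longleftrightarrow> clinear_op T \<and>
     (\<forall>x y. cinner (blinfun_apply T x) y = cinner x (blinfun_apply T y))"

definition positive_op :: "('h::complex_hilbert_space \<Rightarrow>\<^sub>L 'h) \<Rightarrow> bool" where
  "positive_op T \<longleftrightarrow> clinear_op T \<and> (\<forall>x. cinner x (blinfun_apply T x) \<in> \<real>\<^sub>\<ge>\<^sub>0)"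

definition orthonormal_basis :: "'h::complex_hilbert_space set \<Rightarrow> bool" where
  "orthonormal_basis B \<longleftrightarrow>
     (\<forall>e\<in>B. \<forall>f\<in>B. cinner e f = (if e = f then 1 else 0)) \<and>
     (\<forall>x. (\<forall>e\<in>B. cinner e x = 0) \<longrightarrow> x = 0)"

text \<open>
  A bounded operator \<open>X\<close> on a complex Hilbert space is of trace class iff \<open>\<Sum>e\<in>B. \<langle>e, X e\<rangle>\<close>
  converges unconditionally for every orthonormal basis \<open>B\<close>, and the value of the sum is then
  independent of \<open>B\<close>.  So \<open>has_trace X t\<close> says that \<open>X\<close> is of trace class and has trace \<open>t\<close>.
\<close>

definition has_trace :: "('h::complex_hilbert_space \<Rightarrow>\<^sub>L 'h) \<Rightarrow> complex \<Rightarrow> bool" where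
  "has_trace X t \<longleftrightarrow>
     (\<forall>B. orthonormal_basis B \<longrightarrow> ((\<lambda>e. cinner e (blinfun_apply X e)) has_sum t) B)"

definition op_trace :: "('h::complex_hilbert_space \<Rightarrow>\<^sub>L 'h) \<Rightarrow> complex" where
  "op_trace X = (THE t. has_trace X t)"

definition density_operator :: "('h::complex_hilbert_space \<Rightarrow>\<^sub>L 'h) \<Rightarrow> bool" where
  "density_operator \<rho> \<longleftrightarrow> positive_op \<rho> \<and> has_trace \<rho> 1"

definition op_scaleC :: "complex \<Rightarrow> ('h::complex_hilbert_space \<Rightarrow>\<^sub>L 'h) \<Rightarrow> ('h \<Rightarrow>\<^sub>L 'h)" where
  "op_scaleC c T = Blinfun (\<lambda>x. c *\<^sub>C blinfun_apply T x)"

definition op_power :: "('h::real_normed_vector \<Rightarrow>\<^sub>L 'h) \<Rightarrow> nat \<Rightarrow> ('h \<Rightarrow>\<^sub>L 'h)" where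
  "op_power T k = ((\<lambda>X. T o\<^sub>L X) ^^ k) id_blinfun"

definition op_exp :: "('h::banach \<Rightarrow>\<^sub>L 'h) \<Rightarrow> ('h \<Rightarrow>\<^sub>L 'h)" where
  "op_exp T = (\<Sum>k. (1 / fact k) *\<^sub>R op_power T k)"


section \<open>The multivariable quantum characteristic function\<close>

text \<open>
  The index set \<open>{1..n}\<close> is rendered as an arbitrary finite linearly ordered type \<open>'n\<close>; its
  elements in increasing order are \<^term>\<open>sorted_list_of_set (UNIV :: 'n::{finite,linorder} set)\<close>.
\<close>

definition ordered_op_prod ::
  "('n::{finite,linorder} \<Rightarrow> ('h::real_normed_vector \<Rightarrow>\<^sub>L 'h)) \<Rightarrow> ('h \<Rightarrow>\<^sub>L 'h)" where
  "ordered_op_prod T = foldr (\<lambda>j X. T j o\<^sub>L X) (sorted_list_of_set UNIV) id_blinfun"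

definition quantum_char_op ::
  "nat \<Rightarrow> (('n \<Rightarrow> 'n) \<Rightarrow> complex) \<Rightarrow> ('n \<Rightarrow> ('h::complex_hilbert_space \<Rightarrow>\<^sub>L 'h)) \<Rightarrow>
   real ^ 'n::{finite,linorder} \<Rightarrow> ('h \<Rightarrow>\<^sub>L 'h)" where
  "quantum_char_op N w A \<theta> =
     op_power
       (\<Sum>\<sigma> | \<sigma> permutes UNIV.
          op_scaleC (w \<sigma>)
            (ordered_op_prod
               (\<lambda>j. op_exp (op_scaleC (\<i> * complex_of_real (\<theta> $ \<sigma> j) / of_nat N) (A (\<sigma> j))))))
       N"

definition quantum_char_fun ::
  "nat \<Rightarrow> (('n \<Rightarrow> 'n) \<Rightarrow> complex) \<Rightarrow> ('n \<Rightarrow> ('h::complex_hilbert_space \<Rightarrow>\<^sub>L 'h)) \<Rightarrow>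
   ('h \<Rightarrow>\<^sub>L 'h) \<Rightarrow> real ^ 'n::{finite,linorder} \<Rightarrow> complex" where
  "quantum_char_fun N w A \<rho> \<theta> = op_trace (quantum_char_op N w A \<theta> o\<^sub>L \<rho>)"


section \<open>Smooth functions\<close>

definition partial_deriv ::
  "'n::finite \<Rightarrow> (real ^ 'n::finite \<Rightarrow> complex) \<Rightarrow> (real ^ 'n::finite \<Rightarrow> complex)" where
  "partial_deriv j f x = vector_derivative (\<lambda>t. f (x + t *\<^sub>R axis j 1)) (at 0)"

text \<open>
  A function is \<open>C\<^sup>\<infinity>\<close> iff all its iterated partial derivatives, in any order of differentiation,
  are (totally) differentiable; they are then also continuous.
\<close>

definition smooth :: "(real ^ 'n::finite \<Rightarrow> complex) \<Rightarrow> bool" where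
  "smooth f \<longleftrightarrow> (\<forall>js. \<forall>x. foldr partial_deriv js f differentiable (at x))"

definition multi_deriv ::
  "('n::{finite,linorder} \<Rightarrow> nat) \<Rightarrow> (real ^ 'n::{finite,linorder} \<Rightarrow> complex) \<Rightarrow>
   (real ^ 'n::{finite,linorder} \<Rightarrow> complex)" where
  "multi_deriv \<alpha> f = foldr (\<lambda>j. partial_deriv j ^^ \<alpha> j) (sorted_list_of_set UNIV) f"


section \<open>Distributions with compact support\<close>

definition smooth_seminorm ::
  "(real ^ 'n::{finite,linorder}) set \<Rightarrow> nat \<Rightarrow> (real ^ 'n::{finite,linorder} \<Rightarrow> complex) \<Rightarrow> real" where
  "smooth_seminorm K m \<phi> =
     (\<Sum>\<alpha> | (\<Sum>j\<in>UNIV. \<alpha> j) \<le> m. SUP x\<in>K. norm (multi_deriv \<alpha> \<phi> x))"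

text \<open>
  The dual of \<open>C\<^sup>\<infinity>(\<real>\<^sup>n)\<close>: continuous complex-linear functionals, continuity being with respect to
  the seminorms \<^const>\<open>smooth_seminorm\<close>.  Since a functional is a total HOL function, it is fixed
  to be \<^term>\<open>undefined\<close> off \<open>C\<^sup>\<infinity>(\<real>\<^sup>n)\<close>, so that equality of functionals is equality on
  \<open>C\<^sup>\<infinity>(\<real>\<^sup>n)\<close>.
\<close>

definition compact_distributions ::
  "((real ^ 'n::{finite,linorder} \<Rightarrow> complex) \<Rightarrow> complex) set" where
  "compact_distributions = {u.
     u \<in> extensional {\<phi>. smooth \<phi>} \<and>
     (\<forall>\<phi> \<psi>. smooth \<phi> \<longrightarrow> smooth \<psi> \<longrightarrow> u (\<lambda>x. \<phi> x + \<psi> x) = u \<phi> + u \<psi>) \<and>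
     (\<forall>c \<phi>. smooth \<phi> \<longrightarrow> u (\<lambda>x. c * \<phi> x) = c * u \<phi>) \<and>
     (\<exists>K m C. compact K \<and> K \<noteq> {} \<and>
        (\<forall>\<phi>. smooth \<phi> \<longrightarrow> norm (u \<phi>) \<le> C * smooth_seminorm K m \<phi>))}"

definition distribution_support ::
  "((real ^ 'n::finite \<Rightarrow> complex) \<Rightarrow> complex) \<Rightarrow> (real ^ 'n::finite) set" where
  "distribution_support u = - \<Union>{U. open U \<and>
     (\<forall>\<phi>. smooth \<phi> \<and> compact (closure {x. \<phi> x \<noteq> 0}) \<and> closure {x. \<phi> x \<noteq> 0} \<subseteq> U
        \<longrightarrow> u \<phi> = 0)}"

definition distribution_fourier ::
  "((real ^ 'n::finite \<Rightarrow> complex) \<Rightarrow> complex) \<Rightarrow> real ^ 'n::finite \<Rightarrow> complex" where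
  "distribution_fourier u \<theta> = u (\<lambda>x. exp (\<i> * complex_of_real (\<theta> \<bullet> x)))"

definition real_distribution :: "((real ^ 'n::finite \<Rightarrow> complex) \<Rightarrow> complex) \<Rightarrow> bool" where
  "real_distribution u \<longleftrightarrow> (\<forall>\<phi>. smooth \<phi> \<and> (\<forall>x. \<phi> x \<in> \<real>) \<longrightarrow> u \<phi> \<in> \<real>)"

definition nonneg_distribution :: "((real ^ 'n::finite \<Rightarrow> complex) \<Rightarrow> complex) \<Rightarrow> bool" where
  "nonneg_distribution u \<longleftrightarrow> (\<forall>\<phi>. smooth \<phi> \<and> (\<forall>x. \<phi> x \<in> \<real>\<^sub>\<ge>\<^sub>0) \<longrightarrow> u \<phi> \<in> \<real>\<^sub>\<ge>\<^sub>0)"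

text \<open>
  A quasiprobability distribution is neither required to be non-negative nor to be real:
  for a general weight it is complex, and reality is equivalent to the Hermitian symmetry of its
  Fourier transform.
\<close>

definition quasiprobability_distribution ::
  "((real ^ 'n::{finite,linorder} \<Rightarrow> complex) \<Rightarrow> complex) \<Rightarrow> bool" where
  "quasiprobability_distribution u \<longleftrightarrow> u \<in> compact_distributions \<and> u (\<lambda>_. 1) = 1"

definition positive_definite_fun :: "(real ^ 'n::finite \<Rightarrow> complex) \<Rightarrow> bool" where
  "positive_definite_fun g \<longleftrightarrow> continuous_on UNIV g \<and>
     (\<forall>m::nat. \<forall>(t :: nat \<Rightarrow> real ^ 'n) (c :: nat \<Rightarrow> complex).
        (\<Sum>j<m. \<Sum>k<m. c j * cnj (c k) * g (t j - t k)) \<in> \<real>\<^sub>\<ge>\<^sub>0)"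

end

theory Submission
  imports Defs
begin

text \<open>
  A density operator is a sum of rank one operators \<open>|v\<^sub>i\<rangle>\<langle>v\<^sub>i|\<close>, so the
  characteristic function is \<open>\<Sum>\<^sub>i \<langle>v\<^sub>i, f(\<theta>) v\<^sub>i\<rangle>\<close>.  The existence of the distribution amounts to a
  bound of \<open>\<Sum>\<^sub>a c\<^sub>a f(\<theta>\<^sub>a)\<close> by finitely many derivatives of the trigonometric sum
  \<open>\<Sum>\<^sub>a c\<^sub>a e\<^bsup>i\<theta>\<^sub>a\<cdot>x\<^esup>\<close> on the box.  For a single self-adjoint operator \<open>A\<close> and vector-valued
  coefficients this bound comes from the Chebyshev expansion: the polynomials \<open>T\<^sub>k(A / \<parallel>A\<parallel>)\<close> are
  contractions by the Pell identity \<open>T\<^sub>k\<^sup>2 + (1 - x\<^sup>2) U\<^bsub>k-1\<^esub>\<^sup>2 = 1\<close>, and the coefficients decay like \<open>1 / k\<^sup>2\<close>.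
  The bound is stable under products and sums of operator families, the boxes adding up.  Since
  trigonometric sums are dense in \<open>C\<^sup>\<infinity>\<close>, the functional \<open>e\<^bsup>i\<theta>\<cdot>x\<^esup> \<mapsto> \<C>(\<theta>)\<close> extends uniquely to a
  distribution supported in the box.  Positive definiteness gives non-negativity because
  \<open>\<phi> + \<epsilon>\<close> is the square of the smooth function \<open>\<surd>(\<phi> + \<epsilon>)\<close>, a limit of trigonometric sums.
\<close>

section \<open>Inner products\<close>

text \<open>The \<open>A j\<close> need not commute, so no joint spectral measure is at hand and the
  estimates must survive operator products. This is why the coefficients are vectors: in
  \<open>F \<theta> o\<^sub>L G \<theta>\<close> the vectors produced by \<open>G \<theta>\<close>
  become the coefficients for \<open>F\<close>. The price is a loss of derivatives. If A is diagonal
  with n orthonormal eigenvectors e_i and eigenvalues s_i, a vector-valued f with f(s_i) = e_i can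
  have sup norm 1, while the sum of the components of f(s_i) along e_i has norm sqrt n; so a bound
  by the supremum alone cannot hold uniformly. Absolute summability of the Chebyshev coefficients
  repairs this at the cost of two derivatives per exponential. All suprema run over the real box, so
  the final bound yields the support directly, without growth estimates for complex \<theta>.
  Boundedness of the characteristic function is a separate and simpler matter: the exponentials are
  isometries and the weights have total modulus 1.\<close>

lemma scaleC_one [simp]: "1 *\<^sub>C x = (x::'a::complex_hilbert_space)"
  using scaleR_eq_scaleC[of 1 x] by simp

locale semi_inner_product =
  fixes B :: "'a::complex_hilbert_space \<Rightarrow> 'a \<Rightarrow> complex"
  assumes hermitian: "B x y = cnj (B y x)"
    and add_right: "B x (y + z) = B x y + B x z"
    and scaleC_right: "B x (c *\<^sub>C y) = c * B x y"
    and nonneg: "0 \<le> Re (B x x)"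
begin

lemma add_left: "B (x + y) z = B x z + B y z"
  by (metis add_right complex_cnj_add hermitian)

lemma scaleC_left: "B (c *\<^sub>C x) y = cnj c * B x y"
  by (metis scaleC_right complex_cnj_mult hermitian)

lemma self_of_real: "B x x = complex_of_real (Re (B x x))"
  using hermitian[of x x] by (metis Reals_cnj_iff of_real_Re)

lemma expand: "Re (B (x + c *\<^sub>C y) (x + c *\<^sub>C y)) =
  Re (B x x) + 2 * Re (c * B x y) + (cmod c)\<^sup>2 * Re (B y y)"
proof -
  have "B (x + c *\<^sub>C y) (x + c *\<^sub>C y) = B x x + c * B x y + cnj (c * B x y) + c * cnj c * B y y"
    unfolding add_left add_right scaleC_left scaleC_right
    by (subst hermitian[of y x]) (simp add: algebra_simps)
  then show ?thesis
    by (subst (asm) self_of_real[of y]) (simp add: complex_mult_cnj cmod_power2)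
qed

text \<open>Non-negativity of the form on x - t B(y,x) y is a quadratic inequality in t. For B(y,y)
  > 0 the minimizer t = 1 / B(y,y) gives the claim. A null vector y leaves an affine function of t,
  which stays non-negative for all t only if B(x,y) = 0.\<close>

lemma Cauchy_Schwarz: "(cmod (B x y))\<^sup>2 \<le> Re (B x x) * Re (B y y)"
proof -
  let ?m = "cmod (B x y)"
  have ge: "0 \<le> Re (B x x) - 2 * t * ?m\<^sup>2 + t\<^sup>2 * ?m\<^sup>2 * Re (B y y)" for t :: real
  proof -
    let ?c = "- of_real t * cnj (B x y)"
    have "?c * B x y = - of_real (t * ?m\<^sup>2)"
      by (simp add: complex_norm_square mult.commute del: of_real_power)
    then have "Re (?c * B x y) = - t * ?m\<^sup>2"
      by (metis Re_complex_of_real minus_mult_left uminus_complex.sel(1))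
    moreover have "(cmod ?c)\<^sup>2 = t\<^sup>2 * ?m\<^sup>2"
      by (simp add: norm_mult power_mult_distrib)
    ultimately show ?thesis
      using expand[of x ?c y] nonneg[of "x + ?c *\<^sub>C y"] by simp
  qed
  show ?thesis
  proof (cases "Re (B y y) = 0")
    case True
    have "?m = 0"
    proof (rule ccontr)
      assume "?m \<noteq> 0"
      then show False
        using ge[of "(Re (B x x) + 1) / (2 * ?m\<^sup>2)"] True by simp
    qed
    then show ?thesis using True by simp
  next
    case False
    then have pos: "Re (B y y) > 0" using nonneg[of y] by linarith
    have "0 \<le> Re (B x x) - ?m\<^sup>2 / Re (B y y)"
      using ge[of "1 / Re (B y y)"] pos by (simp add: power2_eq_square)
    then show ?thesis using pos by (simp add: field_simps)
  qed
qed

lemma triangle: "sqrt (Re (B (x + y) (x + y))) \<le> sqrt (Re (B x x)) + sqrt (Re (B y y))"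
proof -
  have "Re (B (x + y) (x + y)) = Re (B x x) + 2 * Re (B x y) + Re (B y y)"
    using expand[of x 1 y] by simp
  also have "Re (B x y) \<le> sqrt (Re (B x x) * Re (B y y))"
    using Cauchy_Schwarz[of x y] complex_Re_le_cmod[of "B x y"]
    by (meson order_trans real_le_rsqrt)
  finally have "Re (B (x + y) (x + y)) \<le> (sqrt (Re (B x x)) + sqrt (Re (B y y)))\<^sup>2"
    using nonneg by (simp add: power2_sum real_sqrt_mult)
  then show ?thesis
    by (intro real_le_lsqrt) (auto simp: nonneg)
qed

end

interpretation cinner_form: semi_inner_product "cinner :: 'a::complex_hilbert_space \<Rightarrow> 'a \<Rightarrow> complex"
  by unfold_locales (auto simp: cinner_add_right cinner_scaleC_right cinner_self intro: cinner_commute)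

lemma cinner_scaleC_left [simp]: "cinner (c *\<^sub>C x) y = cnj c * cinner x y"
  by (rule cinner_form.scaleC_left)

declare cinner_scaleC_right [simp]

lemma cmod_cinner_le: "cmod (cinner x y) \<le> norm x * norm y"
  using cinner_form.Cauchy_Schwarz[of x y]
  by (simp add: cinner_self power_mult_distrib[symmetric] power2_le_iff_abs_le)

lemma norm_scaleC [simp]: "norm (c *\<^sub>C x) = cmod c * norm (x::'a::complex_hilbert_space)"
proof -
  have "complex_of_real ((norm (c *\<^sub>C x))\<^sup>2) = of_real ((cmod c * norm x)\<^sup>2)"
  proof -
    have "cinner (c *\<^sub>C x) (c *\<^sub>C x) = (c * cnj c) * cinner x x" by simp
    then show ?thesis
      by (simp only: cinner_self complex_norm_square[symmetric] power_mult_distrib of_real_mult of_real_power)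
  qed
  then show ?thesis
    by (metis norm_ge_zero mult_nonneg_nonneg of_real_eq_iff power2_eq_imp_eq)
qed

interpretation cinner: bounded_bilinear "cinner :: 'a::complex_hilbert_space \<Rightarrow> 'a \<Rightarrow> complex"
proof
  show "cinner (r *\<^sub>R a) b = r *\<^sub>R cinner a b" "cinner a (r *\<^sub>R b) = r *\<^sub>R cinner a b"
    for r and a b :: 'a
    by (simp_all add: scaleR_eq_scaleC scaleR_conv_of_real)
  show "\<exists>K. \<forall>a b :: 'a. norm (cinner a b) \<le> norm a * norm b * K"
    by (rule exI[of _ 1]) (simp add: cmod_cinner_le)
qed (simp_all add: cinner_form.add_left cinner_add_right)

interpretation scaleC: bounded_bilinear "scaleC :: complex \<Rightarrow> 'a::complex_hilbert_space \<Rightarrow> 'a"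
proof
  show "(r *\<^sub>R a) *\<^sub>C b = r *\<^sub>R a *\<^sub>C b" "a *\<^sub>C (r *\<^sub>R b) = r *\<^sub>R a *\<^sub>C b" for r a and b :: 'a
    by (simp_all add: scaleR_eq_scaleC scaleC_scaleC scaleR_conv_of_real mult.commute)
  show "\<exists>K. \<forall>a. \<forall>b :: 'a. norm (a *\<^sub>C b) \<le> norm a * norm b * K"
    by (rule exI[of _ 1]) simp
qed (simp_all add: scaleC_add_left scaleC_add_right)

declare cinner.zero_left [simp] cinner.zero_right [simp] scaleC.zero_left [simp] scaleC.zero_right [simp]

lemma cinner_self_eq_0_iff: "cinner x x = 0 \<longleftrightarrow> x = 0"
  by (simp add: cinner_self)

lemma norm_sq_eq_Re_cinner: "(norm x)\<^sup>2 = Re (cinner x x)"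
  by (simp add: cinner_self)

lemma norm_add_scaleC_sq:
  "(norm (x + c *\<^sub>C y))\<^sup>2 = (norm x)\<^sup>2 + 2 * Re (c * cinner x y) + (cmod c)\<^sup>2 * (norm y)\<^sup>2"
  using cinner_form.expand[of x c y] by (simp add: norm_sq_eq_Re_cinner)

lemma norm_diff_sq: "(norm (x - y))\<^sup>2 = (norm x)\<^sup>2 - 2 * Re (cinner x y) + (norm y)\<^sup>2"
  using norm_add_scaleC_sq[of x "-1" y] by (simp add: scaleC.minus_left)

lemma cinner_ext: "(\<And>z. cinner z x = cinner z y) \<Longrightarrow> x = y"
  by (metis cinner.diff_right cinner_self_eq_0_iff eq_iff_diff_eq_0)

section \<open>Orthonormal bases\<close>

definition orthonormal_set :: "'h::complex_hilbert_space set \<Rightarrow> bool" where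
  "orthonormal_set B \<longleftrightarrow> (\<forall>e\<in>B. \<forall>f\<in>B. cinner e f = (if e = f then 1 else 0))"

lemma orthonormal_basis_imp_set: "orthonormal_basis B \<Longrightarrow> orthonormal_set B"
  by (simp add: orthonormal_basis_def orthonormal_set_def)

text \<open>A maximal orthonormal set is a basis, because a non-zero vector orthogonal to it could
  be normalized and adjoined. The space may be non-separable, so the basis is a possibly uncountable
  set.\<close>

lemma ex_orthonormal_basis: "\<exists>B :: 'h::complex_hilbert_space set. orthonormal_basis B"
proof -
  let ?A = "{B :: 'h set. orthonormal_set B}"
  have "\<exists>M\<in>?A. \<forall>X\<in>?A. M \<subseteq> X \<longrightarrow> X = M"
  proof (rule Zorn_Lemma, rule ballI)
    fix C assume "C \<in> chains ?A"
    then have C: "\<And>X. X \<in> C \<Longrightarrow> orthonormal_set X" and ch: "\<And>X Y. X \<in> C \<Longrightarrow> Y \<in> C \<Longrightarrow> X \<subseteq> Y \<or> Y \<subseteq> X"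
      by (auto simp: chains_def chain_subset_def)
    have "orthonormal_set (\<Union>C)"
      unfolding orthonormal_set_def
    proof safe
      fix e f X Y assume "e \<in> X" "X \<in> C" "f \<in> Y" "Y \<in> C"
      then obtain Z where "Z \<in> C" "e \<in> Z" "f \<in> Z" using ch by blast
      then show "cinner e f = (if e = f then 1 else 0)"
        using C unfolding orthonormal_set_def by blast
    qed
    then show "\<Union>C \<in> ?A" by simp
  qed
  then obtain M where M: "orthonormal_set M"
    and max: "\<forall>X\<in>?A. M \<subseteq> X \<longrightarrow> X = M"
    by blast
  have "x = 0" if orth: "\<forall>e\<in>M. cinner e x = 0" for x
  proof (rule ccontr)
    assume "x \<noteq> 0"
    define y where "y = complex_of_real (1 / norm x) *\<^sub>C x"
    have yy: "cinner y y = 1"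
      using \<open>x \<noteq> 0\<close> by (simp add: y_def cinner_self norm_divide)
    have ey: "cinner e y = 0" "cinner y e = 0" if "e \<in> M" for e
      using orth that cinner_commute[of x e] by (auto simp: y_def)
    have "orthonormal_set (insert y M)"
      using M yy ey unfolding orthonormal_set_def by auto
    then have "insert y M = M" using max by (metis mem_Collect_eq subset_insertI)
    then have "y \<in> M" by blast
    then show False using ey yy by force
  qed
  then show ?thesis
    using M unfolding orthonormal_basis_def orthonormal_set_def by blast
qed

context
  fixes B :: "'h::complex_hilbert_space set"
  assumes ons: "orthonormal_set B"
begin

lemma cinner_sum_orthonormal:
  assumes "finite F" "F \<subseteq> B" "e \<in> B"
  shows "cinner e (\<Sum>f\<in>F. c f *\<^sub>C f) = (if e \<in> F then c e else 0)"
proof -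
  have "cinner e (\<Sum>f\<in>F. c f *\<^sub>C f) = (\<Sum>f\<in>F. if f = e then c f else 0)"
    unfolding cinner.sum_right
    by (rule sum.cong) (use assms ons in \<open>auto simp: orthonormal_set_def\<close>)
  then show ?thesis using assms by simp
qed

lemma norm_sum_orthonormal:
  assumes "finite F" "F \<subseteq> B"
  shows "(norm (\<Sum>f\<in>F. c f *\<^sub>C f))\<^sup>2 = (\<Sum>f\<in>F. (cmod (c f))\<^sup>2)"
proof -
  have "complex_of_real ((norm (\<Sum>f\<in>F. c f *\<^sub>C f))\<^sup>2) = (\<Sum>e\<in>F. cnj (c e) * c e)"
    unfolding cinner_self[symmetric]
    by (subst cinner.sum_left, rule sum.cong)
       (use assms in \<open>auto simp: subset_iff cinner_sum_orthonormal\<close>)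
  also have "\<dots> = complex_of_real (\<Sum>f\<in>F. (cmod (c f))\<^sup>2)"
    unfolding of_real_sum by (simp only: complex_norm_square mult.commute)
  finally show ?thesis by (simp only: of_real_eq_iff)
qed

lemma Bessel:
  assumes "finite F" "F \<subseteq> B"
  shows "(\<Sum>e\<in>F. (cmod (cinner e x))\<^sup>2) \<le> (norm x)\<^sup>2"
proof -
  let ?y = "\<Sum>e\<in>F. cinner e x *\<^sub>C e"
  have "cinner x ?y = (\<Sum>e\<in>F. cinner e x * cnj (cinner e x))"
    by (simp add: cinner.sum_right cinner_commute[of x])
  also have "\<dots> = complex_of_real (\<Sum>e\<in>F. (cmod (cinner e x))\<^sup>2)"
    unfolding of_real_sum by (simp only: complex_norm_square)
  finally have "Re (cinner x ?y) = (\<Sum>e\<in>F. (cmod (cinner e x))\<^sup>2)" by simp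
  then have "(norm (x - ?y))\<^sup>2 = (norm x)\<^sup>2 - (\<Sum>e\<in>F. (cmod (cinner e x))\<^sup>2)"
    using norm_diff_sq[of x ?y] norm_sum_orthonormal[OF assms] by simp
  then show ?thesis by (smt (verit) zero_le_power2)
qed

lemma Bessel_summable: "(\<lambda>e. (cmod (cinner e x))\<^sup>2) summable_on B"
  by (rule nonneg_bdd_above_summable_on) (auto intro!: bdd_aboveI2[of _ _ "(norm x)\<^sup>2"] Bessel)

text \<open>By Bessel the squared coefficients are summable, and the norm of a finite partial sum is
  the l2 norm of its coefficients; hence the net of partial sums is Cauchy and completeness gives a
  limit.\<close>

lemma orthonormal_expansion_summable: "(\<lambda>e. cinner e x *\<^sub>C e) summable_on B"
proof -
  let ?f = "\<lambda>e. cinner e x *\<^sub>C e" and ?g = "\<lambda>e. (cmod (cinner e x))\<^sup>2"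
  obtain S where S: "(?g has_sum S) B" using Bessel_summable summable_on_def by blast
  have "cauchy_filter (filtermap (sum ?f) (finite_subsets_at_top B))"
    unfolding cauchy_filter_metric_filtermap
  proof safe
    fix \<epsilon> :: real assume "\<epsilon> > 0"
    \<comment> \<open>Two partial sums this close to \<open>S\<close> differ by less than
      (\<epsilon>/2)^2, the square of the wanted norm distance \<epsilon>/2.\<close>
    then have "\<forall>\<^sub>F F in finite_subsets_at_top B. dist (sum ?g F) S < (\<epsilon>/2)\<^sup>2 / 2"
      using S unfolding has_sum_def by (intro tendstoD) auto
    then obtain X where X: "finite X" "X \<subseteq> B"
      and XF: "\<And>F. finite F \<Longrightarrow> X \<subseteq> F \<Longrightarrow> F \<subseteq> B \<Longrightarrow> dist (sum ?g F) S < (\<epsilon>/2)\<^sup>2 / 2"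
      unfolding eventually_finite_subsets_at_top by metis
    have close: "dist (sum ?f F) (sum ?f X) < \<epsilon> / 2" if F: "finite F" "X \<subseteq> F" "F \<subseteq> B" for F
    proof -
      have "sum ?f F - sum ?f X = sum ?f (F - X)" "sum ?g F - sum ?g X = sum ?g (F - X)"
        using F X by (simp_all add: sum_diff)
      moreover have "(norm (sum ?f (F - X)))\<^sup>2 = sum ?g (F - X)"
        using F by (intro norm_sum_orthonormal) auto
      moreover have "sum ?g F - sum ?g X < (\<epsilon>/2)\<^sup>2"
        using XF[OF F] XF[OF X(1) subset_refl X(2)] unfolding dist_real_def by linarith
      ultimately show ?thesis
        using \<open>\<epsilon> > 0\<close> unfolding dist_norm
        by (intro power_less_imp_less_base[of "norm (sum ?f F - sum ?f X)" 2 "\<epsilon> / 2"]) simp_all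
    qed
    show "\<exists>P. eventually P (finite_subsets_at_top B) \<and>
        (\<forall>F F'. P F \<and> P F' \<longrightarrow> dist (sum ?f F) (sum ?f F') < \<epsilon>)"
    proof (intro exI conjI allI impI)
      show "\<forall>\<^sub>F F in finite_subsets_at_top B. finite F \<and> X \<subseteq> F \<and> F \<subseteq> B"
        using X unfolding eventually_finite_subsets_at_top by blast
      show "dist (sum ?f F) (sum ?f F') < \<epsilon>"
        if "(finite F \<and> X \<subseteq> F \<and> F \<subseteq> B) \<and> (finite F' \<and> X \<subseteq> F' \<and> F' \<subseteq> B)" for F F'
        using close[of F] close[of F'] that dist_triangle_half_l by blast
    qed
  qed
  then obtain y where "filtermap (sum ?f) (finite_subsets_at_top B) \<le> nhds y"
    using cauchy_filter_complete_converges[of "filtermap (sum ?f) (finite_subsets_at_top B)" "UNIV :: 'h set"]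
    by (force simp: filtermap_bot_iff complete_UNIV)
  then show ?thesis
    by (auto simp: summable_on_def has_sum_def filterlim_def)
qed

end

context
  fixes B :: "'h::complex_hilbert_space set"
  assumes onb: "orthonormal_basis B"
begin

lemma orthonormal_expansion: "((\<lambda>e. cinner e x *\<^sub>C e) has_sum x) B"
proof -
  note ons = orthonormal_basis_imp_set[OF onb]
  obtain y where y: "((\<lambda>e. cinner e x *\<^sub>C e) has_sum y) B"
    using orthonormal_expansion_summable[OF ons] summable_on_def by blast
  have "cinner f (x - y) = 0" if "f \<in> B" for f
  proof -
    have "((\<lambda>e. cinner f (cinner e x *\<^sub>C e)) has_sum cinner f y) B"
      by (rule has_sum_bounded_linear[OF cinner.bounded_linear_right y])
    moreover have "((\<lambda>e. cinner f (cinner e x *\<^sub>C e)) has_sum cinner f x) B"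
    proof (rule has_sum_finite_neutralI[of "{f}"])
      show "cinner f x = (\<Sum>e\<in>{f}. cinner f (cinner e x *\<^sub>C e))"
        using that ons by (simp add: orthonormal_set_def)
      show "\<And>e. e \<in> B - {f} \<Longrightarrow> cinner f (cinner e x *\<^sub>C e) = 0"
        using that ons by (auto simp: orthonormal_set_def)
    qed (use that in auto)
    ultimately show ?thesis
      using has_sum_unique by (simp add: cinner.diff_right) blast
  qed
  then have "x = y" using onb unfolding orthonormal_basis_def by (metis eq_iff_diff_eq_0)
  then show ?thesis using y by simp
qed

lemma Parseval: "((\<lambda>e. cinner y e * cinner e x) has_sum cinner y x) B"
  using has_sum_bounded_linear[OF cinner.bounded_linear_right orthonormal_expansion, of y x]
  by (simp add: mult.commute)

lemma Parseval_norm: "((\<lambda>e. (cmod (cinner e x))\<^sup>2) has_sum (norm x)\<^sup>2) B"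
proof -
  have "((\<lambda>e. cinner x e * cinner e x) has_sum cinner x x) B" by (rule Parseval)
  also have "(\<lambda>e. cinner x e * cinner e x) = (\<lambda>e. complex_of_real ((cmod (cinner e x))\<^sup>2))"
    by (rule ext) (simp only: complex_norm_square cinner_commute[of x] mult.commute)
  finally show ?thesis
    unfolding cinner_self using has_sum_of_real_iff by blast
qed

text \<open>This bound, uniform in the basis, supplies the domination for interchanging the basis
  sum with the sum over the vectors \<open>v i\<close> in the trace formula.\<close>

lemma Parseval_abs:
  "(\<lambda>e. cmod (cinner y e) * cmod (cinner e x)) summable_on B"
  "infsum (\<lambda>e. cmod (cinner y e) * cmod (cinner e x)) B \<le> norm y * norm x"
proof -
  have bd: "(\<Sum>e\<in>F. cmod (cinner y e) * cmod (cinner e x)) \<le> norm y * norm x"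
    if "finite F" "F \<subseteq> B" for F
  proof -
    have "(\<Sum>e\<in>F. cmod (cinner y e) * cmod (cinner e x)) = (\<Sum>e\<in>F. cmod (cinner e y) * cmod (cinner e x))"
      by (rule sum.cong) (metis cinner_commute complex_mod_cnj)+
    also have "\<dots> = (\<Sum>e\<in>F. \<bar>cmod (cinner e y)\<bar> * \<bar>cmod (cinner e x)\<bar>)" by simp
    also have "\<dots> \<le> L2_set (\<lambda>e. cmod (cinner e y)) F * L2_set (\<lambda>e. cmod (cinner e x)) F"
      by (rule L2_set_mult_ineq)
    also have "\<dots> \<le> norm y * norm x"
      unfolding L2_set_def using Bessel[OF orthonormal_basis_imp_set[OF onb] that]
      by (intro mult_mono real_le_lsqrt) (auto intro!: sum_nonneg)
    finally show ?thesis .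
  qed
  show s: "(\<lambda>e. cmod (cinner y e) * cmod (cinner e x)) summable_on B"
    by (rule nonneg_bdd_above_summable_on) (auto intro!: bdd_aboveI2[of _ _ "norm y * norm x"] bd)
  show "infsum (\<lambda>e. cmod (cinner y e) * cmod (cinner e x)) B \<le> norm y * norm x"
    by (rule infsum_le_finite_sums[OF s]) (use bd in auto)
qed

end

section \<open>Density operators\<close>

text \<open>A plain function instead of a bounded operator: the Cholesky residuals below then need
  no boundedness proof, and additivity and homogeneity are recovered from the form by
  \<open>cinner_ext\<close>.\<close>

definition psd_map :: "('h::complex_hilbert_space \<Rightarrow> 'h) \<Rightarrow> bool" where
  "psd_map P \<longleftrightarrow> semi_inner_product (\<lambda>x y. cinner x (P y))"

lemma clinear_opD: "clinear_op T \<Longrightarrow> blinfun_apply T (c *\<^sub>C x) = c *\<^sub>C blinfun_apply T x"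
  by (simp add: clinear_op_def)

text \<open>Polarization on a complex space: reality of <z, P z> at z = x + y and at z = x + i y
  yields the imaginary and the real part of hermitian symmetry.\<close>

lemma positive_op_imp_psd_map:
  fixes P :: "'h::complex_hilbert_space \<Rightarrow>\<^sub>L 'h"
  assumes "positive_op P"
  shows "psd_map (blinfun_apply P)"
proof -
  let ?f = "\<lambda>x y. cinner x (P y)"
  have lin: "P (c *\<^sub>C x) = c *\<^sub>C P x" for c x
    using assms by (simp add: positive_op_def clinear_op_def)
  have pos: "Re (?f x x) \<ge> 0" "Im (?f x x) = 0" for x
    using assms by (auto simp: positive_op_def complex_nonneg_Reals_iff)
  have im: "Im (?f x y) + Im (?f y x) = 0" for x y
    using pos(2)[of "x + y"] pos(2)[of x] pos(2)[of y]
    by (simp add: blinfun.add_right cinner.add_left cinner.add_right)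
  have re: "Re (?f x y) - Re (?f y x) = 0" for x y
    using pos(2)[of "x + \<i> *\<^sub>C y"] pos(2)[of x] pos(2)[of y]
    by (simp add: blinfun.add_right cinner.add_left cinner.add_right lin)
  have herm: "?f x y = cnj (?f y x)" for x y
    using re[of x y] im[of x y] unfolding complex_eq_iff cnj.simps by (intro conjI) linarith+
  show ?thesis
    unfolding psd_map_def
  proof (unfold_locales, rule herm)
  qed (simp_all add: pos blinfun.add_right cinner.add_right lin)
qed

section \<open>Cholesky factorization of a positive form by successive pivots\<close>

definition cholesky_vec :: "('h::complex_hilbert_space \<Rightarrow> 'h) \<Rightarrow> 'h \<Rightarrow> 'h" where
  "cholesky_vec P e = complex_of_real (1 / sqrt (Re (cinner e (P e)))) *\<^sub>C P e"

definition cholesky_step :: "('h::complex_hilbert_space \<Rightarrow> 'h) \<Rightarrow> 'h \<Rightarrow> ('h \<Rightarrow> 'h)" where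
  "cholesky_step P e = (\<lambda>x. P x - cinner (cholesky_vec P e) x *\<^sub>C cholesky_vec P e)"

context
  fixes P :: "'h::complex_hilbert_space \<Rightarrow> 'h"
  assumes psd: "psd_map P"
begin

interpretation semi_inner_product "\<lambda>x y. cinner x (P y)"
  using psd by (simp add: psd_map_def)

lemma psd_map_add: "P (x + y) = P x + P y"
  by (rule cinner_ext) (simp add: add_right cinner_add_right)

lemma psd_map_scaleC: "P (c *\<^sub>C x) = c *\<^sub>C P x"
  by (rule cinner_ext) (simp add: scaleC_right)

lemma psd_map_zero: "P 0 = 0"
  using psd_map_scaleC[of 0 0] by simp

lemma psd_map_sum: "P (\<Sum>i\<in>F. f i) = (\<Sum>i\<in>F. P (f i))"
  by (induction F rule: infinite_finite_induct) (simp_all add: psd_map_zero psd_map_add)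

lemma psd_map_hermitian: "cinner x (P y) = cnj (cinner y (P x))"
  by (rule hermitian)

text \<open>Cauchy-Schwarz for the form at P e and e. It covers the zero pivot: there 1 / 0 = 0
  makes \<open>cholesky_vec P e\<close> vanish, and nothing is left to eliminate because P e =
  0.\<close>

lemma psd_map_eq_0: "Re (cinner e (P e)) = 0 \<Longrightarrow> P e = 0"
  using Cauchy_Schwarz[of "P e" e] by (simp add: cinner_self_eq_0_iff)

lemma cholesky_step_form:
  "cinner x (cholesky_step P e y) =
     cinner x (P y) - cinner x (cholesky_vec P e) * cinner (cholesky_vec P e) y"
  by (simp add: cholesky_step_def cinner.diff_right)

text \<open>Cauchy-Schwarz for the form, divided by the pivot <e, P e>. This keeps the residual
  positive after the rank one term is subtracted.\<close>

lemma cholesky_vec_le: "(cmod (cinner (cholesky_vec P e) x))\<^sup>2 \<le> Re (cinner x (P x))"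
proof (cases "Re (cinner e (P e)) = 0")
  case True
  then show ?thesis by (simp add: cholesky_vec_def nonneg)
next
  case False
  then have q: "Re (cinner e (P e)) > 0" using nonneg[of e] by simp
  have "(cmod (cinner (cholesky_vec P e) x))\<^sup>2 = (cmod (cinner (P e) x))\<^sup>2 / Re (cinner e (P e))"
    using q by (simp add: cholesky_vec_def norm_mult norm_divide power_divide)
  also have "cmod (cinner (P e) x) = cmod (cinner x (P e))"
    by (metis cinner_commute complex_mod_cnj)
  also have "(cmod (cinner x (P e)))\<^sup>2 / Re (cinner e (P e)) \<le> Re (cinner x (P x))"
    using Cauchy_Schwarz[of x e] q by (simp add: field_simps)
  finally show ?thesis .
qed

lemma psd_map_cholesky_step: "psd_map (cholesky_step P e)"
  unfolding psd_map_def
proof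
  let ?v = "cholesky_vec P e"
  fix x y z c
  show "cinner x (cholesky_step P e y) = cnj (cinner y (cholesky_step P e x))"
    unfolding cholesky_step_form
    by (subst hermitian, subst (1 2) cinner_commute) (simp add: mult.commute)
  show "cinner x (cholesky_step P e (y + z)) = cinner x (cholesky_step P e y) + cinner x (cholesky_step P e z)"
    by (simp add: cholesky_step_form add_right cinner_add_right algebra_simps)
  show "cinner x (cholesky_step P e (c *\<^sub>C y)) = c * cinner x (cholesky_step P e y)"
    by (simp add: cholesky_step_form scaleC_right algebra_simps)
  have "cinner x ?v * cinner ?v x = complex_of_real ((cmod (cinner ?v x))\<^sup>2)"
    by (subst cinner_commute) (simp only: complex_norm_square mult.commute)
  then show "0 \<le> Re (cinner x (cholesky_step P e x))"
    using cholesky_vec_le[of e x] by (simp add: cholesky_step_form)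
qed

lemma cholesky_step_self: "cholesky_step P e e = 0"
proof (cases "Re (cinner e (P e)) = 0")
  case True
  then show ?thesis by (simp add: cholesky_step_def cholesky_vec_def psd_map_eq_0)
next
  case False
  then have q: "Re (cinner e (P e)) > 0" using nonneg[of e] by simp
  let ?s = "complex_of_real (1 / sqrt (Re (cinner e (P e))))"
  have "cinner (P e) e = of_real (Re (cinner e (P e)))"
    using self_of_real[of e] by (metis cinner_commute complex_cnj_complex_of_real)
  moreover have "?s * (?s * of_real (Re (cinner e (P e)))) = 1"
    unfolding of_real_mult[symmetric] using q by (simp add: field_simps)
  ultimately have "cinner (cholesky_vec P e) e *\<^sub>C cholesky_vec P e = P e"
    unfolding cholesky_vec_def by (simp add: scaleC_scaleC mult.commute mult.left_commute del: of_real_divide)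
  then show ?thesis by (simp add: cholesky_step_def)
qed

text \<open>By symmetry f is orthogonal to P e, hence to the new column. Directions eliminated by
  earlier pivots therefore stay eliminated.\<close>

lemma cholesky_step_kernel: "P f = 0 \<Longrightarrow> cholesky_step P e f = 0"
proof -
  assume "P f = 0"
  then have "cinner f (P e) = 0" by (subst psd_map_hermitian) simp
  then have "cinner (P e) f = 0" by (metis cinner_commute complex_cnj_zero)
  then show ?thesis using \<open>P f = 0\<close> by (simp add: cholesky_step_def cholesky_vec_def)
qed

end

primrec cholesky :: "('h::complex_hilbert_space \<Rightarrow> 'h) \<Rightarrow> (nat \<Rightarrow> 'h) \<Rightarrow> nat \<Rightarrow> ('h \<Rightarrow> 'h)" where
  "cholesky P e 0 = P"
| "cholesky P e (Suc k) = cholesky_step (cholesky P e k) (e k)"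

context
  fixes P :: "'h::complex_hilbert_space \<Rightarrow> 'h" and e :: "nat \<Rightarrow> 'h"
  assumes psd: "psd_map P"
begin

lemma psd_map_cholesky: "psd_map (cholesky P e k)"
  by (induction k) (simp_all add: psd psd_map_cholesky_step)

lemma cholesky_kernel: "P f = 0 \<Longrightarrow> cholesky P e k f = 0"
  by (induction k) (simp_all add: psd_map_cholesky cholesky_step_kernel)

lemma cholesky_eq_0: "i < k \<Longrightarrow> cholesky P e k (e i) = 0"
  by (induction k) (auto simp: less_Suc_eq psd_map_cholesky cholesky_step_kernel cholesky_step_self)

lemma cholesky_form:
  "cinner x (P y) = cinner x (cholesky P e k y) +
     (\<Sum>i<k. cinner x (cholesky_vec (cholesky P e i) (e i)) * cinner (cholesky_vec (cholesky P e i) (e i)) y)"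
  by (induction k) (simp_all add: psd_map_cholesky cholesky_step_form)

lemma cholesky_decreasing: "Re (cinner x (cholesky P e k x)) \<le> Re (cinner x (P x))"
proof -
  have "Re (cinner x v * cinner v x) \<ge> 0" for v
  proof -
    have "cinner x v * cinner v x = complex_of_real ((cmod (cinner v x))\<^sup>2)"
      by (subst cinner_commute) (simp only: complex_norm_square mult.commute)
    then show ?thesis by simp
  qed
  then have "Re (\<Sum>i<k. cinner x (cholesky_vec (cholesky P e i) (e i)) * cinner (cholesky_vec (cholesky P e i) (e i)) x) \<ge> 0"
    unfolding Re_sum by (intro sum_nonneg)
  then show ?thesis using cholesky_form[of x x k] by simp
qed

text \<open>A finite combination y of basis vectors is annihilated by all late residuals. The
  triangle inequality for the residual form then bounds its value at x by its value at x - y, and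
  this is at most M times the squared norm of x - y because the residuals decrease.\<close>

lemma cholesky_tendsto_0:
  assumes bd: "\<And>x. Re (cinner x (P x)) \<le> M * (norm x)\<^sup>2"
    and onb: "orthonormal_basis B"
    and B: "\<And>f. f \<in> B \<Longrightarrow> P f = 0 \<or> f \<in> range e"
  shows "(\<lambda>k. Re (cinner x (cholesky P e k x))) \<longlonglongrightarrow> 0"
proof (rule LIMSEQ_I)
  fix r :: real assume "r > 0"
  define M' where "M' = \<bar>M\<bar> + 1"
  have M': "M' > 0" and bd': "Re (cinner x (P x)) \<le> M' * (norm x)\<^sup>2" for x
  proof -
    show "M' > 0" by (simp add: M'_def)
    have "M * (norm x)\<^sup>2 \<le> M' * (norm x)\<^sup>2" by (rule mult_right_mono) (simp_all add: M'_def)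
    then show "Re (cinner x (P x)) \<le> M' * (norm x)\<^sup>2" using bd[of x] by simp
  qed
  \<comment> \<open>Chosen so that M' \<delta>^2 = r / 2; \<open>M'\<close> replaces
    \<open>M\<close> in order to be positive.\<close>
  define \<delta> where "\<delta> = sqrt (r / (2 * M'))"
  have \<delta>: "\<delta> > 0" "M' * \<delta>\<^sup>2 < r" using \<open>r > 0\<close> M' by (simp_all add: \<delta>_def)
  obtain F where F: "finite F" "F \<subseteq> B" "norm ((\<Sum>f\<in>F. cinner f x *\<^sub>C f) - x) \<le> \<delta>"
    using has_sum_finite_approximation[OF orthonormal_expansion[OF onb, of x] \<delta>(1)]
    unfolding dist_norm by blast
  define y where "y = (\<Sum>f\<in>F. cinner f x *\<^sub>C f)"
  have "\<exists>k0. \<forall>k\<ge>k0. cholesky P e k f = 0" if f: "f \<in> B" for f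
  proof (cases "P f = 0")
    case False
    then obtain i where "f = e i" using B[OF f] by blast
    then show ?thesis using cholesky_eq_0 by (intro exI[of _ "Suc i"]) auto
  qed (use cholesky_kernel in blast)
  then obtain k0 where k0: "\<And>f k. f \<in> B \<Longrightarrow> k \<ge> k0 f \<Longrightarrow> cholesky P e k f = 0" by metis
  show "\<exists>no. \<forall>k\<ge>no. norm (Re (cinner x (cholesky P e k x)) - 0) < r"
  proof (intro exI allI impI)
    fix k assume k: "k \<ge> sum k0 F"
    interpret semi_inner_product "\<lambda>x y. cinner x (cholesky P e k y)"
      using psd_map_cholesky[of k] by (simp add: psd_map_def)
    have "cholesky P e k f = 0" if "f \<in> F" for f
      using k0[of f k] F that k member_le_sum[of f F k0] by fastforce
    then have Py: "cholesky P e k y = 0"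
      unfolding y_def by (simp add: psd_map_sum[OF psd_map_cholesky] psd_map_scaleC[OF psd_map_cholesky])
    have "Re (cinner (x - y) (cholesky P e k (x - y))) \<le> M' * (norm (x - y))\<^sup>2"
      using cholesky_decreasing[of "x - y" k] bd'[of "x - y"] by linarith
    also have "\<dots> \<le> M' * \<delta>\<^sup>2"
      using F(3) M' by (intro mult_left_mono power_mono) (simp_all add: y_def norm_minus_commute)
    finally have 1: "Re (cinner (x - y) (cholesky P e k (x - y))) < r" using \<delta> by simp
    have "sqrt (Re (cinner x (cholesky P e k x))) \<le> sqrt (Re (cinner (x - y) (cholesky P e k (x - y))))"
      using triangle[of "x - y" y] Py by simp
    then show "norm (Re (cinner x (cholesky P e k x)) - 0) < r"
      using 1 nonneg[of x] by simp
  qed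
qed

text \<open>The residual tends to zero on the diagonal; Cauchy-Schwarz for the residual form extends
  this to mixed arguments x, y, and \<open>cholesky_form\<close> reads the outcome as a convergent
  series.\<close>

lemma cholesky_sums:
  assumes bd: "\<And>x. Re (cinner x (P x)) \<le> M * (norm x)\<^sup>2"
    and onb: "orthonormal_basis B"
    and B: "\<And>f. f \<in> B \<Longrightarrow> P f = 0 \<or> f \<in> range e"
  shows "(\<lambda>i. cinner x (cholesky_vec (cholesky P e i) (e i)) * cinner (cholesky_vec (cholesky P e i) (e i)) y)
           sums cinner x (P y)"
proof -
  let ?q = "\<lambda>x k. Re (cinner x (cholesky P e k x))"
  have "(\<lambda>k. cmod (cinner x (cholesky P e k y))) \<longlonglongrightarrow> 0"
  proof (rule tendsto_sandwich[of "\<lambda>_. 0" _ _ "\<lambda>k. sqrt (?q x k * ?q y k)"])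
    have "(\<lambda>k. sqrt (?q x k * ?q y k)) \<longlonglongrightarrow> sqrt (0 * 0)"
      using cholesky_tendsto_0[OF assms] by (intro tendsto_real_sqrt tendsto_mult) auto
    then show "(\<lambda>k. sqrt (?q x k * ?q y k)) \<longlonglongrightarrow> 0" by simp
    show "\<forall>\<^sub>F k in sequentially. cmod (cinner x (cholesky P e k y)) \<le> sqrt (?q x k * ?q y k)"
      using semi_inner_product.Cauchy_Schwarz psd_map_cholesky[unfolded psd_map_def]
      by (intro always_eventually allI real_le_rsqrt) blast
  qed auto
  then have "(\<lambda>k. cinner x (P y) - cinner x (cholesky P e k y)) \<longlonglongrightarrow> cinner x (P y) - 0"
    by (intro tendsto_intros) (simp add: tendsto_norm_zero_iff)
  then show ?thesis
  proof -
    have "cinner x (P y) - cinner x (cholesky P e k y) =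
        (\<Sum>i<k. cinner x (cholesky_vec (cholesky P e i) (e i)) * cinner (cholesky_vec (cholesky P e i) (e i)) y)" for k
      using cholesky_form[of x y k] by simp
    then show ?thesis
      using \<open>(\<lambda>k. _ - _) \<longlonglongrightarrow> _\<close> unfolding sums_def by simp
  qed
qed

end

section \<open>Traces against a density operator\<close>

lemma has_trace_unique:
  fixes X :: "'h::complex_hilbert_space \<Rightarrow>\<^sub>L 'h"
  assumes "has_trace X s" "has_trace X t"
  shows "s = t"
  \<comment> \<open>\<open>has_trace\<close> quantifies over all bases and would hold vacuously if
    there were none.\<close>
  using assms ex_orthonormal_basis[where ?'h = 'h] has_sum_unique unfolding has_trace_def by metis

lemma op_trace_eqI: "has_trace X t \<Longrightarrow> op_trace X = t"
  unfolding op_trace_def using has_trace_unique by blast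

text \<open>
  The vectors \<open>v i\<close> are the columns of the Cholesky factor of \<open>\<rho>\<close> with respect to the countably many
  basis vectors \<open>e\<close> with \<open>\<langle>e, \<rho> e\<rangle> \<noteq> 0\<close>; no spectral theorem is needed.
\<close>

lemma density_operator_decomposition:
  fixes \<rho> :: "'h::complex_hilbert_space \<Rightarrow>\<^sub>L 'h"
  assumes "density_operator \<rho>"
  obtains v :: "nat \<Rightarrow> 'h" where "((\<lambda>i. (norm (v i))\<^sup>2) has_sum 1) UNIV"
    and "\<And>x y. (\<lambda>i. cinner x (v i) * cinner (v i) y) sums cinner x (\<rho> y)"
proof -
  have psd: "psd_map (blinfun_apply \<rho>)" and tr: "has_trace \<rho> 1"
    using assms positive_op_imp_psd_map by (auto simp: density_operator_def)
  obtain B :: "'h set" where onb: "orthonormal_basis B" using ex_orthonormal_basis by blast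
  have hs: "((\<lambda>e. cinner e (\<rho> e)) has_sum 1) B" using tr onb by (simp add: has_trace_def)
  \<comment> \<open>A summable family has countable support, so the pivots can be enumerated by the
    natural numbers even in a non-separable space. Repetitions in the enumeration of a finite set do
    no harm: the residual already annihilates a repeated vector, so its later column is
    zero.\<close>
  then have cnt: "countable {e\<in>B. cinner e (\<rho> e) \<noteq> 0}"
    by (intro summable_countable_complex) (auto simp: summable_on_def)
  define e where "e = from_nat_into {e\<in>B. cinner e (\<rho> e) \<noteq> 0}"
  have range: "\<rho> f = 0 \<or> f \<in> range e" if "f \<in> B" for f
  proof (cases "cinner f (\<rho> f) = 0")
    case True
    then show ?thesis using psd_map_eq_0[OF psd, of f] by simp
  next
    case False
    then have "f \<in> {e\<in>B. cinner e (\<rho> e) \<noteq> 0}" using that by simp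
    then show ?thesis
      unfolding e_def using from_nat_into_surj[OF cnt] by blast
  qed
  have bd: "Re (cinner x (\<rho> x)) \<le> norm \<rho> * (norm x)\<^sup>2" for x
  proof -
    have "Re (cinner x (\<rho> x)) \<le> norm x * norm (\<rho> x)"
      using complex_Re_le_cmod cmod_cinner_le order_trans by blast
    also have "\<dots> \<le> norm x * (norm \<rho> * norm x)" by (intro mult_left_mono norm_blinfun) simp
    finally show ?thesis by (simp add: power2_eq_square mult_ac)
  qed
  define v where "v = (\<lambda>i. cholesky_vec (cholesky (blinfun_apply \<rho>) e i) (e i))"
  have sums: "(\<lambda>i. cinner x (v i) * cinner (v i) y) sums cinner x (\<rho> y)" for x y
    unfolding v_def by (rule cholesky_sums[OF psd bd onb range])
  \<comment> \<open>Matrix of squared entries: the row of e sums to <e, \<rho> e>, the column of i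
    to the squared norm of \<open>v i\<close>. All entries are non-negative, so the trace 1 can be
    resummed by columns.\<close>
  let ?f = "\<lambda>(e, i). (cmod (cinner e (v i)))\<^sup>2"
  have row: "((\<lambda>i. ?f (e, i)) has_sum Re (cinner e (\<rho> e))) UNIV" for e
  proof -
    have "cinner e (v i) * cinner (v i) e = complex_of_real ((cmod (cinner e (v i)))\<^sup>2)" for i
      by (subst (2) cinner_commute) (simp only: complex_norm_square)
    then have "(\<lambda>i. Re (complex_of_real ((cmod (cinner e (v i)))\<^sup>2))) sums Re (cinner e (\<rho> e))"
      using sums_Re[OF sums[of e e]] by simp
    then show ?thesis by (intro sums_nonneg_imp_has_sum) auto
  qed
  have "((\<lambda>e. Re (cinner e (\<rho> e))) has_sum 1) B" using has_sum_Re[OF hs] by simp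
  moreover from this have "?f summable_on (B \<times> UNIV)"
    by (intro summable_on_SigmaI[OF row]) (auto simp: summable_on_def)
  ultimately have "(?f has_sum 1) (B \<times> UNIV)" by (intro has_sum_SigmaI[OF row])
  then have "((\<lambda>(i, e). ?f (e, i)) has_sum 1) (UNIV \<times> B)" by (subst (asm) has_sum_swap)
  then have "((\<lambda>i. (norm (v i))\<^sup>2) has_sum 1) UNIV"
    by (rule has_sum_SigmaD) (use Parseval_norm[OF onb] in simp)
  then show ?thesis using sums that by blast
qed

text \<open>The double family <v_i, e> <e, T v_i> is absolutely summable, being dominated after the
  sum over e by norm T times the squared norm of v_i. Summed over e it gives <v_i, T v_i> by
  Parseval, summed over i it gives <e, T \<rho> e>; equality of the two orders is the trace formula,
  for every basis.\<close>

lemma density_operator_trace: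
  fixes \<rho> :: "'h::complex_hilbert_space \<Rightarrow>\<^sub>L 'h"
  assumes "density_operator \<rho>"
  obtains v :: "nat \<Rightarrow> 'h" where "((\<lambda>i. (norm (v i))\<^sup>2) has_sum 1) UNIV"
    and "\<And>T. clinear_op T \<Longrightarrow> ((\<lambda>i. cinner (v i) (blinfun_apply T (v i))) has_sum op_trace (T o\<^sub>L \<rho>)) UNIV"
proof -
  obtain v :: "nat \<Rightarrow> 'h" where v1: "((\<lambda>i. (norm (v i))\<^sup>2) has_sum 1) UNIV"
    and sums: "\<And>x y. (\<lambda>i. cinner x (v i) * cinner (v i) y) sums cinner x (\<rho> y)"
    using density_operator_decomposition[OF assms] by blast
  \<comment> \<open>The decomposition of \<rho> was weak, but applying T termwise needs norm
    convergence. It holds because 2 |<v_i, x>| norm v_i is at most the sum of the two squares, and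
    both are summable.\<close>
  have expand: "((\<lambda>i. cinner (v i) x *\<^sub>C v i) has_sum \<rho> x) UNIV" for x
  proof -
    have "(\<lambda>i. (cmod (cinner (v i) x))\<^sup>2) summable_on UNIV"
    proof (rule summable_on_comparison_test)
      show "(\<lambda>i. (norm x)\<^sup>2 * (norm (v i))\<^sup>2) summable_on UNIV"
        using v1 by (intro summable_on_cmult_right) (auto simp: summable_on_def)
      show "(cmod (cinner (v i) x))\<^sup>2 \<le> (norm x)\<^sup>2 * (norm (v i))\<^sup>2" for i
        using cmod_cinner_le[of "v i" x] by (simp add: power_mult_distrib[symmetric] mult.commute power_mono)
    qed auto
    then have "(\<lambda>i. (cmod (cinner (v i) x))\<^sup>2 + (norm (v i))\<^sup>2) summable_on UNIV"
      using v1 by (intro summable_on_add) (auto simp: summable_on_def)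
    then have "(\<lambda>i. norm (cinner (v i) x *\<^sub>C v i)) summable_on UNIV"
    proof (rule summable_on_comparison_test)
      show "norm (cinner (v i) x *\<^sub>C v i) \<le> (cmod (cinner (v i) x))\<^sup>2 + (norm (v i))\<^sup>2" for i
        using sum_squares_bound[of "cmod (cinner (v i) x)" "norm (v i)"]
          mult_nonneg_nonneg[OF norm_ge_zero norm_ge_zero, of "cinner (v i) x" "v i"]
        by (simp only: norm_scaleC real_norm_def abs_norm_cancel)
    qed auto
    from abs_summable_summable[OF this] obtain z where z: "((\<lambda>i. cinner (v i) x *\<^sub>C v i) has_sum z) UNIV"
      unfolding summable_on_def by blast
    have "cinner y z = cinner y (\<rho> x)" for y
    proof -
      have "((\<lambda>i. cinner y (cinner (v i) x *\<^sub>C v i)) has_sum cinner y z) UNIV"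
        by (rule has_sum_bounded_linear[OF cinner.bounded_linear_right z])
      then have "(\<lambda>i. cinner y (v i) * cinner (v i) x) sums cinner y z"
        by (intro has_sum_imp_sums) (simp add: mult.commute)
      then show ?thesis using sums sums_unique2 by blast
    qed
    then show ?thesis using z cinner_ext by metis
  qed
  have "((\<lambda>i. cinner (v i) (T (v i))) has_sum op_trace (T o\<^sub>L \<rho>)) UNIV" if T: "clinear_op T" for T
  proof -
    have le: "norm (v i) * norm (T (v i)) \<le> norm T * (norm (v i))\<^sup>2" for i
      using mult_left_mono[OF norm_blinfun[of T "v i"], of "norm (v i)"]
      by (simp add: power2_eq_square mult_ac)
    have s1: "(\<lambda>i. norm T * (norm (v i))\<^sup>2) summable_on UNIV"
      using v1 by (intro summable_on_cmult_right) (auto simp: summable_on_def)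
    have "(\<lambda>i. norm (cinner (v i) (T (v i)))) summable_on UNIV"
      by (rule summable_on_comparison_test[OF s1]) (auto intro: order_trans[OF cmod_cinner_le le])
    from abs_summable_summable[OF this] obtain t where t: "((\<lambda>i. cinner (v i) (T (v i))) has_sum t) UNIV"
      unfolding summable_on_def by blast
    have "has_trace (T o\<^sub>L \<rho>) t"
      unfolding has_trace_def
    proof (intro allI impI)
      fix B :: "'h set" assume onb: "orthonormal_basis B"
      let ?F = "\<lambda>(i, e). cinner (v i) e * cinner e (T (v i))"
      have "(\<lambda>p. norm (?F p)) summable_on (UNIV \<times> B)"
        unfolding Infinite_Sum.abs_summable_on_Sigma_iff
      proof (intro conjI ballI)
        show "(\<lambda>e. norm (?F (i, e))) summable_on B" for i
          using Parseval_abs(1)[OF onb, of "v i" "T (v i)"] by (simp add: norm_mult)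
        show "(\<lambda>i. norm (infsum (\<lambda>e. norm (?F (i, e))) B)) summable_on UNIV"
        proof (rule summable_on_comparison_test[OF s1])
          show "norm (infsum (\<lambda>e. norm (?F (i, e))) B) \<le> norm T * (norm (v i))\<^sup>2" for i
            using order_trans[OF Parseval_abs(2)[OF onb, of "v i" "T (v i)"] le]
            by (simp add: norm_mult infsum_nonneg)
        qed auto
      qed
      then have "?F summable_on (UNIV \<times> B)" by (rule abs_summable_summable)
      then have "(?F has_sum t) (UNIV \<times> B)"
        by (intro has_sum_SigmaI[OF _ t]) (use Parseval[OF onb] in auto)
      then have "((\<lambda>(e, i). ?F (i, e)) has_sum t) (B \<times> UNIV)" by (subst (asm) has_sum_swap)
      then show "((\<lambda>e. cinner e (blinfun_apply (T o\<^sub>L \<rho>) e)) has_sum t) B"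
      proof (rule has_sum_SigmaD)
        fix e
        have "((\<lambda>i. cinner e (T (cinner (v i) e *\<^sub>C v i))) has_sum cinner e (T (\<rho> e))) UNIV"
          by (rule has_sum_bounded_linear[OF cinner.bounded_linear_right
                has_sum_bounded_linear[OF blinfun.bounded_linear_right expand]])
        then show "((\<lambda>i. case (e, i) of (e, i) \<Rightarrow> ?F (i, e)) has_sum cinner e (blinfun_apply (T o\<^sub>L \<rho>) e)) UNIV"
          by (simp add: clinear_opD[OF T])
      qed
    qed
    then show ?thesis using t op_trace_eqI by metis
  qed
  then show ?thesis using v1 that by blast
qed

section \<open>Powers and exponentials of operators\<close>

lemma op_power_0 [simp]: "op_power T 0 = id_blinfun"
  by (simp add: op_power_def)

lemma op_power_Suc [simp]: "op_power T (Suc k) = T o\<^sub>L op_power T k"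
  by (simp add: op_power_def)

lemma norm_op_power_le: "norm (op_power T k) \<le> norm T ^ k"
proof (induction k)
  case 0
  then show ?case by (simp add: norm_blinfun_id_le)
next
  case (Suc k)
  then show ?case
    using norm_blinfun_compose[of T "op_power T k"]
    by (simp, meson mult_left_mono norm_ge_zero order_trans)
qed

lemma norm_op_power_apply_le: "norm (blinfun_apply (op_power T k) x) \<le> norm T ^ k * norm x"
  by (meson norm_blinfun norm_op_power_le mult_right_mono norm_ge_zero order_trans)

lemma op_exp_sums: "(\<lambda>k. (1 / fact k) *\<^sub>R op_power T k) sums op_exp T"
proof -
  have "summable (\<lambda>k. (1 / fact k) *\<^sub>R op_power T k)"
  proof (rule summable_comparison_test')
    show "summable (\<lambda>k. norm T ^ k /\<^sub>R fact k)" by (rule summable_exp_generic)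
    show "norm ((1 / fact k) *\<^sub>R op_power T k) \<le> norm T ^ k /\<^sub>R fact k" for k
      using norm_op_power_le[of T k] by (simp add: divide_simps)
  qed
  then show ?thesis by (simp add: op_exp_def summable_sums)
qed

lemma op_exp_apply_sums:
  "(\<lambda>k. (1 / fact k) *\<^sub>R blinfun_apply (op_power T k) x) sums blinfun_apply (op_exp T) x"
  using bounded_linear.sums[OF blinfun.bounded_linear_left[of x] op_exp_sums]
  by (simp add: blinfun.scaleR_left)

lemma op_scaleC_apply [simp]: "blinfun_apply (op_scaleC c T) x = c *\<^sub>C blinfun_apply T x"
  unfolding op_scaleC_def
  by (subst bounded_linear_Blinfun_apply)
     (auto intro: bounded_linear_compose[OF scaleC.bounded_linear_right blinfun.bounded_linear_right])

lemma clinear_op_id: "clinear_op id_blinfun"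
  by (simp add: clinear_op_def)

lemma clinear_op_compose: "clinear_op S \<Longrightarrow> clinear_op T \<Longrightarrow> clinear_op (S o\<^sub>L T)"
  by (simp add: clinear_op_def)

lemma clinear_op_scaleC: "clinear_op T \<Longrightarrow> clinear_op (op_scaleC c T)"
  by (simp add: clinear_op_def scaleC_scaleC mult.commute)

lemma clinear_op_sum: "(\<And>i. i \<in> I \<Longrightarrow> clinear_op (T i)) \<Longrightarrow> clinear_op (\<Sum>i\<in>I. T i)"
  by (simp add: clinear_op_def blinfun.sum_left scaleC.sum_right)

lemma clinear_op_power: "clinear_op T \<Longrightarrow> clinear_op (op_power T k)"
  by (induction k) (simp_all add: clinear_op_id clinear_op_compose)

lemma clinear_op_exp:
  assumes "clinear_op T"
  shows "clinear_op (op_exp T)"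
  unfolding clinear_op_def
proof (intro allI)
  fix c x
  have "(\<lambda>k. (1 / fact k) *\<^sub>R op_power T k (c *\<^sub>C x)) sums (c *\<^sub>C op_exp T x)"
    using bounded_linear.sums[OF scaleC.bounded_linear_right op_exp_apply_sums, of c T x]
    by (simp add: clinear_opD[OF clinear_op_power[OF assms]] scaleC.scaleR_right)
  then show "op_exp T (c *\<^sub>C x) = c *\<^sub>C op_exp T x"
    using op_exp_apply_sums sums_unique2 by blast
qed

lemma op_power_scaleC:
  "clinear_op T \<Longrightarrow> blinfun_apply (op_power (op_scaleC c T) k) x = c ^ k *\<^sub>C blinfun_apply (op_power T k) x"
  by (induction k) (simp_all add: clinear_opD scaleC_scaleC)

lemma op_exp_scaleC_sums:
  assumes "clinear_op T"
  shows "(\<lambda>k. (c ^ k / fact k) *\<^sub>C blinfun_apply (op_power T k) x) sums blinfun_apply (op_exp (op_scaleC c T)) x"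
  using op_exp_apply_sums[of "op_scaleC c T" x]
  by (simp add: op_power_scaleC[OF assms] scaleR_eq_scaleC scaleC_scaleC)

text \<open>The Taylor polynomials F d of t |-> exp(t T) x satisfy F (d+1)' = T (F d). In the
  derivative of the squared norm of F (d+1) the real part of <F d, T (F d)> drops out, so only the
  pairing with the last Taylor term remains, and its bound \<delta> d tends to 0. This avoids
  differentiating \<open>op_exp\<close> itself.\<close>

lemma norm_op_exp_skew:
  fixes T :: "'h::complex_hilbert_space \<Rightarrow>\<^sub>L 'h"
  assumes skew: "\<And>y. Re (cinner y (T y)) = 0"
  shows "norm (op_exp T x) = norm x"
proof -
  define F where "F d t = (\<Sum>k<d. (t ^ k / fact k) *\<^sub>R op_power T k x)" for d :: nat and t :: real
  define M where "M = exp (norm T) * norm x"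
  have deriv: "(F (Suc d) has_vector_derivative T (F d t)) (at t)" for d t
  proof -
    have "(F (Suc d) has_vector_derivative
        (\<Sum>k<Suc d. (real k * t ^ (k - 1) / fact k) *\<^sub>R op_power T k x)) (at t)"
      unfolding F_def
      by (rule has_vector_derivative_sum, rule has_vector_derivative_eq_rhs, rule has_vector_derivative_scaleR)
         (auto intro!: derivative_eq_intros)
    also have "(\<Sum>k<Suc d. (real k * t ^ (k - 1) / fact k) *\<^sub>R op_power T k x) = T (F d t)"
      by (subst sum.lessThan_Suc_shift)
         (simp add: F_def blinfun.sum_right blinfun.scaleR_right field_simps del: of_nat_Suc)
    finally show ?thesis .
  qed
  have F_le: "norm (F d t) \<le> M" if "0 \<le> t" "t \<le> 1" for d t
  proof -
    have "norm (F d t) \<le> (\<Sum>k<d. (norm T ^ k /\<^sub>R fact k) * norm x)"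
      unfolding F_def
    proof (rule sum_norm_le)
      fix k
      have "t ^ k * norm (op_power T k x) \<le> 1 * (norm T ^ k * norm x)"
        using that by (intro mult_mono norm_op_power_apply_le power_le_one) auto
      then show "norm ((t ^ k / fact k) *\<^sub>R op_power T k x) \<le> (norm T ^ k /\<^sub>R fact k) * norm x"
        using that by (simp add: divide_simps)
    qed
    also have "\<dots> = (\<Sum>k<d. norm T ^ k /\<^sub>R fact k) * norm x" by (simp add: sum_distrib_right)
    also have "\<dots> \<le> M"
      unfolding M_def exp_def by (intro mult_right_mono sum_le_suminf summable_exp_generic) auto
    finally show ?thesis .
  qed
  define \<delta> where "\<delta> d = 2 * ((norm T ^ d / fact d) * norm x) * (norm T * M)" for d :: nat
  have bound: "\<bar>(norm (F (Suc d) 1))\<^sup>2 - (norm x)\<^sup>2\<bar> \<le> \<delta> d" for d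
  proof -
    let ?\<phi> = "\<lambda>t. Re (cinner (F (Suc d) t) (F (Suc d) t))"
    let ?\<phi>' = "\<lambda>t. Re (cinner (F (Suc d) t) (T (F d t)) + cinner (T (F d t)) (F (Suc d) t))"
    have "(?\<phi> has_real_derivative ?\<phi>' t) (at t)" for t
      unfolding has_real_derivative_iff_has_vector_derivative
      by (intro bounded_linear.has_vector_derivative[OF bounded_linear_Re]
            cinner.has_vector_derivative deriv)
    then obtain t where t: "0 < t" "t < 1" "?\<phi> 1 - ?\<phi> 0 = ?\<phi>' t"
      using MVT2[of 0 1 ?\<phi> ?\<phi>'] by auto
    have "Re (cinner (T (F d t)) (F (Suc d) t)) = Re (cinner (F (Suc d) t) (T (F d t)))"
      by (subst cinner_commute) simp
    moreover have "Re (cinner (F (Suc d) t) (T (F d t))) = Re (cinner ((t ^ d / fact d) *\<^sub>R op_power T d x) (T (F d t)))"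
      by (simp add: F_def[of "Suc d"] F_def[of d, symmetric] cinner.add_left skew)
    ultimately have "\<bar>?\<phi>' t\<bar> \<le> 2 * cmod (cinner ((t ^ d / fact d) *\<^sub>R op_power T d x) (T (F d t)))"
      using abs_Re_le_cmod[of "cinner ((t ^ d / fact d) *\<^sub>R op_power T d x) (T (F d t))"] by simp
    also have "\<dots> \<le> 2 * (norm ((t ^ d / fact d) *\<^sub>R op_power T d x) * norm (T (F d t)))"
      by (intro mult_left_mono cmod_cinner_le) simp
    also have "\<dots> \<le> 2 * (((norm T ^ d / fact d) * norm x) * (norm T * M))"
    proof (intro mult_left_mono mult_mono)
      have "t ^ d * norm (op_power T d x) \<le> 1 * (norm T ^ d * norm x)"
        using t by (intro mult_mono norm_op_power_apply_le power_le_one) auto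
      then show "norm ((t ^ d / fact d) *\<^sub>R op_power T d x) \<le> (norm T ^ d / fact d) * norm x"
        using t by (simp add: divide_simps)
      show "norm (T (F d t)) \<le> norm T * M"
        using norm_blinfun[of T "F d t"] F_le[of t d] t
        by (meson less_eq_real_def mult_left_mono norm_ge_zero order_trans)
    qed auto
    finally have "\<bar>?\<phi> 1 - ?\<phi> 0\<bar> \<le> \<delta> d" using t(3) by (simp add: \<delta>_def)
    moreover have "F (Suc d) 0 = x"
      by (simp add: F_def sum.lessThan_Suc_shift del: sum.lessThan_Suc op_power_Suc)
    ultimately show ?thesis by (simp add: norm_sq_eq_Re_cinner)
  qed
  have "(\<lambda>d. F d 1) \<longlonglongrightarrow> op_exp T x"
    using op_exp_apply_sums[of T x] by (simp add: sums_def F_def)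
  then have "(\<lambda>d. \<bar>(norm (F (Suc d) 1))\<^sup>2 - (norm x)\<^sup>2\<bar>) \<longlonglongrightarrow> \<bar>(norm (op_exp T x))\<^sup>2 - (norm x)\<^sup>2\<bar>"
    by (intro tendsto_intros LIMSEQ_Suc)
  moreover have "\<delta> \<longlonglongrightarrow> 0"
  proof -
    have "(\<lambda>d. norm T ^ d / fact d) \<longlonglongrightarrow> 0"
      using summable_LIMSEQ_zero[OF summable_exp_generic[of "norm T"]] by (simp add: divide_inverse mult.commute)
    then have "(\<lambda>d. 2 * ((norm T ^ d / fact d) * norm x) * (norm T * M)) \<longlonglongrightarrow> 2 * (0 * norm x) * (norm T * M)"
      by (intro tendsto_intros)
    then show ?thesis by (simp add: \<delta>_def[abs_def])
  qed
  ultimately have "\<bar>(norm (op_exp T x))\<^sup>2 - (norm x)\<^sup>2\<bar> \<le> 0"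
    using bound by (intro LIMSEQ_le) auto
  then show ?thesis by simp
qed

lemma selfadjoint_imp_clinear: "selfadjoint_op A \<Longrightarrow> clinear_op A"
  by (simp add: selfadjoint_op_def)

lemma selfadjointD: "selfadjoint_op A \<Longrightarrow> cinner (A x) y = cinner x (A y)"
  by (simp add: selfadjoint_op_def)

lemma norm_op_exp_selfadjoint:
  assumes "selfadjoint_op A" "Re c = 0"
  shows "norm (op_exp (op_scaleC c A) x) = norm x"
proof (rule norm_op_exp_skew)
  fix y
  have "cinner y (A y) = cnj (cinner y (A y))"
    by (metis assms(1) cinner_commute selfadjointD)
  then have "Im (cinner y (A y)) = 0" by (metis Reals_cnj_iff complex_is_Real_iff)
  then show "Re (cinner y (op_scaleC c A y)) = 0" using assms by simp
qed

section \<open>Chebyshev polynomials of a self-adjoint contraction\<close>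

text \<open>
  For \<open>B = cos t\<close> the two components are \<open>cos (k t)\<close> and \<open>sin (k t) / sin t\<close>, i.e. the Chebyshev
  polynomials \<open>T\<^sub>k\<close> and \<open>U\<^bsub>k-1\<^esub>\<close> of \<open>B\<close>.
\<close>

primrec cheb :: "('h::real_normed_vector \<Rightarrow>\<^sub>L 'h) \<Rightarrow> nat \<Rightarrow> ('h \<Rightarrow>\<^sub>L 'h) \<times> ('h \<Rightarrow>\<^sub>L 'h)" where
  "cheb B 0 = (id_blinfun, 0)"
| "cheb B (Suc k) = (case cheb B k of (S, U) \<Rightarrow> ((B o\<^sub>L (S + (B o\<^sub>L U))) - U, S + (B o\<^sub>L U)))"

definition cheb_T :: "('h::real_normed_vector \<Rightarrow>\<^sub>L 'h) \<Rightarrow> nat \<Rightarrow> ('h \<Rightarrow>\<^sub>L 'h)" where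
  "cheb_T B k = fst (cheb B k)"

definition cheb_U :: "('h::real_normed_vector \<Rightarrow>\<^sub>L 'h) \<Rightarrow> nat \<Rightarrow> ('h \<Rightarrow>\<^sub>L 'h)" where
  "cheb_U B k = snd (cheb B k)"

lemma cheb_simps:
  "cheb_T B 0 x = x" "cheb_U B 0 x = 0"
  "cheb_U B (Suc k) x = cheb_T B k x + B (cheb_U B k x)"
  "cheb_T B (Suc k) x = B (cheb_U B (Suc k) x) - cheb_U B k x"
  by (simp_all add: cheb_T_def cheb_U_def case_prod_beta blinfun.bilinear_simps)

lemma cheb_T_1: "cheb_T B (Suc 0) x = B x"
  by (simp add: cheb_simps)

text \<open>The counterpart of 2 cos t cos((k+1) t) = cos((k+2) t) + cos(k t): applying B to
  Chebyshev sums behaves like multiplying cosine sums by cos t.\<close>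

lemma cheb_T_rec: "B (cheb_T B (Suc k) x) = (1/2) *\<^sub>R (cheb_T B (Suc (Suc k)) x + cheb_T B k x)"
proof -
  let ?T = "\<lambda>k. blinfun_apply (cheb_T B k) x" and ?U = "\<lambda>k. blinfun_apply (cheb_U B k) x"
  have "B (?U (Suc k)) = ?T (Suc k) + ?U k" by (simp only: cheb_simps(4)) simp
  then have "B (?U (Suc (Suc k))) = B (?T (Suc k)) + B (?T (Suc k)) + B (?U k)"
    by (simp only: cheb_simps(3)[of B "Suc k"] blinfun.add_right) (simp add: blinfun.add_right)
  then have "?T (Suc (Suc k)) + ?T k = B (?T (Suc k)) + B (?T (Suc k))"
    by (simp only: cheb_simps(4)[of B "Suc k"] cheb_simps(3)[of B k]) simp
  then show ?thesis by (simp add: scaleR_2[symmetric])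
qed

text \<open>The Pell identity read as an identity of quadratic forms. In the induction step
  self-adjointness of B identifies the cross terms <B b', b> and <b', B b>.\<close>

lemma cheb_Pell:
  assumes sa: "selfadjoint_op B"
  shows "(norm (cheb_T B k x))\<^sup>2 + (norm (cheb_U B k x))\<^sup>2 - (norm (B (cheb_U B k x)))\<^sup>2 = (norm x)\<^sup>2"
proof (induction k)
  case 0
  then show ?case by (simp add: cheb_simps)
next
  case (Suc k)
  let ?a = "cheb_T B k x" and ?b = "cheb_U B k x" and ?b' = "cheb_U B (Suc k) x"
  have "(norm (cheb_T B (Suc k) x))\<^sup>2 = (norm (B ?b'))\<^sup>2 - 2 * Re (cinner (B ?b') ?b) + (norm ?b)\<^sup>2"
    by (simp only: cheb_simps(4) norm_diff_sq)
  moreover have "cinner (B ?b') ?b = cinner ?b' (B ?b)" by (rule selfadjointD[OF sa])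
  moreover have "(norm (?b' - B ?b))\<^sup>2 = (norm ?b')\<^sup>2 - 2 * Re (cinner ?b' (B ?b)) + (norm (B ?b))\<^sup>2"
    by (rule norm_diff_sq)
  moreover have "?b' - B ?b = ?a" by (simp add: cheb_simps)
  ultimately show ?case using Suc by simp
qed

lemma norm_cheb_T_le:
  assumes "selfadjoint_op B" "norm B \<le> 1"
  shows "norm (cheb_T B k x) \<le> norm x"
proof -
  have "norm (B (cheb_U B k x)) \<le> norm (cheb_U B k x)"
    using norm_blinfun[of B "cheb_U B k x"] assms(2)
    by (meson mult_left_le_one_le norm_ge_zero order_trans)
  then have "(norm (cheb_T B k x))\<^sup>2 \<le> (norm x)\<^sup>2"
    using cheb_Pell[OF assms(1), of k x] power_mono[of "norm (B (cheb_U B k x))" "norm (cheb_U B k x)" 2]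
    by (smt (verit) norm_ge_zero)
  then show ?thesis by (rule power2_le_imp_le) simp
qed

text \<open>Pairs a cosine sum with vector coefficients c_l with the sum of the vectors T_l(B) c_l.
  As a relation it needs no proof that the vector is determined by the function.\<close>

inductive cheb_rep :: "('h::real_normed_vector \<Rightarrow>\<^sub>L 'h) \<Rightarrow> (real \<Rightarrow> 'h) \<Rightarrow> 'h \<Rightarrow> bool" for B where
  single: "cheb_rep B (\<lambda>t. cos (real l * t) *\<^sub>R c) (cheb_T B l c)"
| add: "cheb_rep B f y \<Longrightarrow> cheb_rep B g z \<Longrightarrow> cheb_rep B (\<lambda>t. f t + g t) (y + z)"

text \<open>The product formula for cosines and \<open>cheb_T_rec\<close> split a term in the same
  way, with coefficient r/2 at l + 1 and at l - 1. The index l = 0 is separate, since there only l +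
  1 occurs, with coefficient r.\<close>

lemma cheb_rep_mult:
  assumes "cheb_rep B f y"
  shows "cheb_rep B (\<lambda>t. (r * cos t) *\<^sub>R f t) (r *\<^sub>R B y)"
  using assms
proof induction
  case (single l c)
  show ?case
  proof (cases l)
    case 0
    have "(\<lambda>t. (r * cos t) *\<^sub>R cos (real l * t) *\<^sub>R c) = (\<lambda>t. cos (real 1 * t) *\<^sub>R (r *\<^sub>R c))"
      "r *\<^sub>R B (cheb_T B l c) = cheb_T B 1 (r *\<^sub>R c)"
      using 0 by (simp_all add: cheb_T_1 cheb_simps(1) blinfun.scaleR_right mult.commute)
    then show ?thesis by (metis cheb_rep.single)
  next
    case (Suc m)
    have "r * cos t * cos (real l * t) = cos (real (Suc l) * t) * (r/2) + cos (real m * t) * (r/2)" for t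
    proof -
      have "cos (real (Suc l) * t) + cos (real m * t) = 2 * cos t * cos (real l * t)"
        using cos_add[of "real l * t" t] cos_diff[of "real l * t" t] Suc by (simp add: algebra_simps)
      then have "cos (real (Suc l) * t) * (r/2) + cos (real m * t) * (r/2) = 2 * cos t * cos (real l * t) * (r/2)"
        by (simp only: distrib_right[symmetric])
      then show ?thesis by simp
    qed
    then have 1: "(\<lambda>t. (r * cos t) *\<^sub>R cos (real l * t) *\<^sub>R c) =
        (\<lambda>t. cos (real (Suc l) * t) *\<^sub>R (r/2) *\<^sub>R c + cos (real m * t) *\<^sub>R (r/2) *\<^sub>R c)"
      by (simp add: scaleR_left_distrib[symmetric])
    have 2: "r *\<^sub>R B (cheb_T B l c) = cheb_T B (Suc l) ((r/2) *\<^sub>R c) + cheb_T B m ((r/2) *\<^sub>R c)"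
      using cheb_T_rec[of B m c] Suc by (simp add: blinfun.scaleR_right scaleR_right_distrib)
    show ?thesis unfolding 1 2 by (intro cheb_rep.intros)
  qed
next
  case (add f y g z)
  then show ?case
    using cheb_rep.add[OF add.IH] by (simp add: scaleR_right_distrib blinfun.add_right)
qed

text \<open>Horner scheme: peeling off the constant coefficient leaves r cos t, respectively r B,
  times a polynomial with one coefficient less.\<close>

lemma cheb_rep_poly:
  "cheb_rep B (\<lambda>t. \<Sum>k<d. (r * cos t) ^ k *\<^sub>R v k) (\<Sum>k<d. op_power (r *\<^sub>R B) k (v k))"
proof (induction d arbitrary: v)
  case 0
  then show ?case using cheb_rep.single[of B 0 0] by (simp add: cheb_simps)
next
  case (Suc d)
  have "cheb_rep B (\<lambda>t. cos (real 0 * t) *\<^sub>R v 0 + (r * cos t) *\<^sub>R (\<Sum>k<d. (r * cos t) ^ k *\<^sub>R v (Suc k)))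
    (cheb_T B 0 (v 0) + r *\<^sub>R B (\<Sum>k<d. op_power (r *\<^sub>R B) k (v (Suc k))))"
    by (intro cheb_rep.intros cheb_rep_mult Suc)
  then show ?case
    unfolding sum.lessThan_Suc_shift
    by (simp add: cheb_simps(1) scaleR_sum_right blinfun.sum_right blinfun.scaleR_left mult.assoc)
qed

text \<open>The vanishing of c from d on allows two sums to be padded to a common length before they
  are added.\<close>

lemma cheb_rep_coeffs:
  assumes "cheb_rep B f y"
  shows "\<exists>d c. (\<forall>l\<ge>d. c l = 0) \<and> (\<forall>t. f t = (\<Sum>l<d. cos (real l * t) *\<^sub>R c l)) \<and> y = (\<Sum>l<d. cheb_T B l (c l))"
  using assms
proof induction
  case (single l c)
  show ?case
    by (rule exI[of _ "Suc l"], rule exI[of _ "\<lambda>k. if k = l then c else 0"])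
       (auto simp: if_distrib if_distribR cong: if_cong)
next
  case (add f y g z)
  then obtain d c e b where c: "\<forall>l\<ge>d. c l = 0" "\<And>t. f t = (\<Sum>l<d. cos (real l * t) *\<^sub>R c l)" "y = (\<Sum>l<d. cheb_T B l (c l))"
    and b: "\<forall>l\<ge>e. b l = 0" "\<And>t. g t = (\<Sum>l<e. cos (real l * t) *\<^sub>R b l)" "z = (\<Sum>l<e. cheb_T B l (b l))"
    by blast
  let ?m = "max d e"
  have "f t = (\<Sum>l<?m. cos (real l * t) *\<^sub>R c l)" "g t = (\<Sum>l<?m. cos (real l * t) *\<^sub>R b l)" for t
    unfolding c(2) b(2) using c(1) b(1) by (intro sum.mono_neutral_left; auto simp: not_less)+
  moreover have "y = (\<Sum>l<?m. cheb_T B l (c l))" "z = (\<Sum>l<?m. cheb_T B l (b l))"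
    unfolding c(3) b(3) using c(1) b(1) by (intro sum.mono_neutral_left; auto simp: not_less)+
  ultimately show ?case
    using c(1) b(1)
    by (intro exI[of _ ?m] exI[of _ "\<lambda>l. c l + b l"])
       (simp add: scaleR_right_distrib blinfun.add_right sum.distrib)
qed

section \<open>Cosine coefficients and their decay\<close>

lemma has_integral_cos:
  "((\<lambda>t. cos (real_of_int m * t)) has_integral (if m = 0 then pi else 0)) {0..pi}"
proof (cases "m = 0")
  case True
  then show ?thesis using has_integral_const_real[of "1::real" 0 pi] by simp
next
  case False
  have "((\<lambda>t. cos (real_of_int m * t)) has_integral
      (sin (real_of_int m * pi) / real_of_int m - sin (real_of_int m * 0) / real_of_int m)) {0..pi}"
  proof (rule fundamental_theorem_of_calculus)
    show "((\<lambda>t. sin (real_of_int m * t) / real_of_int m) has_vector_derivative cos (real_of_int m * t))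
        (at t within {0..pi})" for t
      using False unfolding has_real_derivative_iff_has_vector_derivative[symmetric]
      by (auto intro!: derivative_eq_intros)
  qed simp
  moreover have "sin (real_of_int m * pi) = 0" by (simp add: sin_zero_iff_int2)
  ultimately show ?thesis using False by simp
qed

lemma has_integral_cos_cos:
  "((\<lambda>t. cos (real k * t) * cos (real l * t)) has_integral
     (if k = l then if k = 0 then pi else pi / 2 else 0)) {0..pi}"
proof -
  have "cos (real k * t) * cos (real l * t) =
      (1/2) * (cos (real_of_int (int k - int l) * t) + cos (real_of_int (int k + int l) * t))" for t
    using cos_add[of "real k * t" "real l * t"] cos_diff[of "real k * t" "real l * t"]
    by (simp add: algebra_simps)
  moreover have "((\<lambda>t. (1/2) * (cos (real_of_int (int k - int l) * t) + cos (real_of_int (int k + int l) * t)))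
      has_integral (1/2) * ((if int k - int l = 0 then pi else 0) + (if int k + int l = 0 then pi else 0))) {0..pi}"
    by (intro has_integral_mult_right has_integral_add has_integral_cos)
  moreover have "(1/2) * ((if int k - int l = 0 then pi else 0) + (if int k + int l = 0 then pi else 0)) =
      (if k = l then if k = 0 then pi else pi / 2 else 0)"
    by auto
  ultimately show ?thesis by (simp only:)
qed

text \<open>Orthogonality gives c_k as the integral of cos(k t) f(t) over [0, pi], divided by pi /
  2, or by pi for k = 0; the interval length pi then leaves the factor 2, respectively 1.\<close>

lemma cos_sum_coeff_bound:
  fixes c :: "nat \<Rightarrow> 'a::banach"
  assumes f: "\<And>t. f t = (\<Sum>l<d. cos (real l * t) *\<^sub>R c l)" and "k < d"
    and M: "\<And>t. norm (f t) \<le> M"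
  shows "norm (c k) \<le> (if k = 0 then M else 2 * M)"
proof -
  let ?I = "\<lambda>l. if k = l then if k = 0 then pi else pi / 2 else 0"
  have "((\<lambda>t. \<Sum>l<d. (cos (real k * t) * cos (real l * t)) *\<^sub>R c l) has_integral (\<Sum>l<d. ?I l *\<^sub>R c l)) {0..pi}"
    by (intro has_integral_sum has_integral_scaleR_left has_integral_cos_cos) simp
  also have "(\<lambda>t. \<Sum>l<d. (cos (real k * t) * cos (real l * t)) *\<^sub>R c l) = (\<lambda>t. cos (real k * t) *\<^sub>R f t)"
    by (simp add: f scaleR_sum_right)
  also have "(\<Sum>l<d. ?I l *\<^sub>R c l) = (\<Sum>l<d. if k = l then ?I k *\<^sub>R c k else 0)"
    by (rule sum.cong) auto
  also have "\<dots> = ?I k *\<^sub>R c k" using \<open>k < d\<close> by simp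
  finally have I: "((\<lambda>t. cos (real k * t) *\<^sub>R f t) has_integral ?I k *\<^sub>R c k) (cbox 0 pi)" by simp
  have "norm (?I k *\<^sub>R c k) \<le> M * measure lborel (cbox 0 pi)"
  proof (rule has_integral_bound[OF _ I])
    show "0 \<le> M" using M[of 0] norm_ge_zero order_trans by blast
    show "norm (cos (real k * t) *\<^sub>R f t) \<le> M" for t
      using mult_mono[OF abs_cos_le_one[of "real k * t"] M[of t]] by simp
  qed
  then show ?thesis by (auto simp: field_simps split: if_splits)
qed

text \<open>Telescoping with 1 / (d+1)^2 \<le> 1 / d - 1 / (d+1). The case d = 0 fits because 1 / 0
  = 0.\<close>

lemma sum_inverse_squares_le: "(\<Sum>l<d. 1 / (real (Suc l))\<^sup>2) \<le> 2 - 1 / real d"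
proof (induction d)
  case (Suc d)
  show ?case
  proof (cases d)
    case (Suc m)
    have "1 / (real (Suc d))\<^sup>2 \<le> 1 / (real d * real (Suc d))"
      using Suc unfolding power2_eq_square by (intro divide_left_mono mult_right_mono) auto
    also have "\<dots> = 1 / real d - 1 / real (Suc d)"
      using Suc by (simp add: field_simps)
    finally have "1 / (real (Suc d))\<^sup>2 \<le> 1 / real d - 1 / real (Suc d)" .
    then show ?thesis using Suc.IH by simp
  qed simp
qed simp

text \<open>The coefficients of f'' are - l^2 c_l, so norm c_l is at most 2 M2 / l^2 for l \<ge> 1,
  and the bound 2 for the sum of 1 / l^2 produces 4 M2; M0 covers c_0. Each T_l(B) is a contraction,
  so the norms of the coefficients simply add.\<close>

lemma cheb_rep_norm_le:
  fixes B :: "'h::complex_hilbert_space \<Rightarrow>\<^sub>L 'h"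
  assumes sa: "selfadjoint_op B" "norm B \<le> 1" and rep: "cheb_rep B f y"
    and f1: "\<And>t. (f has_vector_derivative f1 t) (at t)"
    and f2: "\<And>t. (f1 has_vector_derivative f2 t) (at t)"
    and M0: "\<And>t. norm (f t) \<le> M0" and M2: "\<And>t. norm (f2 t) \<le> M2"
  shows "norm y \<le> M0 + 4 * M2"
proof -
  obtain d c where f: "\<And>t. f t = (\<Sum>l<d. cos (real l * t) *\<^sub>R c l)" and y: "y = (\<Sum>l<d. cheb_T B l (c l))"
    using cheb_rep_coeffs[OF rep] by blast
  have "(f has_vector_derivative (\<Sum>l<d. (- sin (real l * t) * real l) *\<^sub>R c l)) (at t)" for t
    unfolding f[abs_def]
    by (rule has_vector_derivative_sum, rule has_vector_derivative_eq_rhs, rule has_vector_derivative_scaleR)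
       (auto intro!: derivative_eq_intros)
  then have f1_eq: "f1 = (\<lambda>t. \<Sum>l<d. (- sin (real l * t) * real l) *\<^sub>R c l)"
    using f1 vector_derivative_unique_at by blast
  have "(f1 has_vector_derivative (\<Sum>l<d. cos (real l * t) *\<^sub>R (- (real l)\<^sup>2 *\<^sub>R c l))) (at t)" for t
    unfolding f1_eq
    by (rule has_vector_derivative_sum, rule has_vector_derivative_eq_rhs, rule has_vector_derivative_scaleR)
       (auto intro!: derivative_eq_intros simp: power2_eq_square mult.assoc)
  then have f2_eq: "\<And>t. f2 t = (\<Sum>l<d. cos (real l * t) *\<^sub>R (- (real l)\<^sup>2 *\<^sub>R c l))"
    using f2 vector_derivative_unique_at by blast
  have M2_pos: "0 \<le> M2" using M2[of 0] norm_ge_zero order_trans by blast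
  have M0_pos: "0 \<le> M0" using M0[of 0] norm_ge_zero order_trans by blast
  have c_Suc: "norm (c (Suc l)) \<le> 2 * M2 * (1 / (real (Suc l))\<^sup>2)" if "Suc l < d" for l
    using cos_sum_coeff_bound[OF f2_eq that M2] by (simp add: field_simps del: of_nat_Suc)
  have "norm y \<le> (\<Sum>l<d. norm (c l))"
    unfolding y by (intro sum_norm_le norm_cheb_T_le sa)
  also have "\<dots> \<le> M0 + 4 * M2"
  proof (cases d)
    case 0
    then show ?thesis using M0_pos M2_pos by simp
  next
    case (Suc m)
    have "(\<Sum>l<m. norm (c (Suc l))) \<le> (\<Sum>l<m. 2 * M2 * (1 / (real (Suc l))\<^sup>2))"
      using Suc by (intro sum_mono c_Suc) simp
    also have "\<dots> = 2 * M2 * (\<Sum>l<m. 1 / (real (Suc l))\<^sup>2)" by (simp add: sum_distrib_left)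
    also have "\<dots> \<le> 2 * M2 * 2"
      using M2_pos sum_inverse_squares_le[of m]
      by (intro mult_left_mono) (auto intro: order_trans)
    finally have "(\<Sum>l<m. norm (c (Suc l))) \<le> 4 * M2" by simp
    moreover have "norm (c 0) \<le> M0" using cos_sum_coeff_bound[OF f _ M0, of 0] Suc by simp
    ultimately show ?thesis unfolding Suc sum.lessThan_Suc_shift by simp
  qed
  finally show ?thesis .
qed

text \<open>The substitution s = r cos t turns p on [-r, r] into a cosine sum for B = A / r. Its
  second t-derivative r^2 (sin t)^2 p'' - r (cos t) p' is at most (r^2 + r) M, whence the constant.
  The scaling breaks down for r = 0, where A = 0 and only p(0) remains.\<close>

lemma poly_calculus_bound:
  fixes A :: "'h::complex_hilbert_space \<Rightarrow>\<^sub>L 'h"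
  assumes sa: "selfadjoint_op A" and r: "norm A \<le> r"
    and p: "\<And>s. p s = (\<Sum>k<d. s ^ k *\<^sub>R v k)"
    and p1: "\<And>s. (p has_vector_derivative p1 s) (at s)"
    and p2: "\<And>s. (p1 has_vector_derivative p2 s) (at s)"
    and M: "\<And>s. \<bar>s\<bar> \<le> r \<Longrightarrow> norm (p s) \<le> M \<and> norm (p1 s) \<le> M \<and> norm (p2 s) \<le> M"
  shows "norm (\<Sum>k<d. op_power A k (v k)) \<le> (1 + 4 * (r + r\<^sup>2)) * M"
proof -
  have r0: "0 \<le> r" using r norm_ge_zero order_trans by blast
  have "norm (p 0) \<le> M" using M[of 0] r0 by simp
  then have M0: "0 \<le> M" using norm_ge_zero order_trans by blast
  show ?thesis
  proof (cases "r = 0")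
    case True
    then have A: "A = 0" using r by simp
    have "op_power A k x = 0 ^ k *\<^sub>R x" for k x by (cases k) (simp_all add: A)
    then have "(\<Sum>k<d. op_power A k (v k)) = p 0" unfolding p by simp
    then show ?thesis using M[of 0] True by simp
  next
    case False
    then have pos: "0 < r" using r0 by simp
    define B where "B = (1/r) *\<^sub>R A"
    have AB: "A = r *\<^sub>R B" using pos by (simp add: B_def)
    have saB: "selfadjoint_op B"
      using sa unfolding selfadjoint_op_def clinear_op_def B_def
      by (simp add: blinfun.scaleR_left scaleC.scaleR_right cinner.scaleR_left cinner.scaleR_right)
    have nB: "norm B \<le> 1" using r pos by (simp add: B_def field_simps)
    have rep: "cheb_rep B (\<lambda>t. p (r * cos t)) (\<Sum>k<d. op_power A k (v k))"
      unfolding p AB by (rule cheb_rep_poly)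
    define f1 where "f1 t = (- r * sin t) *\<^sub>R p1 (r * cos t)" for t
    define f2 where "f2 t = (- r * sin t) *\<^sub>R ((- r * sin t) *\<^sub>R p2 (r * cos t)) + (- r * cos t) *\<^sub>R p1 (r * cos t)" for t
    have c: "((\<lambda>t. r * cos t) has_vector_derivative (- r * sin t)) (at t)" for t
      unfolding has_real_derivative_iff_has_vector_derivative[symmetric]
      by (auto intro!: derivative_eq_intros)
    have d1: "((\<lambda>t. p (r * cos t)) has_vector_derivative f1 t) (at t)" for t
      using vector_diff_chain_at[OF c p1] by (simp add: f1_def o_def)
    have d2: "(f1 has_vector_derivative f2 t) (at t)" for t
    proof -
      have "((\<lambda>t. p1 (r * cos t)) has_vector_derivative (- r * sin t) *\<^sub>R p2 (r * cos t)) (at t)"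
        using vector_diff_chain_at[OF c p2] by (simp add: o_def)
      moreover have "((\<lambda>t. - r * sin t) has_real_derivative - r * cos t) (at t)"
        by (auto intro!: derivative_eq_intros)
      ultimately show ?thesis
        unfolding f1_def[abs_def] f2_def by (intro has_vector_derivative_scaleR)
    qed
    have rc: "\<bar>r * cos t\<bar> \<le> r" for t
      using pos abs_cos_le_one[of t] by (simp add: abs_mult)
    have rs: "\<bar>- r * sin t\<bar> \<le> r" for t
      using pos abs_sin_le_one[of t] by (simp add: abs_mult)
    have "norm (f2 t) \<le> (r + r\<^sup>2) * M" for t
    proof -
      have "norm (f2 t) \<le> \<bar>- r * sin t\<bar> * (\<bar>- r * sin t\<bar> * norm (p2 (r * cos t))) + \<bar>r * cos t\<bar> * norm (p1 (r * cos t))"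
        unfolding f2_def by (rule order_trans[OF norm_triangle_ineq]) (simp add: abs_mult)
      also have "\<dots> \<le> r * (r * M) + r * M"
        using M[OF rc[of t]] rc[of t] rs[of t] M0 pos
        by (intro add_mono mult_mono) auto
      finally show ?thesis by (simp add: algebra_simps power2_eq_square)
    qed
    then have "norm (\<Sum>k<d. op_power A k (v k)) \<le> M + 4 * ((r + r\<^sup>2) * M)"
      using M rc by (intro cheb_rep_norm_le[OF saB nB rep d1 d2]) auto
    then show ?thesis by (simp add: algebra_simps)
  qed
qed

lemma exp_partial_sums_uniform_limit:
  "uniform_limit (cball 0 R) (\<lambda>d z. \<Sum>k<d. z ^ k / fact k) (exp :: complex \<Rightarrow> complex) sequentially"
proof -
  have "uniform_limit (cball 0 R) (\<lambda>d z. \<Sum>k<d. z ^ k / fact k) (\<lambda>z::complex. \<Sum>k. z ^ k / fact k) sequentially"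
  proof (rule Weierstrass_m_test)
    show "summable (\<lambda>k. \<bar>R\<bar> ^ k /\<^sub>R fact k)" by (rule summable_exp_generic)
    show "norm (z ^ k / fact k) \<le> \<bar>R\<bar> ^ k /\<^sub>R fact k" if "z \<in> cball 0 R" for k and z :: complex
      using that by (auto simp: norm_divide norm_power divide_simps intro!: power_mono)
  qed
  then show ?thesis by (simp add: exp_def[abs_def] scaleR_conv_of_real divide_inverse mult.commute)
qed

text \<open>
  The exponential sum is approximated by its Taylor polynomials, to which the Chebyshev expansion
  applies.
\<close>

lemma exp_calculus_bound:
  fixes A :: "'h::complex_hilbert_space \<Rightarrow>\<^sub>L 'h" and \<tau> :: "nat \<Rightarrow> real" and w :: "nat \<Rightarrow> 'h"
  assumes sa: "selfadjoint_op A" and r: "norm A \<le> r"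
    and M: "\<And>s j. \<bar>s\<bar> \<le> r \<Longrightarrow> j \<le> 2 \<Longrightarrow> norm (\<Sum>a<n. ((\<i> * \<tau> a) ^ j * exp (\<i> * \<tau> a * s)) *\<^sub>C w a) \<le> M"
  shows "norm (\<Sum>a<n. op_exp (op_scaleC (\<i> * \<tau> a) A) (w a)) \<le> (1 + 4 * (r + r\<^sup>2)) * M"
proof -
  \<comment> \<open>\<open>E d\<close> is a Taylor polynomial of exp, \<open>Q d j\<close> the
    corresponding approximant of the j-th derivative of the exponential sum, \<open>v k\<close> its
    coefficient vectors. Differentiation lowers the truncation: the derivative of
    \<open>Q (Suc d) j\<close> is \<open>Q d (Suc j)\<close>.\<close>
  define E where "E d z = (\<Sum>k<d. z ^ k / fact k)" for d and z :: complex
  define Q where "Q d j s = (\<Sum>a<n. ((\<i> * \<tau> a) ^ j * E d (\<i> * \<tau> a * of_real s)) *\<^sub>C w a)" for d j and s :: real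
  define v where "v k = (\<Sum>a<n. ((\<i> * \<tau> a) ^ k / fact k) *\<^sub>C w a)" for k
  let ?C = "1 + 4 * (r + r\<^sup>2)"
  have r0: "0 \<le> r" using r norm_ge_zero order_trans by blast
  have Q_deriv: "(Q (Suc d) j has_vector_derivative Q d (Suc j) s) (at s)" for d j s
  proof -
    have E': "(E (Suc d) has_field_derivative E d z) (at z)" for z
    proof -
      have "(E (Suc d) has_field_derivative (\<Sum>k<Suc d. of_nat k * z ^ (k - 1) / fact k)) (at z)"
        unfolding E_def by (auto intro!: derivative_eq_intros)
      also have "(\<Sum>k<Suc d. of_nat k * z ^ (k - 1) / fact k) = E d z"
        by (subst sum.lessThan_Suc_shift) (simp add: E_def divide_simps del: of_nat_Suc)
      finally show ?thesis .
    qed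
    have "((\<lambda>s. (\<i> * \<tau> a) ^ j * E (Suc d) (\<i> * \<tau> a * of_real s)) has_vector_derivative
        (\<i> * \<tau> a) ^ Suc j * E d (\<i> * \<tau> a * of_real s)) (at s)" for a
    proof -
      have "((\<lambda>z. (\<i> * \<tau> a) ^ j * E (Suc d) (\<i> * \<tau> a * z)) has_field_derivative
         (\<i> * \<tau> a) ^ Suc j * E d (\<i> * \<tau> a * of_real s)) (at (of_real s))"
        by (rule derivative_eq_intros DERIV_chain2[OF E'] refl)+ (simp add: mult_ac)
      from has_vector_derivative_real_field[OF this] show ?thesis by simp
    qed
    from has_vector_derivative_sum[OF bounded_linear.has_vector_derivative[OF scaleC.bounded_linear_left this]]
    show ?thesis unfolding Q_def[abs_def] .
  qed
  have Q_0: "Q d 0 s = (\<Sum>k<d. s ^ k *\<^sub>R v k)" for d s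
    unfolding Q_def E_def v_def
    by (simp add: scaleR_eq_scaleC scaleC.sum_left scaleC.sum_right scaleC_scaleC power_mult_distrib mult_ac)
       (rule sum.swap)
  have close: "\<forall>\<^sub>F d in sequentially. norm (\<Sum>k<d. op_power A k (v k)) \<le> ?C * (M + \<epsilon>)" if "\<epsilon> > 0" for \<epsilon>
  proof -
    \<comment> \<open>The factor (1 + |\<tau>|)^2 dominates |\<tau>|^j for all j \<le> 2, and
      \<open>R\<close> bounds every exponent |\<tau> s|. Dividing by \<open>W + 1\<close> is safe
      when \<open>W\<close> is 0.\<close>
    define W where "W = (\<Sum>a<n. (1 + \<bar>\<tau> a\<bar>)\<^sup>2 * norm (w a))"
    define R where "R = (\<Sum>a<n. \<bar>\<tau> a\<bar>) * r"
    have W0: "W \<ge> 0" unfolding W_def by (intro sum_nonneg) auto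
    have "\<forall>\<^sub>F d in sequentially. \<forall>z\<in>cball 0 R. dist (E d z) (exp z) < \<epsilon> / (W + 1)"
      using exp_partial_sums_uniform_limit[of R] \<open>\<epsilon> > 0\<close> W0 unfolding uniform_limit_iff E_def by simp
    then obtain d0 where d0: "\<And>d z. d \<ge> d0 \<Longrightarrow> norm z \<le> R \<Longrightarrow> cmod (E d z - exp z) < \<epsilon> / (W + 1)"
      unfolding eventually_sequentially dist_norm Ball_def mem_cball_0 by blast
    have Q_le: "norm (Q d j s) \<le> M + \<epsilon>" if "d \<ge> d0" "\<bar>s\<bar> \<le> r" "j \<le> 2" for d j s
    proof -
      let ?f = "\<Sum>a<n. ((\<i> * \<tau> a) ^ j * exp (\<i> * \<tau> a * s)) *\<^sub>C w a"
      have "Q d j s - ?f = (\<Sum>a<n. ((\<i> * \<tau> a) ^ j * (E d (\<i> * \<tau> a * s) - exp (\<i> * \<tau> a * s))) *\<^sub>C w a)"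
        unfolding Q_def by (simp add: sum_subtractf[symmetric] scaleC.diff_left right_diff_distrib)
      also have "norm \<dots> \<le> (\<Sum>a<n. ((1 + \<bar>\<tau> a\<bar>)\<^sup>2 * norm (w a)) * (\<epsilon> / (W + 1)))"
      proof (rule sum_norm_le)
        fix a assume a: "a \<in> {..<n}"
        have "\<bar>\<tau> a\<bar> * \<bar>s\<bar> \<le> R"
          unfolding R_def using a that(2) r0
          by (intro mult_mono member_le_sum) (auto intro!: sum_nonneg)
        then have "cmod (E d (\<i> * \<tau> a * s) - exp (\<i> * \<tau> a * s)) \<le> \<epsilon> / (W + 1)"
          by (intro less_imp_le[OF d0] that) (simp add: norm_mult)
        moreover have "\<bar>\<tau> a\<bar> ^ j \<le> (1 + \<bar>\<tau> a\<bar>)\<^sup>2"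
          using power_mono[of "\<bar>\<tau> a\<bar>" "1 + \<bar>\<tau> a\<bar>" j] power_increasing[OF \<open>j \<le> 2\<close>, of "1 + \<bar>\<tau> a\<bar>"] by simp
        ultimately have "\<bar>\<tau> a\<bar> ^ j * cmod (E d (\<i> * \<tau> a * s) - exp (\<i> * \<tau> a * s)) * norm (w a)
            \<le> (1 + \<bar>\<tau> a\<bar>)\<^sup>2 * (\<epsilon> / (W + 1)) * norm (w a)"
          using W0 \<open>\<epsilon> > 0\<close> by (intro mult_mono mult_nonneg_nonneg) auto
        then show "norm (((\<i> * \<tau> a) ^ j * (E d (\<i> * \<tau> a * s) - exp (\<i> * \<tau> a * s))) *\<^sub>C w a)
            \<le> ((1 + \<bar>\<tau> a\<bar>)\<^sup>2 * norm (w a)) * (\<epsilon> / (W + 1))"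
          by (simp add: norm_mult norm_power mult_ac)
      qed
      also have "\<dots> = W * (\<epsilon> / (W + 1))" by (simp only: W_def sum_distrib_right)
      also have "\<dots> \<le> \<epsilon>" using W0 \<open>\<epsilon> > 0\<close> by (simp add: field_simps)
      finally have "norm (Q d j s - ?f) \<le> \<epsilon>" .
      then show ?thesis using M[OF that(2,3)] norm_triangle_sub[of "Q d j s" ?f] by linarith
    qed
    have "norm (\<Sum>k<d. op_power A k (v k)) \<le> ?C * (M + \<epsilon>)" if "d \<ge> d0 + 2" for d
    proof -
      \<comment> \<open>Two differentiations lower the truncation from d to e, which must still be
        at least \<open>d0\<close>.\<close>
      define e where "e = d - 2"
      have d: "d = Suc (Suc e)" using that by (simp add: e_def)
      have "e \<ge> d0" using that d by simp
      then show ?thesis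
        using Q_le by (intro poly_calculus_bound[OF sa r Q_0[of d] Q_deriv[of "Suc e" 0, folded d] Q_deriv]) (auto simp: d)
    qed
    then show ?thesis unfolding eventually_sequentially by blast
  qed
  have lim: "(\<lambda>d. \<Sum>k<d. op_power A k (v k)) \<longlonglongrightarrow> (\<Sum>a<n. op_exp (op_scaleC (\<i> * \<tau> a) A) (w a))"
  proof -
    have "(\<lambda>d. \<Sum>a<n. \<Sum>k<d. ((\<i> * \<tau> a) ^ k / fact k) *\<^sub>C op_power A k (w a)) \<longlonglongrightarrow>
        (\<Sum>a<n. op_exp (op_scaleC (\<i> * \<tau> a) A) (w a))"
      using op_exp_scaleC_sums[OF selfadjoint_imp_clinear[OF sa]] unfolding sums_def by (intro tendsto_sum) blast
    moreover have "(\<Sum>a<n. \<Sum>k<d. ((\<i> * \<tau> a) ^ k / fact k) *\<^sub>C op_power A k (w a)) = (\<Sum>k<d. op_power A k (v k))" for d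
      unfolding v_def
      by (subst sum.swap)
         (simp add: blinfun.sum_right clinear_opD[OF clinear_op_power[OF selfadjoint_imp_clinear[OF sa]]])
    ultimately show ?thesis by simp
  qed
  have "norm (\<Sum>a<n. op_exp (op_scaleC (\<i> * \<tau> a) A) (w a)) \<le> ?C * (M + \<epsilon>)" if "\<epsilon> > 0" for \<epsilon>
    by (rule tendsto_upperbound[OF tendsto_norm[OF lim] close[OF that]]) simp
  moreover have C: "?C > 0" using r0 by (simp add: add_pos_nonneg)
  ultimately have "norm (\<Sum>a<n. op_exp (op_scaleC (\<i> * \<tau> a) A) (w a)) \<le> ?C * (M + \<epsilon> / ?C)" if "\<epsilon> > 0" for \<epsilon>
    using that by (meson divide_pos_pos)
  moreover have "?C * (M + \<epsilon> / ?C) = ?C * M + \<epsilon>" for \<epsilon>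
    using C by (simp only: distrib_left) simp
  ultimately have "norm (\<Sum>a<n. op_exp (op_scaleC (\<i> * \<tau> a) A) (w a)) \<le> ?C * M + \<epsilon>" if "\<epsilon> > 0" for \<epsilon>
    using that by (simp only:)
  then show ?thesis by (rule field_le_epsilon)
qed

section \<open>Operator families of exponential type\<close>

text \<open>The iterated partial derivative in y, along \<open>js\<close>, of the character exp(i
  \<theta>.y), in a closed form that makes its multiplicativity in \<open>js\<close> and y jointly
  immediate.\<close>

definition exp_deriv :: "'n::finite list \<Rightarrow> real ^ 'n::finite \<Rightarrow> real ^ 'n::finite \<Rightarrow> complex" where
  "exp_deriv js \<theta> y = (\<Prod>j\<leftarrow>js. \<i> * complex_of_real (\<theta> $ j)) * exp (\<i> * complex_of_real (\<theta> \<bullet> y))"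

lemma exp_deriv_append: "exp_deriv (js @ ks) \<theta> (x + y) = exp_deriv js \<theta> x * exp_deriv ks \<theta> y"
  by (simp add: exp_deriv_def inner_add_right distrib_left exp_add)

text \<open>
  A family \<open>F\<close> that is bounded in this sense behaves like \<open>\<theta> \<mapsto> \<integral> e\<^bsup>i\<theta>\<cdot>y\<^esup> dE(y)\<close> for an
  operator-valued distribution \<open>E\<close> of order \<open>k\<close> supported in the box of half-widths \<open>r\<close>.
\<close>

definition exp_type_bound ::
  "(real ^ 'n::finite \<Rightarrow> ('h::complex_hilbert_space \<Rightarrow>\<^sub>L 'h)) \<Rightarrow> real ^ 'n::finite \<Rightarrow> nat \<Rightarrow> real \<Rightarrow> bool" where
  "exp_type_bound F r k C \<longleftrightarrow> (\<forall>n (\<theta> :: nat \<Rightarrow> real ^ 'n) (w :: nat \<Rightarrow> 'h) M.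
     (\<forall>js y. length js \<le> k \<longrightarrow> (\<forall>j. \<bar>y $ j\<bar> \<le> r $ j) \<longrightarrow>
        norm (\<Sum>a<n. exp_deriv js (\<theta> a) y *\<^sub>C w a) \<le> M) \<longrightarrow>
     norm (\<Sum>a<n. blinfun_apply (F (\<theta> a)) (w a)) \<le> C * M)"

lemma exp_type_boundD:
  fixes F :: "real ^ 'n::finite \<Rightarrow> ('h::complex_hilbert_space \<Rightarrow>\<^sub>L 'h)"
    and \<theta> :: "nat \<Rightarrow> real ^ 'n" and w :: "nat \<Rightarrow> 'h"
  assumes "exp_type_bound F r k C"
    and "\<And>js y. length js \<le> k \<Longrightarrow> (\<And>j. \<bar>y $ j\<bar> \<le> r $ j) \<Longrightarrow>
        norm (\<Sum>a<n. exp_deriv js (\<theta> a) y *\<^sub>C w a) \<le> M"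
  shows "norm (\<Sum>a<n. blinfun_apply (F (\<theta> a)) (w a)) \<le> C * M"
  using assms(1) unfolding exp_type_bound_def
  by (elim allE[of _ n] allE[of _ \<theta>] allE[of _ w] allE[of _ M] mp) (use assms(2) in blast)

lemma exp_type_bound_id:
  "exp_type_bound (\<lambda>_ :: real ^ 'n::finite. id_blinfun :: 'h::complex_hilbert_space \<Rightarrow>\<^sub>L 'h) 0 0 1"
  unfolding exp_type_bound_def
proof (intro allI impI, goal_cases)
  case (1 n \<theta> w M)
  then show ?case using 1[rule_format, of "[]" 0] by (simp add: exp_deriv_def)
qed

text \<open>For fixed js and y the number \<open>exp_deriv js \<theta> y\<close> passes through the
  complex linear \<open>G \<theta>\<close>. The bound for F is applied to the vectors G(\<theta>_a)
  w_a, then the bound for G to the multiples of w_a by these numbers; multiplicativity merges the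
  two lists and the two points, so boxes and orders add up and constants multiply.\<close>

lemma exp_type_bound_compose:
  fixes F G :: "real ^ 'n::finite \<Rightarrow> ('h::complex_hilbert_space \<Rightarrow>\<^sub>L 'h)"
  assumes F: "exp_type_bound F r k C" and G: "exp_type_bound G s l D" and lin: "\<And>\<theta>. clinear_op (G \<theta>)"
  shows "exp_type_bound (\<lambda>\<theta>. F \<theta> o\<^sub>L G \<theta>) (r + s) (k + l) (C * D)"
  unfolding exp_type_bound_def
proof (intro allI impI)
  fix n and \<theta> :: "nat \<Rightarrow> real ^ 'n" and w :: "nat \<Rightarrow> 'h" and M :: real
  assume *: "\<forall>js y. length js \<le> k + l \<longrightarrow> (\<forall>j. \<bar>y $ j\<bar> \<le> (r + s) $ j) \<longrightarrow>
        norm (\<Sum>a<n. exp_deriv js (\<theta> a) y *\<^sub>C w a) \<le> M"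
  have "norm (\<Sum>a<n. F (\<theta> a) (G (\<theta> a) (w a))) \<le> C * (D * M)"
  proof (rule exp_type_boundD[OF F])
    fix js :: "'n list" and y :: "real ^ 'n" assume js: "length js \<le> k" and y: "\<And>j. \<bar>y $ j\<bar> \<le> r $ j"
    have "norm (\<Sum>a<n. G (\<theta> a) (exp_deriv js (\<theta> a) y *\<^sub>C w a)) \<le> D * M"
    proof (rule exp_type_boundD[OF G])
      fix ks :: "'n list" and z :: "real ^ 'n" assume ks: "length ks \<le> l" and z: "\<And>j. \<bar>z $ j\<bar> \<le> s $ j"
      have "norm (\<Sum>a<n. exp_deriv (ks @ js) (\<theta> a) (z + y) *\<^sub>C w a) \<le> M"
      proof (rule *[rule_format])
        show "\<bar>(z + y) $ j\<bar> \<le> (r + s) $ j" for j using y[of j] z[of j] by simp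
      qed (use js ks in simp)
      then show "norm (\<Sum>a<n. exp_deriv ks (\<theta> a) z *\<^sub>C exp_deriv js (\<theta> a) y *\<^sub>C w a) \<le> M"
        by (simp add: exp_deriv_append scaleC_scaleC)
    qed
    then show "norm (\<Sum>a<n. exp_deriv js (\<theta> a) y *\<^sub>C G (\<theta> a) (w a)) \<le> D * M"
      by (simp add: clinear_opD[OF lin])
  qed
  then show "norm (\<Sum>a<n. (F (\<theta> a) o\<^sub>L G (\<theta> a)) (w a)) \<le> C * D * M"
    by (simp add: mult.assoc)
qed

lemma exp_type_bound_sum:
  fixes F :: "'i \<Rightarrow> real ^ 'n::finite \<Rightarrow> ('h::complex_hilbert_space \<Rightarrow>\<^sub>L 'h)"
  assumes "\<And>i. i \<in> I \<Longrightarrow> exp_type_bound (F i) r k (C i)"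
  shows "exp_type_bound (\<lambda>\<theta>. \<Sum>i\<in>I. op_scaleC (c i) (F i \<theta>)) r k (\<Sum>i\<in>I. cmod (c i) * C i)"
  unfolding exp_type_bound_def
proof (intro allI impI)
  fix n and \<theta> :: "nat \<Rightarrow> real ^ 'n" and w :: "nat \<Rightarrow> 'h" and M :: real
  assume *: "\<forall>js y. length js \<le> k \<longrightarrow> (\<forall>j. \<bar>y $ j\<bar> \<le> r $ j) \<longrightarrow>
        norm (\<Sum>a<n. exp_deriv js (\<theta> a) y *\<^sub>C w a) \<le> M"
  have "(\<Sum>a<n. (\<Sum>i\<in>I. op_scaleC (c i) (F i (\<theta> a))) (w a)) = (\<Sum>i\<in>I. c i *\<^sub>C (\<Sum>a<n. F i (\<theta> a) (w a)))"
    by (simp add: blinfun.sum_left scaleC.sum_right) (rule sum.swap)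
  also have "norm \<dots> \<le> (\<Sum>i\<in>I. cmod (c i) * (C i * M))"
  proof (rule sum_norm_le)
    fix i assume "i \<in> I"
    then have "norm (\<Sum>a<n. F i (\<theta> a) (w a)) \<le> C i * M"
      by (rule exp_type_boundD[OF assms]) (use * in blast)
    then show "norm (c i *\<^sub>C (\<Sum>a<n. F i (\<theta> a) (w a))) \<le> cmod (c i) * (C i * M)"
      by (simp add: mult_left_mono)
  qed
  finally show "norm (\<Sum>a<n. (\<Sum>i\<in>I. op_scaleC (c i) (F i (\<theta> a))) (w a)) \<le> (\<Sum>i\<in>I. cmod (c i) * C i) * M"
    by (simp add: sum_distrib_right mult.assoc)
qed

text \<open>The frequency \<theta>_j / N at a point s of [-norm A, norm A] is the frequency
  \<theta>_j at s / N, so the box shrinks to a segment of half-width norm A / N on the j-axis. The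
  factors 1 / N^q that the derivatives produce are at most 1.\<close>

lemma exp_type_bound_exp:
  fixes A :: "'h::complex_hilbert_space \<Rightarrow>\<^sub>L 'h" and j :: "'n::finite"
  assumes sa: "selfadjoint_op A" and "N \<ge> 1"
  shows "exp_type_bound (\<lambda>\<theta>. op_exp (op_scaleC (\<i> * complex_of_real (\<theta> $ j) / of_nat N) A))
     (axis j (norm A / real N)) 2 (1 + 4 * (norm A + (norm A)\<^sup>2))"
  unfolding exp_type_bound_def
proof (intro allI impI)
  fix n and \<theta> :: "nat \<Rightarrow> real ^ 'n" and w :: "nat \<Rightarrow> 'h" and M :: real
  assume *: "\<forall>js y. length js \<le> 2 \<longrightarrow> (\<forall>i. \<bar>y $ i\<bar> \<le> axis j (norm A / real N) $ i) \<longrightarrow>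
        norm (\<Sum>a<n. exp_deriv js (\<theta> a) y *\<^sub>C w a) \<le> M"
  have N: "real N \<ge> 1" "N \<noteq> 0" using \<open>N \<ge> 1\<close> by auto
  define \<tau> where "\<tau> a = \<theta> a $ j / real N" for a
  have "norm (\<Sum>a<n. op_exp (op_scaleC (\<i> * \<tau> a) A) (w a)) \<le> (1 + 4 * (norm A + (norm A)\<^sup>2)) * M"
  proof (rule exp_calculus_bound[OF sa order_refl])
    fix s :: real and q :: nat assume s: "\<bar>s\<bar> \<le> norm A" and q: "q \<le> 2"
    let ?y = "axis j (s / real N) :: real ^ 'n"
    have "(\<i> * \<tau> a) ^ q * exp (\<i> * \<tau> a * s) = (1 / of_nat N ^ q) * exp_deriv (replicate q j) (\<theta> a) ?y" for a
      using N by (simp add: exp_deriv_def \<tau>_def inner_axis map_replicate_const prod_list_replicate field_simps power_divide)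
    then have "(\<Sum>a<n. ((\<i> * \<tau> a) ^ q * exp (\<i> * \<tau> a * s)) *\<^sub>C w a) =
        (1 / of_nat N ^ q) *\<^sub>C (\<Sum>a<n. exp_deriv (replicate q j) (\<theta> a) ?y *\<^sub>C w a)"
      by (simp only: scaleC.sum_right scaleC_scaleC)
    also have "norm \<dots> \<le> 1 * norm (\<Sum>a<n. exp_deriv (replicate q j) (\<theta> a) ?y *\<^sub>C w a)"
      unfolding norm_scaleC using N by (intro mult_right_mono) (auto simp: norm_divide norm_power)
    also have "\<dots> \<le> M"
    proof -
      have "\<bar>?y $ i\<bar> \<le> axis j (norm A / real N) $ i" for i
        using s N by (auto simp: axis_def divide_right_mono)
      then show ?thesis using *[rule_format, of "replicate q j" ?y] q by simp
    qed
    finally show "norm (\<Sum>a<n. ((\<i> * \<tau> a) ^ q * exp (\<i> * \<tau> a * s)) *\<^sub>C w a) \<le> M" .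
  qed
  then show "norm (\<Sum>a<n. op_exp (op_scaleC (\<i> * complex_of_real (\<theta> a $ j) / of_nat N) A) (w a))
      \<le> (1 + 4 * (norm A + (norm A)\<^sup>2)) * M"
    by (simp add: \<tau>_def)
qed

lemma exp_type_bound_op_power:
  assumes "exp_type_bound F r k C" "\<And>\<theta>. clinear_op (F \<theta>)"
  shows "exp_type_bound (\<lambda>\<theta>. op_power (F \<theta>) m) (real m *\<^sub>R r) (m * k) (C ^ m)"
proof (induction m)
  case 0
  then show ?case by (simp add: exp_type_bound_id)
next
  case (Suc m)
  have "exp_type_bound (\<lambda>\<theta>. F \<theta> o\<^sub>L op_power (F \<theta>) m) (r + real m *\<^sub>R r) (k + m * k) (C * C ^ m)"
    by (intro exp_type_bound_compose assms Suc clinear_op_power)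
  then show ?case by (simp add: scaleR_left_distrib)
qed

section \<open>The quantum characteristic function\<close>

lemma has_sum_sum:
  fixes f :: "'i \<Rightarrow> 'a \<Rightarrow> 'b::topological_comm_monoid_add"
  assumes "\<And>i. i \<in> I \<Longrightarrow> (f i has_sum s i) B"
  shows "((\<lambda>x. \<Sum>i\<in>I. f i x) has_sum (\<Sum>i\<in>I. s i)) B"
  using assms by (induction I rule: infinite_finite_induct) (auto intro: has_sum_add)

context
  fixes A :: "'n::{finite,linorder} \<Rightarrow> ('h::complex_hilbert_space \<Rightarrow>\<^sub>L 'h)"
    and N :: nat and w :: "('n \<Rightarrow> 'n) \<Rightarrow> complex"
  assumes sa: "\<And>j. selfadjoint_op (A j)" and N: "N \<ge> 1"
    and w_sum: "(\<Sum>\<sigma> | \<sigma> permutes UNIV. w \<sigma>) = 1"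
    and w_norm: "(\<Sum>\<sigma> | \<sigma> permutes UNIV. norm (w \<sigma>)) = 1"
begin

abbreviation exp_factor :: "'n \<Rightarrow> (real, 'n) vec \<Rightarrow> ('h \<Rightarrow>\<^sub>L 'h)" where
  "exp_factor j \<theta> \<equiv> op_exp (op_scaleC (\<i> * complex_of_real (\<theta> $ j) / of_nat N) (A j))"

lemma clinear_exp_factor: "clinear_op (exp_factor j \<theta>)"
  by (intro clinear_op_exp clinear_op_scaleC selfadjoint_imp_clinear sa)

lemma clinear_foldr_exp_factor: "clinear_op (foldr (\<lambda>j X. exp_factor (\<sigma> j) \<theta> o\<^sub>L X) js id_blinfun)"
  by (induction js) (simp_all add: clinear_op_id clinear_op_compose clinear_exp_factor)

lemma clinear_symmetrized:
  "clinear_op (\<Sum>\<sigma> | \<sigma> permutes UNIV. op_scaleC (w \<sigma>) (ordered_op_prod (\<lambda>j. exp_factor (\<sigma> j) \<theta>)))"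
  unfolding ordered_op_prod_def by (intro clinear_op_sum clinear_op_scaleC clinear_foldr_exp_factor)

lemma clinear_quantum_char_op: "clinear_op (quantum_char_op N w A \<theta>)"
  unfolding quantum_char_op_def by (intro clinear_op_power clinear_symmetrized)

text \<open>Exponentials of imaginary multiples of self-adjoint operators are isometries, hence so
  are their products. Since the weights have total modulus 1, the weighted sum is a contraction, and
  so are its powers.\<close>

lemma norm_quantum_char_op_le: "norm (quantum_char_op N w A \<theta> x) \<le> norm x"
proof -
  have exp: "norm (exp_factor j \<theta> x) = norm x" for j x
    by (intro norm_op_exp_selfadjoint sa) simp
  have "norm (foldr (\<lambda>j X. exp_factor (\<sigma> j) \<theta> o\<^sub>L X) js id_blinfun x) = norm x" for \<sigma> js x
    by (induction js) (simp_all add: exp)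
  then have prod: "norm (ordered_op_prod (\<lambda>j. exp_factor (\<sigma> j) \<theta>) x) = norm x" for \<sigma> x
    by (simp add: ordered_op_prod_def)
  let ?S = "\<Sum>\<sigma> | \<sigma> permutes UNIV. op_scaleC (w \<sigma>) (ordered_op_prod (\<lambda>j. exp_factor (\<sigma> j) \<theta>))"
  have S: "norm (?S x) \<le> norm x" for x
  proof -
    have "norm (?S x) \<le> (\<Sum>\<sigma> | \<sigma> permutes UNIV. norm (w \<sigma>) * norm x)"
      unfolding blinfun.sum_left by (intro sum_norm_le) (simp add: prod)
    also have "\<dots> = norm x" by (simp add: sum_distrib_right[symmetric] w_norm)
    finally show ?thesis .
  qed
  have "norm (op_power ?S m x) \<le> norm x" for m
    by (induction m) (auto intro: order_trans[OF S])
  then show ?thesis by (simp add: quantum_char_op_def)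
qed

lemma quantum_char_op_0: "quantum_char_op N w A 0 x = x"
proof -
  have "op_exp (op_scaleC 0 (A j)) = id_blinfun" for j
  proof (rule blinfun_eqI)
    fix x
    have "(\<lambda>k. (0 ^ k / fact k) *\<^sub>C op_power (A j) k x) sums op_exp (op_scaleC 0 (A j)) x"
      by (rule op_exp_scaleC_sums[OF selfadjoint_imp_clinear[OF sa]])
    moreover have "(\<lambda>k. (0 ^ k / fact k) *\<^sub>C op_power (A j) k x) sums (\<Sum>k\<in>{0}. (0 ^ k / fact k) *\<^sub>C op_power (A j) k x)"
      by (rule sums_finite) (auto simp: power_0_left)
    ultimately show "op_exp (op_scaleC 0 (A j)) x = id_blinfun x"
      using sums_unique2 by fastforce
  qed
  then have "ordered_op_prod (\<lambda>j. exp_factor (\<sigma> j) 0) = id_blinfun" for \<sigma> :: "'n \<Rightarrow> 'n"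
  proof -
    have "foldr (\<lambda>j X. exp_factor (\<sigma> j) 0 o\<^sub>L X) js id_blinfun = id_blinfun" for js
      by (induction js) (auto simp: \<open>\<And>j. op_exp (op_scaleC 0 (A j)) = id_blinfun\<close> intro!: blinfun_eqI)
    then show ?thesis by (simp add: ordered_op_prod_def)
  qed
  then have S: "(\<Sum>\<sigma> | \<sigma> permutes UNIV. op_scaleC (w \<sigma>) (ordered_op_prod (\<lambda>j. exp_factor (\<sigma> j) 0))) x = x" for x
    by (simp add: blinfun.sum_left scaleC.sum_left[symmetric] w_sum)
  have "op_power T m x = x" if "\<And>x. T x = x" for T :: "'h \<Rightarrow>\<^sub>L 'h" and m x
    by (induction m) (simp_all add: that)
  from this[OF S] show ?thesis unfolding quantum_char_op_def .
qed

text \<open>Every ordering uses each coordinate exactly once, so all permutations share the box with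
  half-widths norm (A j) / N. The weighted sum keeps this box and the N-th power enlarges it N
  times, which restores exactly norm (A j).\<close>

lemma exp_type_bound_quantum_char_op:
  "\<exists>k C. exp_type_bound (quantum_char_op N w A) (\<chi> j. norm (A j)) k C"
proof -
  define D where "D j = 1 + 4 * (norm (A j) + (norm (A j))\<^sup>2)" for j
  have fold: "exp_type_bound (\<lambda>\<theta>. foldr (\<lambda>j X. exp_factor (\<sigma> j) \<theta> o\<^sub>L X) js id_blinfun)
      (\<Sum>j\<leftarrow>js. axis (\<sigma> j) (norm (A (\<sigma> j)) / real N)) (2 * length js) (\<Prod>j\<leftarrow>js. D (\<sigma> j))" for \<sigma> js
  proof (induction js)
    case Nil
    then show ?case by (simp add: exp_type_bound_id)
  next
    case (Cons j js)
    show ?case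
      using exp_type_bound_compose[OF exp_type_bound_exp[OF sa N] Cons clinear_foldr_exp_factor, of "\<sigma> j" "\<sigma> j"]
      by (simp add: D_def)
  qed
  let ?l = "sorted_list_of_set (UNIV :: 'n set)"
  have prod: "exp_type_bound (\<lambda>\<theta>. ordered_op_prod (\<lambda>j. exp_factor (\<sigma> j) \<theta>))
      (\<chi> j. norm (A j) / real N) (2 * length ?l) (\<Prod>j\<leftarrow>?l. D (\<sigma> j))" if "\<sigma> permutes UNIV" for \<sigma>
  proof -
    have "(\<Sum>j\<leftarrow>?l. axis (\<sigma> j) (norm (A (\<sigma> j)) / real N)) = (\<Sum>j\<in>UNIV. axis (\<sigma> j) (norm (A (\<sigma> j)) / real N))"
      by (subst sum_list_distinct_conv_sum_set) auto
    also have "\<dots> = (\<Sum>j\<in>UNIV. axis j (norm (A j) / real N))"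
      using sum.permute[OF that, of "\<lambda>j. axis j (norm (A j) / real N)"] by (simp add: o_def)
    also have "\<dots> = (\<chi> j. norm (A j) / real N)"
      by (simp add: vec_eq_iff axis_def)
    finally show ?thesis
      using fold[of \<sigma> ?l] unfolding ordered_op_prod_def by simp
  qed
  have "exp_type_bound (quantum_char_op N w A) (real N *\<^sub>R (\<chi> j. norm (A j) / real N)) (N * (2 * length ?l))
      ((\<Sum>\<sigma> | \<sigma> permutes UNIV. cmod (w \<sigma>) * (\<Prod>j\<leftarrow>?l. D (\<sigma> j))) ^ N)"
    unfolding quantum_char_op_def[abs_def]
    by (intro exp_type_bound_op_power exp_type_bound_sum clinear_symmetrized) (use prod in auto)
  moreover have "real N *\<^sub>R (\<chi> j. norm (A j) / real N) = (\<chi> j. norm (A j))"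
    using N by (simp add: vec_eq_iff)
  ultimately show ?thesis by metis
qed

context
  fixes \<rho> :: "'h \<Rightarrow>\<^sub>L 'h"
  assumes \<rho>: "density_operator \<rho>"
begin

lemma norm_quantum_char_fun_le: "cmod (quantum_char_fun N w A \<rho> \<theta>) \<le> 1"
proof -
  obtain v :: "nat \<Rightarrow> 'h" where v: "((\<lambda>i. (norm (v i))\<^sup>2) has_sum 1) UNIV"
    and tr: "\<And>T. clinear_op T \<Longrightarrow> ((\<lambda>i. cinner (v i) (blinfun_apply T (v i))) has_sum op_trace (T o\<^sub>L \<rho>)) UNIV"
    using density_operator_trace[OF \<rho>] by blast
  show ?thesis
    unfolding quantum_char_fun_def
  proof (rule norm_infsum_le[OF tr[OF clinear_quantum_char_op] v])
    show "cmod (cinner (v i) (quantum_char_op N w A \<theta> (v i))) \<le> (norm (v i))\<^sup>2" for i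
      using cmod_cinner_le[of "v i" "quantum_char_op N w A \<theta> (v i)"]
        mult_left_mono[OF norm_quantum_char_op_le[of \<theta> "v i"], of "norm (v i)"]
      by (simp add: power2_eq_square)
  qed
qed

lemma quantum_char_fun_0: "quantum_char_fun N w A \<rho> 0 = 1"
proof -
  obtain v :: "nat \<Rightarrow> 'h" where v: "((\<lambda>i. (norm (v i))\<^sup>2) has_sum 1) UNIV"
    and tr: "\<And>T. clinear_op T \<Longrightarrow> ((\<lambda>i. cinner (v i) (blinfun_apply T (v i))) has_sum op_trace (T o\<^sub>L \<rho>)) UNIV"
    using density_operator_trace[OF \<rho>] by blast
  have "((\<lambda>i. complex_of_real ((norm (v i))\<^sup>2)) has_sum complex_of_real 1) UNIV"
    using v by (rule has_sum_of_real)
  moreover have "((\<lambda>i. complex_of_real ((norm (v i))\<^sup>2)) has_sum quantum_char_fun N w A \<rho> 0) UNIV"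
    using tr[OF clinear_quantum_char_op, of 0]
    by (simp add: quantum_char_fun_def quantum_char_op_0 cinner_self)
  ultimately show ?thesis using has_sum_unique by fastforce
qed

text \<open>On the vectors c_a v_i the vector-valued trigonometric sum is the scalar one times v_i.
  The operator bound thus contributes C M times the squared norm of v_i for each i, and these
  squares sum to 1.\<close>

lemma quantum_char_fun_bound:
  "\<exists>k C. \<forall>n (c :: nat \<Rightarrow> complex) (\<theta> :: nat \<Rightarrow> (real, 'n) vec) M.
     (\<forall>js y. length js \<le> k \<longrightarrow> y \<in> cbox (\<chi> j. - norm (A j)) (\<chi> j. norm (A j)) \<longrightarrow>
        cmod (\<Sum>a<n. c a * exp_deriv js (\<theta> a) y) \<le> M) \<longrightarrow>
     cmod (\<Sum>a<n. c a * quantum_char_fun N w A \<rho> (\<theta> a)) \<le> C * M"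
proof -
  obtain v :: "nat \<Rightarrow> 'h" where v: "((\<lambda>i. (norm (v i))\<^sup>2) has_sum 1) UNIV"
    and tr: "\<And>T. clinear_op T \<Longrightarrow> ((\<lambda>i. cinner (v i) (blinfun_apply T (v i))) has_sum op_trace (T o\<^sub>L \<rho>)) UNIV"
    using density_operator_trace[OF \<rho>] by blast
  obtain k C where bd: "exp_type_bound (quantum_char_op N w A) (\<chi> j. norm (A j)) k C"
    using exp_type_bound_quantum_char_op by blast
  have "cmod (\<Sum>a<n. c a * quantum_char_fun N w A \<rho> (\<theta> a)) \<le> C * M"
    if *: "\<And>js y. length js \<le> k \<Longrightarrow> y \<in> cbox (\<chi> j. - norm (A j)) (\<chi> j. norm (A j)) \<Longrightarrow>
        cmod (\<Sum>a<n. c a * exp_deriv js (\<theta> a) y) \<le> M"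
    for n and c :: "nat \<Rightarrow> complex" and \<theta> :: "nat \<Rightarrow> (real, 'n) vec" and M
  proof -
    let ?Q = "quantum_char_op N w A"
    have "((\<lambda>i. \<Sum>a<n. c a * cinner (v i) (?Q (\<theta> a) (v i))) has_sum
        (\<Sum>a<n. c a * quantum_char_fun N w A \<rho> (\<theta> a))) UNIV"
      unfolding quantum_char_fun_def
      by (intro has_sum_sum has_sum_cmult_right tr clinear_quantum_char_op)
    moreover have "((\<lambda>i. C * M * (norm (v i))\<^sup>2) has_sum (C * M * 1)) UNIV"
      by (intro has_sum_cmult_right v)
    moreover have "cmod (\<Sum>a<n. c a * cinner (v i) (?Q (\<theta> a) (v i))) \<le> C * M * (norm (v i))\<^sup>2" for i
    proof -
      have "norm (\<Sum>a<n. ?Q (\<theta> a) (c a *\<^sub>C v i)) \<le> C * (M * norm (v i))"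
      proof (rule exp_type_boundD[OF bd])
        fix js :: "'n list" and y :: "(real, 'n) vec" assume js: "length js \<le> k" and y: "\<And>j. \<bar>y $ j\<bar> \<le> (\<chi> j. norm (A j)) $ j"
        have "y \<in> cbox (\<chi> j. - norm (A j)) (\<chi> j. norm (A j))"
          using y by (auto simp: mem_box_cart abs_le_iff minus_le_iff)
        then have "cmod (\<Sum>a<n. c a * exp_deriv js (\<theta> a) y) \<le> M" by (rule *[OF js])
        moreover have "(\<Sum>a<n. exp_deriv js (\<theta> a) y *\<^sub>C c a *\<^sub>C v i) = (\<Sum>a<n. c a * exp_deriv js (\<theta> a) y) *\<^sub>C v i"
          by (simp add: scaleC.sum_left scaleC_scaleC mult.commute)
        ultimately show "norm (\<Sum>a<n. exp_deriv js (\<theta> a) y *\<^sub>C c a *\<^sub>C v i) \<le> M * norm (v i)"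
          by (simp add: mult_right_mono)
      qed
      then have "norm (v i) * norm (\<Sum>a<n. ?Q (\<theta> a) (c a *\<^sub>C v i)) \<le> norm (v i) * (C * (M * norm (v i)))"
        by (rule mult_left_mono) simp
      moreover have "(\<Sum>a<n. c a * cinner (v i) (?Q (\<theta> a) (v i))) = cinner (v i) (\<Sum>a<n. ?Q (\<theta> a) (c a *\<^sub>C v i))"
        by (simp add: cinner.sum_right clinear_opD[OF clinear_quantum_char_op])
      ultimately show ?thesis
        using cmod_cinner_le[of "v i" "\<Sum>a<n. ?Q (\<theta> a) (c a *\<^sub>C v i)"]
        by (simp add: power2_eq_square mult_ac)
    qed
    ultimately show ?thesis using norm_infsum_le by fastforce
  qed
  then show ?thesis by blast
qed

end

end

section \<open>Calculus of smooth functions\<close>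

lemma has_derivative_partial_deriv:
  assumes "(f has_derivative f') (at x)"
  shows "partial_deriv j f x = f' (axis j 1)"
proof -
  have "((\<lambda>t. f (x + t *\<^sub>R axis j 1)) has_derivative (\<lambda>t. f' (t *\<^sub>R axis j 1))) (at 0)"
    by (rule has_derivative_compose[of "\<lambda>t. x + t *\<^sub>R axis j 1" _ _ _ f f'])
       (use assms in \<open>auto intro!: derivative_eq_intros\<close>)
  then have "((\<lambda>t. f (x + t *\<^sub>R axis j 1)) has_vector_derivative f' (axis j 1)) (at 0)"
    using linear_cmul[OF has_derivative_linear[OF assms]] by (simp add: has_vector_derivative_def)
  then show ?thesis unfolding partial_deriv_def by (rule vector_derivative_at)
qed

lemma has_vector_derivative_partial_deriv:
  assumes "f differentiable (at (x + s *\<^sub>R axis j 1))"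
  shows "((\<lambda>s. f (x + s *\<^sub>R axis j 1)) has_vector_derivative partial_deriv j f (x + s *\<^sub>R axis j 1)) (at s)"
proof -
  obtain f' where f': "(f has_derivative f') (at (x + s *\<^sub>R axis j 1))"
    using assms by (auto simp: differentiable_def)
  have "((\<lambda>s. f (x + s *\<^sub>R axis j 1)) has_derivative (\<lambda>t. f' (t *\<^sub>R axis j 1))) (at s)"
    by (rule has_derivative_compose[of "\<lambda>t. x + t *\<^sub>R axis j 1" _ _ _ f f'])
       (use f' in \<open>auto intro!: derivative_eq_intros\<close>)
  then show ?thesis
    using linear_cmul[OF has_derivative_linear[OF f']] has_derivative_partial_deriv[OF f']
    by (simp add: has_vector_derivative_def)
qed

lemma partial_deriv_add:
  assumes "\<And>x. f differentiable (at x)" "\<And>x. g differentiable (at x)"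
  shows "partial_deriv j (\<lambda>x. f x + g x) = (\<lambda>x. partial_deriv j f x + partial_deriv j g x)"
proof
  fix x
  obtain f' where f': "(f has_derivative f') (at x)"
    using assms(1) unfolding differentiable_def by blast
  obtain g' where g': "(g has_derivative g') (at x)"
    using assms(2) unfolding differentiable_def by blast
  show "partial_deriv j (\<lambda>x. f x + g x) x = partial_deriv j f x + partial_deriv j g x"
    unfolding has_derivative_partial_deriv[OF f'] has_derivative_partial_deriv[OF g']
      has_derivative_partial_deriv[OF has_derivative_add[OF f' g']] ..
qed

lemma partial_deriv_mult:
  assumes "\<And>x. f differentiable (at x)" "\<And>x. g differentiable (at x)"
  shows "partial_deriv j (\<lambda>x. f x * g x) = (\<lambda>x. f x * partial_deriv j g x + partial_deriv j f x * g x)"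
proof
  fix x
  obtain f' where f': "(f has_derivative f') (at x)"
    using assms(1) unfolding differentiable_def by blast
  obtain g' where g': "(g has_derivative g') (at x)"
    using assms(2) unfolding differentiable_def by blast
  show "partial_deriv j (\<lambda>x. f x * g x) x = f x * partial_deriv j g x + partial_deriv j f x * g x"
    unfolding has_derivative_partial_deriv[OF f'] has_derivative_partial_deriv[OF g']
      has_derivative_partial_deriv[OF has_derivative_mult[OF f' g']] ..
qed

lemma partial_deriv_cnj:
  assumes "\<And>x. f differentiable (at x)"
  shows "partial_deriv j (\<lambda>x. cnj (f x)) = (\<lambda>x. cnj (partial_deriv j f x))"
proof
  fix x
  obtain f' where f': "(f has_derivative f') (at x)"
    using assms unfolding differentiable_def by meson
  show "partial_deriv j (\<lambda>x. cnj (f x)) x = cnj (partial_deriv j f x)"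
    using has_derivative_partial_deriv[OF has_derivative_cnj[OF f']] has_derivative_partial_deriv[OF f'] by simp
qed

lemma partial_deriv_const: "partial_deriv j (\<lambda>_. c) = (\<lambda>_. 0)"
  using has_derivative_partial_deriv[OF has_derivative_const] by fast

abbreviation iter_deriv :: "'n list \<Rightarrow> (real ^ 'n::finite \<Rightarrow> complex) \<Rightarrow> (real ^ 'n::finite \<Rightarrow> complex)" where
  "iter_deriv js f \<equiv> foldr partial_deriv js f"

lemma smooth_differentiable: "smooth f \<Longrightarrow> f differentiable (at x)"
  unfolding smooth_def by (metis foldr.simps(1) id_apply)

lemma smooth_continuous: "smooth f \<Longrightarrow> continuous_on S f"
  by (meson continuous_at_imp_continuous_on differentiable_imp_continuous_within smooth_differentiable)

lemma smooth_iter_deriv: "smooth f \<Longrightarrow> smooth (iter_deriv js f)"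
  unfolding smooth_def by (metis foldr_append)

lemma smooth_partial_deriv: "smooth f \<Longrightarrow> smooth (partial_deriv j f)"
  using smooth_iter_deriv[of f "[j]"] by simp

text \<open>Reduces smoothness to exhibiting a family of differentiable functions that is stable
  under all partial derivatives, so that iterated derivatives need not be computed.\<close>

lemma smooth_coinduct:
  assumes "f \<in> S" and S: "\<And>f x. f \<in> S \<Longrightarrow> f differentiable (at x)" "\<And>f j. f \<in> S \<Longrightarrow> partial_deriv j f \<in> S"
  shows "smooth f"
proof -
  have "iter_deriv js f \<in> S" for js
    by (induction js) (use assms in auto)
  then show ?thesis using S(1) by (simp add: smooth_def)
qed

inductive_set generated_algebra :: "(real ^ 'n::finite \<Rightarrow> complex) set \<Rightarrow> (real ^ 'n::finite \<Rightarrow> complex) set" for G where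
  base: "g \<in> G \<Longrightarrow> g \<in> generated_algebra G"
| add: "f \<in> generated_algebra G \<Longrightarrow> g \<in> generated_algebra G \<Longrightarrow> (\<lambda>x. f x + g x) \<in> generated_algebra G"
| mult: "f \<in> generated_algebra G \<Longrightarrow> g \<in> generated_algebra G \<Longrightarrow> (\<lambda>x. f x * g x) \<in> generated_algebra G"

text \<open>By the Leibniz rule the whole algebra is stable under differentiation once the
  derivatives of the generators lie in it.\<close>

lemma smooth_generated_algebra:
  assumes G: "\<And>g x. g \<in> G \<Longrightarrow> g differentiable (at x)" "\<And>g j. g \<in> G \<Longrightarrow> partial_deriv j g \<in> generated_algebra G"
    and f: "f \<in> generated_algebra G"
  shows "smooth f"
proof (rule smooth_coinduct[OF f])
  have *: "(\<forall>x. f differentiable (at x)) \<and> (\<forall>j. partial_deriv j f \<in> generated_algebra G)"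
    if "f \<in> generated_algebra G" for f
    using that
  proof induction
    case (base g)
    then show ?case using G by blast
  next
    case (add f g)
    then show ?case
      by (auto intro: generated_algebra.intros simp: partial_deriv_add)
  next
    case (mult f g)
    then have "f \<in> generated_algebra G" "g \<in> generated_algebra G"
      "\<And>j. partial_deriv j f \<in> generated_algebra G" "\<And>j. partial_deriv j g \<in> generated_algebra G"
      by blast+
    then have "(\<lambda>x. f x * partial_deriv j g x + partial_deriv j f x * g x) \<in> generated_algebra G" for j
      by (intro generated_algebra.add generated_algebra.mult)
    then show ?case using mult by (auto intro: differentiable_mult simp: partial_deriv_mult)
  qed
  show "f differentiable (at x)" if "f \<in> generated_algebra G" for f x using *[OF that] by blast
  show "partial_deriv j f \<in> generated_algebra G" if "f \<in> generated_algebra G" for f j using *[OF that] by blast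
qed

lemma smooth_const [simp]: "smooth (\<lambda>_. c)"
  by (rule smooth_coinduct[of _ "range (\<lambda>c x. c)"]) (auto simp: partial_deriv_const)

text \<open>Taking all smooth functions as generators gives closure under sums and under products at
  one stroke.\<close>

lemma generated_algebra_smooth: "f \<in> generated_algebra (Collect smooth) \<Longrightarrow> smooth f"
  by (rule smooth_generated_algebra) (auto intro: generated_algebra.base smooth_differentiable smooth_partial_deriv)

lemma smooth_add: "smooth f \<Longrightarrow> smooth g \<Longrightarrow> smooth (\<lambda>x. f x + g x)"
  by (rule generated_algebra_smooth) (auto intro: generated_algebra.intros)

lemma smooth_mult: "smooth f \<Longrightarrow> smooth g \<Longrightarrow> smooth (\<lambda>x. f x * g x)"
  by (rule generated_algebra_smooth) (auto intro: generated_algebra.intros)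

lemma smooth_cmult: "smooth f \<Longrightarrow> smooth (\<lambda>x. c * f x)"
  by (rule smooth_mult) simp_all

lemma smooth_minus: "smooth f \<Longrightarrow> smooth (\<lambda>x. - f x)"
  using smooth_cmult[of f "-1"] by simp

lemma smooth_diff: "smooth f \<Longrightarrow> smooth g \<Longrightarrow> smooth (\<lambda>x. f x - g x)"
  using smooth_add[of f "\<lambda>x. - g x"] smooth_minus[of g] by simp

lemma smooth_sum: "(\<And>i. i \<in> I \<Longrightarrow> smooth (f i)) \<Longrightarrow> smooth (\<lambda>x. \<Sum>i\<in>I. f i x)"
  by (induction I rule: infinite_finite_induct) (auto intro: smooth_add)

lemma smooth_prod: "(\<And>i. i \<in> I \<Longrightarrow> smooth (f i)) \<Longrightarrow> smooth (\<lambda>x. \<Prod>i\<in>I. f i x)"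
  by (induction I rule: infinite_finite_induct) (auto intro: smooth_mult)

lemma smooth_power: "smooth f \<Longrightarrow> smooth (\<lambda>x. f x ^ k)"
  by (induction k) (auto intro: smooth_mult)

lemma smooth_cnj: "smooth f \<Longrightarrow> smooth (\<lambda>x. cnj (f x))"
proof (rule smooth_coinduct[of _ "(\<lambda>f x. cnj (f x)) ` Collect smooth"])
  show "g differentiable (at x)" if "g \<in> (\<lambda>f x. cnj (f x)) ` Collect smooth" for g x
  proof -
    obtain f where f: "g = (\<lambda>x. cnj (f x))" "smooth f" using \<open>g \<in> _\<close> by blast
    then obtain f' where "(f has_derivative f') (at x)"
      using smooth_differentiable unfolding differentiable_def by blast
    then show ?thesis unfolding f differentiable_def by (blast intro: has_derivative_cnj)
  qed
  show "partial_deriv j g \<in> (\<lambda>f x. cnj (f x)) ` Collect smooth"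
    if "g \<in> (\<lambda>f x. cnj (f x)) ` Collect smooth" for g j
    using that by (auto simp: partial_deriv_cnj smooth_differentiable smooth_partial_deriv)
qed auto

lemma has_derivative_coord:
  "((\<lambda>x::real ^ 'n::finite. complex_of_real (x $ j)) has_derivative (\<lambda>h. complex_of_real (h $ j))) (at x)"
  by (rule has_derivative_of_real) (rule bounded_linear_imp_has_derivative, rule bounded_linear_vec_nth)

lemma partial_deriv_coord:
  "partial_deriv i (\<lambda>x :: real ^ 'n::finite. complex_of_real (x $ j)) = (\<lambda>_. if i = j then 1 else 0)"
proof
  show "partial_deriv i (\<lambda>x. complex_of_real (x $ j)) x = (if i = j then 1 else 0)" for x :: "real ^ 'n"
    by (subst has_derivative_partial_deriv[OF has_derivative_coord]) (simp add: axis_def)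
qed

lemma smooth_coord: "smooth (\<lambda>x. complex_of_real (x $ j))"
proof (rule smooth_generated_algebra[of "insert (\<lambda>x. complex_of_real (x $ j)) (range (\<lambda>c x. c))"])
  let ?G = "insert (\<lambda>x. complex_of_real (x $ j)) (range (\<lambda>c x. c))"
  show "g differentiable (at x)" if "g \<in> ?G" for g x
    using that has_derivative_coord by (auto simp: differentiable_def intro: has_derivative_const)
  show "partial_deriv i g \<in> generated_algebra ?G" if "g \<in> ?G" for g i
    using that by (auto simp: partial_deriv_const partial_deriv_coord intro!: generated_algebra.base)
qed (auto intro: generated_algebra.base)

section \<open>Characters and other explicit smooth functions\<close>

definition exp_char :: "real ^ 'n::finite \<Rightarrow> real ^ 'n::finite \<Rightarrow> complex" where
  "exp_char \<theta> x = exp (\<i> * complex_of_real (\<theta> \<bullet> x))"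

lemma exp_char_add: "exp_char (\<theta> + \<eta>) x = exp_char \<theta> x * exp_char \<eta> x"
  by (simp add: exp_char_def inner_add_left distrib_left exp_add)

lemma exp_char_zero [simp]: "exp_char 0 x = 1"
  by (simp add: exp_char_def)

lemma cnj_exp_char: "cnj (exp_char \<theta> x) = exp_char (- \<theta>) x"
  by (simp add: exp_char_def exp_cnj)

lemma has_derivative_exp_char:
  "(exp_char \<theta> has_derivative (\<lambda>h. \<i> * complex_of_real (\<theta> \<bullet> h) * exp_char \<theta> x)) (at x)"
proof -
  have "((\<lambda>x. \<i> * complex_of_real (\<theta> \<bullet> x)) has_derivative (\<lambda>h. \<i> * complex_of_real (\<theta> \<bullet> h))) (at x)"
    by (auto intro!: derivative_eq_intros)
  moreover have "(exp has_derivative (\<lambda>h. h * exp_char \<theta> x)) (at (\<i> * complex_of_real (\<theta> \<bullet> x)))"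
    unfolding exp_char_def
    by (rule has_derivative_eq_rhs[OF DERIV_exp[unfolded has_field_derivative_def]]) (auto simp: fun_eq_iff)
  ultimately show ?thesis
    unfolding exp_char_def[abs_def] by (rule has_derivative_compose)
qed

lemma partial_deriv_exp_char:
  "partial_deriv j (exp_char \<theta>) = (\<lambda>x. \<i> * complex_of_real (\<theta> $ j) * exp_char \<theta> x)"
proof
  show "partial_deriv j (exp_char \<theta>) x = \<i> * complex_of_real (\<theta> $ j) * exp_char \<theta> x" for x
    by (subst has_derivative_partial_deriv[OF has_derivative_exp_char]) (simp add: inner_axis)
qed

lemma smooth_exp_char [simp]: "smooth (exp_char \<theta>)"
proof (rule smooth_generated_algebra[of "insert (exp_char \<theta>) (range (\<lambda>c x. c))"])
  let ?G = "insert (exp_char \<theta>) (range (\<lambda>c x. c))"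
  show "g differentiable (at x)" if "g \<in> ?G" for g x
    using that has_derivative_exp_char by (auto simp: differentiable_def intro: has_derivative_const)
  show "partial_deriv i g \<in> generated_algebra ?G" if "g \<in> ?G" for g i
  proof -
    have "(\<lambda>_. c) \<in> generated_algebra ?G" "exp_char \<theta> \<in> generated_algebra ?G" for c
      by (auto intro!: generated_algebra.base)
    then have "partial_deriv i (exp_char \<theta>) \<in> generated_algebra ?G"
      unfolding partial_deriv_exp_char by (intro generated_algebra.mult)
    moreover have "partial_deriv i (\<lambda>_. c) \<in> generated_algebra ?G" for c
      unfolding partial_deriv_const by (auto intro!: generated_algebra.base)
    ultimately show ?thesis using that by blast
  qed
qed (auto intro: generated_algebra.base)

text \<open>With s = sqrt p and r = 1 / s one has s' = p' r / 2 and r' = - p' r^3 / 2, so s and r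
  together with the smooth functions generate an algebra that is stable under
  differentiation.\<close>

lemma smooth_sqrt:
  assumes "smooth f" and f: "\<And>x. f x = complex_of_real (p x)" and pos: "\<And>x. p x > 0"
  shows "smooth (\<lambda>x. complex_of_real (sqrt (p x)))"
proof -
  let ?s = "\<lambda>x. complex_of_real (sqrt (p x))" and ?r = "\<lambda>x. complex_of_real (inverse (sqrt (p x)))"
  let ?G = "insert ?s (insert ?r (Collect smooth))"
  have p: "p = (\<lambda>x. Re (f x))" using f by simp
  have f_eq: "f = (\<lambda>x. complex_of_real (p x))" using f by blast
  obtain f' where f': "\<And>x. (f has_derivative f' x) (at x)"
    using smooth_differentiable[OF \<open>smooth f\<close>] unfolding differentiable_def by metis
  have dp: "(p has_derivative (\<lambda>h. Re (f' x h))) (at x)" for x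
    unfolding p by (rule has_derivative_Re[OF f'])
  \<comment> \<open>Since f is real-valued its derivative is real, and the embedded derivative of p
    is the derivative of f.\<close>
  have Re_f': "complex_of_real (Re (f' x h)) = f' x h" for x h
  proof -
    have "(f has_derivative (\<lambda>h. complex_of_real (Re (f' x h)))) (at x)"
      unfolding f_eq by (rule has_derivative_of_real[OF dp])
    then show ?thesis using has_derivative_unique[OF f'[of x]] by metis
  qed
  have ds: "(?s has_derivative (\<lambda>h. complex_of_real (Re (f' x h) * (inverse (sqrt (p x)) / 2)))) (at x)" for x
    using pos[of x] by (auto intro!: derivative_eq_intros dp)
  have dr: "(?r has_derivative (\<lambda>h. complex_of_real (Re (f' x h) * (- 1 / 2 * inverse (sqrt (p x)) ^ 3)))) (at x)" for x
  proof -
    have "((\<lambda>x. inverse (sqrt (p x))) has_derivative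
        (\<lambda>h. - (inverse (sqrt (p x)) * (Re (f' x h) * (inverse (sqrt (p x)) / 2)) * inverse (sqrt (p x))))) (at x)"
      using pos[of x] by (auto intro!: derivative_eq_intros dp)
    moreover have "- (inverse (sqrt (p x)) * (Re (f' x h) * (inverse (sqrt (p x)) / 2)) * inverse (sqrt (p x))) =
        Re (f' x h) * (- 1 / 2 * inverse (sqrt (p x)) ^ 3)" for h
      by (simp add: power3_eq_cube)
    ultimately show ?thesis by (intro has_derivative_of_real) (simp only:)
  qed
  have s': "partial_deriv j ?s = (\<lambda>x. partial_deriv j f x * ((1/2) * ?r x))" for j
  proof
    show "partial_deriv j ?s x = partial_deriv j f x * ((1/2) * ?r x)" for x
      unfolding has_derivative_partial_deriv[OF ds] has_derivative_partial_deriv[OF f']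
      by (simp add: Re_f')
  qed
  have r': "partial_deriv j ?r = (\<lambda>x. partial_deriv j f x * ((-1/2) * (?r x * (?r x * ?r x))))" for j
  proof
    show "partial_deriv j ?r x = partial_deriv j f x * ((-1/2) * (?r x * (?r x * ?r x)))" for x
      unfolding has_derivative_partial_deriv[OF dr] has_derivative_partial_deriv[OF f']
      by (simp add: Re_f' power3_eq_cube)
  qed
  note alg = generated_algebra.intros
  have r: "?r \<in> generated_algebra ?G" and c: "(\<lambda>_. c) \<in> generated_algebra ?G"
    and f'_alg: "partial_deriv j f \<in> generated_algebra ?G" for c j
    using smooth_partial_deriv[OF \<open>smooth f\<close>] by (auto intro!: alg(1))
  show ?thesis
  proof (rule smooth_generated_algebra[of ?G])
    show "g differentiable (at x)" if "g \<in> ?G" for g x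
      using that ds dr smooth_differentiable by (auto simp: differentiable_def)
    have "partial_deriv j ?s \<in> generated_algebra ?G" "partial_deriv j ?r \<in> generated_algebra ?G" for j
      unfolding s' r' by (intro alg(3) r c f'_alg)+
    moreover have "partial_deriv j g \<in> generated_algebra ?G" if "smooth g" for g j
      using smooth_partial_deriv[OF that] by (intro alg(1)) simp
    ultimately show "partial_deriv j g \<in> generated_algebra ?G" if "g \<in> ?G" for g j
      using that by blast
  qed (auto intro: alg)
qed

lemma iter_deriv_add:
  assumes "smooth f" "smooth g"
  shows "iter_deriv js (\<lambda>x. f x + g x) = (\<lambda>x. iter_deriv js f x + iter_deriv js g x)"
  by (induction js) (simp_all add: partial_deriv_add smooth_differentiable smooth_iter_deriv assms)

lemma iter_deriv_zero: "iter_deriv js (\<lambda>_. 0) = (\<lambda>_. 0)"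
  by (induction js) (simp_all add: partial_deriv_const)

lemma iter_deriv_cmult:
  assumes "smooth f"
  shows "iter_deriv js (\<lambda>x. c * f x) = (\<lambda>x. c * iter_deriv js f x)"
  by (induction js)
     (simp_all add: partial_deriv_mult partial_deriv_const smooth_differentiable smooth_iter_deriv assms)

lemma iter_deriv_diff:
  assumes "smooth f" "smooth g"
  shows "iter_deriv js (\<lambda>x. f x - g x) = (\<lambda>x. iter_deriv js f x - iter_deriv js g x)"
  using iter_deriv_add[OF assms(1) smooth_cmult[OF assms(2), of "-1"], of js] iter_deriv_cmult[OF assms(2), of js "-1"]
  by simp

lemma iter_deriv_sum:
  assumes "\<And>i. i \<in> I \<Longrightarrow> smooth (f i)"
  shows "iter_deriv js (\<lambda>x. \<Sum>i\<in>I. f i x) = (\<lambda>x. \<Sum>i\<in>I. iter_deriv js (f i) x)"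
  using assms
  by (induction I rule: infinite_finite_induct) (simp_all add: iter_deriv_zero iter_deriv_add smooth_sum)

lemma iter_deriv_cnj:
  assumes "smooth f"
  shows "iter_deriv js (\<lambda>x. cnj (f x)) = (\<lambda>x. cnj (iter_deriv js f x))"
  by (induction js) (simp_all add: partial_deriv_cnj smooth_differentiable smooth_iter_deriv assms)

lemma iter_deriv_exp_char:
  "iter_deriv js (exp_char \<theta>) = (\<lambda>x. (\<Prod>j\<leftarrow>js. \<i> * complex_of_real (\<theta> $ j)) * exp_char \<theta> x)"
  by (induction js)
     (simp_all add: partial_deriv_mult partial_deriv_const partial_deriv_exp_char smooth_differentiable mult_ac)

section \<open>Symmetry of mixed derivatives\<close>

text \<open>Symmetry of second derivatives by Schwarz: the mixed second difference over the square
  [0, h]^2 equals h^2 F12 at one point and h^2 F21 at another, by two mean value theorems taken in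
  either order; continuity at the origin does the rest. The values are real because the mean value
  theorem as an equality fails for complex ones.\<close>

lemma mixed_derivatives_eq:
  fixes F F1 F2 F12 F21 :: "real \<Rightarrow> real \<Rightarrow> real"
  assumes F1: "\<And>s t. ((\<lambda>s. F s t) has_real_derivative F1 s t) (at s)"
    and F2: "\<And>s t. ((\<lambda>t. F s t) has_real_derivative F2 s t) (at t)"
    and F12: "\<And>s t. ((\<lambda>t. F1 s t) has_real_derivative F12 s t) (at t)"
    and F21: "\<And>s t. ((\<lambda>s. F2 s t) has_real_derivative F21 s t) (at s)"
    and c12: "\<And>\<epsilon>. \<epsilon> > 0 \<Longrightarrow> \<exists>\<delta>>0. \<forall>s t. \<bar>s\<bar> < \<delta> \<and> \<bar>t\<bar> < \<delta> \<longrightarrow> \<bar>F12 s t - F12 0 0\<bar> < \<epsilon>"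
    and c21: "\<And>\<epsilon>. \<epsilon> > 0 \<Longrightarrow> \<exists>\<delta>>0. \<forall>s t. \<bar>s\<bar> < \<delta> \<and> \<bar>t\<bar> < \<delta> \<longrightarrow> \<bar>F21 s t - F21 0 0\<bar> < \<epsilon>"
  shows "F12 0 0 = F21 0 0"
proof -
  have "\<bar>F12 0 0 - F21 0 0\<bar> \<le> 0 + \<epsilon>" if "\<epsilon> > 0" for \<epsilon>
  proof -
    obtain \<delta>1 where \<delta>1: "\<delta>1 > 0" "\<And>s t. \<bar>s\<bar> < \<delta>1 \<Longrightarrow> \<bar>t\<bar> < \<delta>1 \<Longrightarrow> \<bar>F12 s t - F12 0 0\<bar> < \<epsilon> / 2"
      using c12[of "\<epsilon> / 2"] \<open>\<epsilon> > 0\<close> by auto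
    obtain \<delta>2 where \<delta>2: "\<delta>2 > 0" "\<And>s t. \<bar>s\<bar> < \<delta>2 \<Longrightarrow> \<bar>t\<bar> < \<delta>2 \<Longrightarrow> \<bar>F21 s t - F21 0 0\<bar> < \<epsilon> / 2"
      using c21[of "\<epsilon> / 2"] \<open>\<epsilon> > 0\<close> by auto
    define h where "h = min \<delta>1 \<delta>2 / 2"
    have h: "h > 0" "h < \<delta>1" "h < \<delta>2" using \<delta>1 \<delta>2 by (auto simp: h_def min_def)
    let ?D = "F h h - F h 0 - F 0 h + F 0 0"
    have "\<exists>s>0. s < h \<and> (F h h - F h 0) - (F 0 h - F 0 0) = (h - 0) * (F1 s h - F1 s 0)"
      by (rule MVT2[OF \<open>h > 0\<close>]) (intro DERIV_diff F1)
    then obtain s where s: "0 < s" "s < h" "?D = h * (F1 s h - F1 s 0)" by auto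
    obtain t where t: "0 < t" "t < h" "F1 s h - F1 s 0 = (h - 0) * F12 s t"
      using MVT2[OF \<open>h > 0\<close>, of "F1 s" "F12 s"] F12 by auto
    have "\<exists>t>0. t < h \<and> (F h h - F 0 h) - (F h 0 - F 0 0) = (h - 0) * (F2 h t - F2 0 t)"
      by (rule MVT2[OF \<open>h > 0\<close>]) (intro DERIV_diff F2)
    then obtain t' where t': "0 < t'" "t' < h" "?D = h * (F2 h t' - F2 0 t')" by auto
    obtain s' where s': "0 < s'" "s' < h" "F2 h t' - F2 0 t' = (h - 0) * F21 s' t'"
      using MVT2[OF \<open>h > 0\<close>, of "\<lambda>s. F2 s t'" "\<lambda>s. F21 s t'"] F21 by auto
    have "F12 s t = F21 s' t'" using s(3) t(3) t'(3) s'(3) h(1) by simp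
    moreover have "\<bar>F12 s t - F12 0 0\<bar> < \<epsilon> / 2" using s t h by (intro \<delta>1) auto
    moreover have "\<bar>F21 s' t' - F21 0 0\<bar> < \<epsilon> / 2" using s' t' h by (intro \<delta>2) auto
    ultimately show ?thesis by linarith
  qed
  then have "\<bar>F12 0 0 - F21 0 0\<bar> \<le> 0" by (rule field_le_epsilon)
  then show ?thesis by simp
qed

text \<open>Real and imaginary parts are treated separately, along the two-parameter family x + s
  e_i + t e_j.\<close>

lemma partial_deriv_commute:
  assumes "smooth f"
  shows "partial_deriv i (partial_deriv j f) = partial_deriv j (partial_deriv i f)"
proof
  fix x :: "real ^ 'a"
  let ?p = "\<lambda>s t. x + s *\<^sub>R axis i 1 + t *\<^sub>R axis j (1 :: real)"
  have D1: "((\<lambda>s. g (?p s t)) has_vector_derivative partial_deriv i g (?p s t)) (at s)"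
    and D2: "((\<lambda>t. g (?p s t)) has_vector_derivative partial_deriv j g (?p s t)) (at t)" if "smooth g" for g s t
    using has_vector_derivative_partial_deriv[of g "x + t *\<^sub>R axis j 1" s i]
      has_vector_derivative_partial_deriv[of g "x + s *\<^sub>R axis i 1" t j]
      smooth_differentiable[OF that] by (simp_all add: add_ac)
  note sm = assms smooth_partial_deriv[OF assms]
  have cont: "\<exists>\<delta>>0. \<forall>s t. \<bar>s\<bar> < \<delta> \<and> \<bar>t\<bar> < \<delta> \<longrightarrow> \<bar>T (g (?p s t)) - T (g (?p 0 0))\<bar> < \<epsilon>"
    if g: "smooth g" "\<epsilon> > 0" "T = Re \<or> T = Im" for g \<epsilon> and T :: "complex \<Rightarrow> real"
  proof -
    obtain d where d: "d > 0" "\<And>y. dist y x < d \<Longrightarrow> dist (g y) (g x) < \<epsilon>"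
      using smooth_continuous[OF g(1), of UNIV] g(2) unfolding continuous_on_iff by (metis UNIV_I)
    show ?thesis
    proof (intro exI[of _ "d / 2"] conjI allI impI)
      fix s t assume "\<bar>s\<bar> < d / 2 \<and> \<bar>t\<bar> < d / 2"
      then have "dist (?p s t) x < d"
        using norm_triangle_ineq[of "s *\<^sub>R axis i 1" "t *\<^sub>R axis j (1::real)"] by (simp add: dist_norm add.assoc)
      then have "cmod (g (?p s t) - g x) < \<epsilon>" using d(2) by (simp add: dist_norm)
      then show "\<bar>T (g (?p s t)) - T (g (?p 0 0))\<bar> < \<epsilon>"
        using g(3) abs_Re_le_cmod[of "g (?p s t) - g x"] abs_Im_le_cmod[of "g (?p s t) - g x"] by auto
    qed (use d in simp)
  qed
  have "T (partial_deriv j (partial_deriv i f) (?p 0 0)) = T (partial_deriv i (partial_deriv j f) (?p 0 0))"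
    if T: "T = Re \<or> T = Im" for T :: "complex \<Rightarrow> real"
  proof (rule mixed_derivatives_eq[where F = "\<lambda>s t. T (f (?p s t))"
        and ?F1.0 = "\<lambda>s t. T (partial_deriv i f (?p s t))" and ?F2.0 = "\<lambda>s t. T (partial_deriv j f (?p s t))"
        and ?F12.0 = "\<lambda>s t. T (partial_deriv j (partial_deriv i f) (?p s t))"
        and ?F21.0 = "\<lambda>s t. T (partial_deriv i (partial_deriv j f) (?p s t))"])
    have bl: "bounded_linear T" using T bounded_linear_Re bounded_linear_Im by blast
    note bl' = bounded_linear.has_vector_derivative[OF bl]
    show "((\<lambda>s. T (f (?p s t))) has_real_derivative T (partial_deriv i f (?p s t))) (at s)"
      "((\<lambda>t. T (f (?p s t))) has_real_derivative T (partial_deriv j f (?p s t))) (at t)"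
      "((\<lambda>t. T (partial_deriv i f (?p s t))) has_real_derivative T (partial_deriv j (partial_deriv i f) (?p s t))) (at t)"
      "((\<lambda>s. T (partial_deriv j f (?p s t))) has_real_derivative T (partial_deriv i (partial_deriv j f) (?p s t))) (at s)"
      for s t
      unfolding has_real_derivative_iff_has_vector_derivative
      by (intro bl' D1 D2 sm)+
  qed (intro cont smooth_partial_deriv assms T; assumption)+
  from this[of Re] this[of Im] show "partial_deriv i (partial_deriv j f) x = partial_deriv j (partial_deriv i f) x"
    by (simp add: complex_eq_iff)
qed

lemma iter_deriv_remove1:
  assumes "smooth f" "j \<in> set js"
  shows "iter_deriv js f = partial_deriv j (iter_deriv (remove1 j js) f)"
  using assms(2)
proof (induction js)
  case (Cons i js)
  show ?case
  proof (cases "i = j")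
    case False
    then have "iter_deriv (i # js) f = partial_deriv i (partial_deriv j (iter_deriv (remove1 j js) f))"
      using Cons by simp
    also have "\<dots> = partial_deriv j (partial_deriv i (iter_deriv (remove1 j js) f))"
      by (rule partial_deriv_commute[OF smooth_iter_deriv[OF assms(1)]])
    finally show ?thesis using False by simp
  qed simp
qed simp

lemma iter_deriv_perm:
  assumes "smooth f" "mset js = mset ks"
  shows "iter_deriv js f = iter_deriv ks f"
  using assms(2)
proof (induction ks arbitrary: js)
  case (Cons k ks)
  then have "k \<in> set js" by (metis list.set_intros(1) mset_eq_setD)
  moreover have "mset (remove1 k js) = mset ks" using Cons by simp
  ultimately show ?case using iter_deriv_remove1[OF assms(1), of k js] Cons.IH[of "remove1 k js"] by simp
qed simp

section \<open>Seminorms\<close>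

abbreviation multi_list :: "('n::{finite,linorder} \<Rightarrow> nat) \<Rightarrow> 'n list" where
  "multi_list \<alpha> \<equiv> concat (map (\<lambda>j. replicate (\<alpha> j) j) (sorted_list_of_set UNIV))"

lemma multi_deriv_eq_iter_deriv: "multi_deriv \<alpha> f = iter_deriv (multi_list \<alpha>) f"
proof -
  have rep: "foldr partial_deriv (replicate k j) g = (partial_deriv j ^^ k) g" for k j g
    by (induction k) simp_all
  have "foldr (\<lambda>j. partial_deriv j ^^ \<alpha> j) js f = iter_deriv (concat (map (\<lambda>j. replicate (\<alpha> j) j) js)) f" for js
    by (induction js) (simp_all add: rep)
  then show ?thesis by (simp add: multi_deriv_def)
qed

lemma count_multi_list: "count (mset (multi_list \<alpha>)) j = \<alpha> j"
proof -
  have "count (mset (concat (map (\<lambda>j. replicate (\<alpha> j) j) js))) j = (if j \<in> set js then \<alpha> j else 0)"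
    if "distinct js" for js
    using that by (induction js) (auto simp: mset_concat)
  from this[of "sorted_list_of_set UNIV"] show ?thesis by simp
qed

lemma length_multi_list: "length (multi_list \<alpha>) = (\<Sum>j\<in>UNIV. \<alpha> j)"
  by (simp add: length_concat o_def sum_list_distinct_conv_sum_set)

text \<open>Derivatives commute, so a list matters only through its multiplicities. This connects
  the list-indexed derivatives of the estimates with the multi-indices of the seminorms.\<close>

lemma iter_deriv_eq_multi_deriv: "smooth f \<Longrightarrow> iter_deriv js f = multi_deriv (count (mset js)) f"
  unfolding multi_deriv_eq_iter_deriv
  by (rule iter_deriv_perm) (auto intro: multiset_eqI simp: count_multi_list)

lemma finite_multi_indices: "finite {\<alpha> :: 'n::finite \<Rightarrow> nat. (\<Sum>j\<in>UNIV. \<alpha> j) \<le> m}"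
proof (rule finite_subset)
  show "{\<alpha> :: 'n \<Rightarrow> nat. (\<Sum>j\<in>UNIV. \<alpha> j) \<le> m} \<subseteq> (UNIV \<rightarrow>\<^sub>E {..m})"
    by (auto simp: PiE_def extensional_def) (metis finite_class.finite_UNIV UNIV_I le_trans member_le_sum zero_le)
qed (simp add: finite_PiE)

text \<open>A bound in place of a supremum, over lists in place of multi-indices: no
  \<open>SUP\<close> has to be evaluated, and the Leibniz estimate becomes an induction on lists.
  For smooth functions on a non-empty compact set it is equivalent, up to a constant, to a bound on
  \<open>smooth_seminorm\<close>.\<close>

definition deriv_bound ::
  "(real ^ 'n::finite) set \<Rightarrow> nat \<Rightarrow> real \<Rightarrow> (real ^ 'n::finite \<Rightarrow> complex) \<Rightarrow> bool" where
  "deriv_bound K m a f \<longleftrightarrow> (\<forall>js x. length js \<le> m \<longrightarrow> x \<in> K \<longrightarrow> cmod (iter_deriv js f x) \<le> a)"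

lemma deriv_boundD: "deriv_bound K m a f \<Longrightarrow> length js \<le> m \<Longrightarrow> x \<in> K \<Longrightarrow> cmod (iter_deriv js f x) \<le> a"
  by (simp add: deriv_bound_def)

lemma deriv_bound_mono: "deriv_bound K m a f \<Longrightarrow> L \<subseteq> K \<Longrightarrow> k \<le> m \<Longrightarrow> a \<le> b \<Longrightarrow> deriv_bound L k b f"
  by (auto simp: deriv_bound_def) (meson order_trans subsetD)

lemma deriv_bound_partial_deriv:
  fixes f :: "real ^ 'n::finite \<Rightarrow> complex"
  shows "deriv_bound K (Suc m) a f \<Longrightarrow> deriv_bound K m a (partial_deriv j f)"
  unfolding deriv_bound_def
proof (intro allI impI)
  fix js :: "'n list" and x assume *: "\<forall>js x. length js \<le> Suc m \<longrightarrow> x \<in> K \<longrightarrow> cmod (iter_deriv js f x) \<le> a"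
    and "length js \<le> m" "x \<in> K"
  then show "cmod (iter_deriv js (partial_deriv j f) x) \<le> a"
    using *[rule_format, of "js @ [j]" x] by simp
qed

lemma deriv_bound_add:
  assumes "smooth f" "smooth g" "deriv_bound K m a f" "deriv_bound K m b g"
  shows "deriv_bound K m (a + b) (\<lambda>x. f x + g x)"
  unfolding deriv_bound_def iter_deriv_add[OF assms(1,2)]
  using assms(3,4)[THEN deriv_boundD] by (auto intro: norm_triangle_mono)

lemma deriv_bound_cmult:
  assumes "smooth f" "deriv_bound K m a f"
  shows "deriv_bound K m (cmod c * a) (\<lambda>x. c * f x)"
  unfolding deriv_bound_def iter_deriv_cmult[OF assms(1)]
  using assms(2)[THEN deriv_boundD] by (auto simp: norm_mult intro!: mult_left_mono)

lemma deriv_bound_diff: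
  assumes "smooth f" "smooth g" "deriv_bound K m a f" "deriv_bound K m b g"
  shows "deriv_bound K m (a + b) (\<lambda>x. f x - g x)"
  unfolding deriv_bound_def iter_deriv_diff[OF assms(1,2)]
  using assms(3,4)[THEN deriv_boundD] by (auto intro!: order_trans[OF norm_triangle_ineq4] add_mono)

text \<open>Each of the at most m differentiations splits a product into two, whence 2^m. The
  innermost derivative is peeled off, so that the induction hypothesis applies to the pairs f, g'
  and f', g.\<close>

lemma deriv_bound_mult:
  assumes "smooth f" "smooth g" "deriv_bound K m a f" "deriv_bound K m b g"
  shows "deriv_bound K m (2 ^ m * a * b) (\<lambda>x. f x * g x)"
proof -
  have "cmod (iter_deriv js (\<lambda>x. f x * g x) x) \<le> 2 ^ length js * a * b"
    if "length js \<le> m" "x \<in> K" for js x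
    using assms that
  proof (induction js arbitrary: f g m rule: rev_induct)
    case Nil
    have "cmod (f x) \<le> a" "cmod (g x) \<le> b"
      using deriv_boundD[of K m a f "[]" x] deriv_boundD[of K m b g "[]" x] Nil by auto
    then show ?case by (simp add: norm_mult mult_mono')
  next
    case (snoc j js)
    then obtain m' where m: "m = Suc m'" "length js \<le> m'" by (cases m) auto
    note sm = snoc.prems(1,2) snoc.prems(1,2)[THEN smooth_partial_deriv]
    have bd: "deriv_bound K m' a f" "deriv_bound K m' b g"
      using deriv_bound_mono[OF snoc.prems(3) subset_refl _ order_refl]
        deriv_bound_mono[OF snoc.prems(4) subset_refl _ order_refl] m by simp_all
    have bd': "deriv_bound K m' a (partial_deriv j f)" "deriv_bound K m' b (partial_deriv j g)"
      using deriv_bound_partial_deriv[OF snoc.prems(3)[unfolded m(1)]]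
        deriv_bound_partial_deriv[OF snoc.prems(4)[unfolded m(1)]] by simp_all
    have "iter_deriv (js @ [j]) (\<lambda>x. f x * g x) x =
        iter_deriv js (\<lambda>x. f x * partial_deriv j g x) x + iter_deriv js (\<lambda>x. partial_deriv j f x * g x) x"
      using sm by (simp add: partial_deriv_mult smooth_differentiable iter_deriv_add smooth_mult)
    also have "cmod \<dots> \<le> 2 ^ length js * a * b + 2 ^ length js * a * b"
      by (intro norm_triangle_mono snoc.IH[of _ _ m'] sm bd bd' m snoc.prems(6))
    finally show ?case by (simp add: mult_ac)
  qed
  moreover have "2 ^ length js * a * b \<le> 2 ^ m * a * b" if "length js \<le> m" "x \<in> K" for js :: "'a list" and x
  proof -
    have "0 \<le> a" "0 \<le> b"
      using that deriv_boundD[OF assms(3), of "[]" x] deriv_boundD[OF assms(4), of "[]" x]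
      by (auto intro: order_trans[OF norm_ge_zero])
    then show ?thesis using that by (intro mult_right_mono) auto
  qed
  ultimately show ?thesis unfolding deriv_bound_def by (meson order_trans)
qed

lemma deriv_bound_exists:
  assumes "smooth f" "compact K"
  obtains a where "a > 0" "deriv_bound K m a f"
proof -
  have "\<exists>a. \<forall>x\<in>K. cmod (iter_deriv js f x) \<le> a" for js
  proof -
    have "bounded (iter_deriv js f ` K)"
      by (intro compact_imp_bounded compact_continuous_image smooth_continuous smooth_iter_deriv assms)
    then show ?thesis unfolding bounded_iff by blast
  qed
  then obtain a where a: "\<And>js x. x \<in> K \<Longrightarrow> cmod (iter_deriv js f x) \<le> a js" by metis
  have fin: "finite {js :: 'a list. length js \<le> m}"
    using finite_lists_length_le[of "UNIV :: 'a set" m] by simp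
  show thesis
  proof (rule that[of "1 + (\<Sum>js | length js \<le> m. \<bar>a js\<bar>)"])
    show "deriv_bound K m (1 + (\<Sum>js | length js \<le> m. \<bar>a js\<bar>)) f"
      unfolding deriv_bound_def
    proof (intro allI impI)
      fix js :: "'a list" and x assume "length js \<le> m" "x \<in> K"
      then have "\<bar>a js\<bar> \<le> (\<Sum>js | length js \<le> m. \<bar>a js\<bar>)" by (intro member_le_sum fin) auto
      then show "cmod (iter_deriv js f x) \<le> 1 + (\<Sum>js | length js \<le> m. \<bar>a js\<bar>)"
        using a[OF \<open>x \<in> K\<close>, of js] by linarith
    qed
  qed (auto intro: add_pos_nonneg sum_nonneg)
qed

lemma smooth_seminorm_le:
  fixes K :: "(real ^ 'n::{finite,linorder}) set"
  assumes "K \<noteq> {}" "deriv_bound K m a f"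
  shows "smooth_seminorm K m f \<le> real (card {\<alpha> :: 'n \<Rightarrow> nat. (\<Sum>j\<in>UNIV. \<alpha> j) \<le> m}) * a"
  unfolding smooth_seminorm_def
proof (rule sum_bounded_above)
  fix \<alpha> :: "'n \<Rightarrow> nat" assume "\<alpha> \<in> {\<alpha>. (\<Sum>j\<in>UNIV. \<alpha> j) \<le> m}"
  then show "(SUP x\<in>K. norm (multi_deriv \<alpha> f x)) \<le> a"
    unfolding multi_deriv_eq_iter_deriv
    by (intro cSUP_least assms(1) deriv_boundD[OF assms(2)]) (auto simp: length_multi_list)
qed

lemma deriv_bound_smooth_seminorm:
  fixes K :: "(real ^ 'n::{finite,linorder}) set"
  assumes "smooth f" "compact K"
  shows "deriv_bound K m (smooth_seminorm K m f) f"
  unfolding deriv_bound_def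
proof (intro allI impI)
  fix js :: "'n list" and x assume js: "length js \<le> m" and x: "x \<in> K"
  let ?S = "\<lambda>\<alpha>. SUP x\<in>K. norm (multi_deriv \<alpha> f x)"
  have le: "norm (multi_deriv \<alpha> f x) \<le> ?S \<alpha>" for \<alpha>
  proof (rule cSUP_upper[OF x])
    have "compact ((\<lambda>x. norm (multi_deriv \<alpha> f x)) ` K)"
      unfolding multi_deriv_eq_iter_deriv
      by (intro compact_continuous_image continuous_on_norm smooth_continuous smooth_iter_deriv assms)
    then show "bdd_above ((\<lambda>x. norm (multi_deriv \<alpha> f x)) ` K)"
      by (intro bounded_imp_bdd_above compact_imp_bounded)
  qed
  have "(\<Sum>j\<in>UNIV. count (mset js) j) = length js"
    using sum_count_set[of js UNIV] by (simp add: count_mset)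
  then have mem: "count (mset js) \<in> {\<alpha>. (\<Sum>j\<in>UNIV. \<alpha> j) \<le> m}" using js by simp
  have "cmod (iter_deriv js f x) \<le> ?S (count (mset js))"
    unfolding iter_deriv_eq_multi_deriv[OF assms(1)] by (rule le)
  also have "\<dots> \<le> smooth_seminorm K m f"
    unfolding smooth_seminorm_def
    using mem by (intro member_le_sum finite_multi_indices) (auto intro: order_trans[OF norm_ge_zero le])
  finally show "cmod (iter_deriv js f x) \<le> smooth_seminorm K m f" .
qed

section \<open>Trigonometric sums\<close>

inductive_set trig_span :: "(real ^ 'n::finite \<Rightarrow> complex) set" where
  zero: "(\<lambda>_. 0) \<in> trig_span"
| step: "f \<in> trig_span \<Longrightarrow> (\<lambda>x. f x + c * exp_char \<theta> x) \<in> trig_span"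

lemma smooth_trig_span: "f \<in> trig_span \<Longrightarrow> smooth f"
  by (induction rule: trig_span.induct) (auto intro!: smooth_add smooth_cmult)

lemma trig_span_single: "(\<lambda>x. c * exp_char \<theta> x) \<in> trig_span"
  using trig_span.step[OF trig_span.zero] by simp

lemma trig_span_const: "(\<lambda>_. c) \<in> trig_span"
  using trig_span_single[of c 0] by simp

lemma trig_span_add:
  assumes "f \<in> trig_span" "g \<in> trig_span"
  shows "(\<lambda>x. f x + g x) \<in> trig_span"
  using assms(2,1)
proof (induction arbitrary: f rule: trig_span.induct)
  case (step g c \<theta>)
  then show ?case using trig_span.step[of "\<lambda>x. f x + g x" c \<theta>] by (simp add: add.assoc)
qed simp

lemma trig_span_mult_single: "f \<in> trig_span \<Longrightarrow> (\<lambda>x. f x * (c * exp_char \<theta> x)) \<in> trig_span"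
proof (induction rule: trig_span.induct)
  case (step f d \<eta>)
  then show ?case
    using trig_span.step[of "\<lambda>x. f x * (c * exp_char \<theta> x)" "d * c" "\<eta> + \<theta>"]
    by (simp add: algebra_simps exp_char_add)
qed (simp add: trig_span.zero)

lemma trig_span_mult:
  assumes "f \<in> trig_span" "g \<in> trig_span"
  shows "(\<lambda>x. f x * g x) \<in> trig_span"
  using assms(2,1)
proof (induction arbitrary: f rule: trig_span.induct)
  case (step g c \<theta>)
  then show ?case
    using trig_span_add[OF step.IH[OF step.prems] trig_span_mult_single[OF step.prems, of c \<theta>]]
    by (simp add: distrib_left)
qed (simp add: trig_span.zero)

lemma trig_span_repr:
  assumes "f \<in> trig_span"
  shows "\<exists>(n :: nat) c \<theta>. f = (\<lambda>x. \<Sum>a<n. c a * exp_char (\<theta> a) x)"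
  using assms
proof (induction rule: trig_span.induct)
  case zero
  show ?case by (rule exI[of _ 0]) simp
next
  case (step f d \<eta>)
  then obtain n :: nat and c \<theta> where f: "f = (\<lambda>x. \<Sum>a<n. c a * exp_char (\<theta> a) x)" by blast
  show ?case
    by (rule exI[of _ "Suc n"], rule exI[of _ "c(n := d)"], rule exI[of _ "\<theta>(n := \<eta>)"]) (simp add: f)
qed

lemma has_derivative_linear_char:
  "((\<lambda>x. \<i> * complex_of_real (h \<bullet> x)) has_derivative (\<lambda>y. \<i> * complex_of_real (h \<bullet> y))) (at x)"
  by (auto intro!: derivative_eq_intros)

lemma partial_deriv_linear_char:
  "partial_deriv j (\<lambda>x. \<i> * complex_of_real (h \<bullet> x)) = (\<lambda>_. \<i> * complex_of_real (h $ j))"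
proof
  show "partial_deriv j (\<lambda>x. \<i> * complex_of_real (h \<bullet> x)) x = \<i> * complex_of_real (h $ j)" for x
    by (subst has_derivative_partial_deriv[OF has_derivative_linear_char]) (simp add: inner_axis)
qed

lemma smooth_linear_char: "smooth (\<lambda>x. \<i> * complex_of_real (h \<bullet> x))"
  by (rule smooth_coinduct[of _ "insert (\<lambda>x. \<i> * complex_of_real (h \<bullet> x)) (range (\<lambda>c x. c))"])
     (use has_derivative_linear_char has_derivative_const in
       \<open>auto simp: partial_deriv_linear_char partial_deriv_const differentiable_def, blast+\<close>)

lemma cmod_exp_i_minus_1: "cmod (exp (\<i> * complex_of_real u) - 1) \<le> \<bar>u\<bar>"
  using Taylor_exp[of "\<i> * complex_of_real u" 0] by (simp add: norm_mult)

lemma cmod_exp_i_minus_linear: "cmod (exp (\<i> * complex_of_real u) - 1 - \<i> * complex_of_real u) \<le> u\<^sup>2"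
  using Taylor_exp[of "\<i> * complex_of_real u" 1] by (simp add: norm_mult power2_eq_square diff_diff_eq)

text \<open>The remainder is quadratic in h together with all its derivatives: at order 0 by Taylor,
  at order 1 because the derivative is i h_j (exp(i h.x) - 1), and from order 2 on because the
  linear part is gone and at least two factors h_j appear, any further ones being at most 1. The
  constant 1 + B + B^2 covers the three cases.\<close>

lemma exp_char_second_order:
  fixes K :: "(real ^ 'n::finite) set"
  assumes "compact K"
  obtains C where "C > 0" "\<And>h. norm h \<le> 1 \<Longrightarrow>
    deriv_bound K m (C * (norm h)\<^sup>2) (\<lambda>x. exp_char h x - (1 + \<i> * complex_of_real (h \<bullet> x)))"
proof -
  obtain B where B: "B > 0" "\<And>x. x \<in> K \<Longrightarrow> norm x \<le> B"
    using compact_imp_bounded[OF assms] by (auto simp: bounded_pos)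
  have "cmod (iter_deriv js (\<lambda>x. exp_char h x - (1 + \<i> * complex_of_real (h \<bullet> x))) x) \<le> (1 + B + B\<^sup>2) * (norm h)\<^sup>2"
    if h: "norm h \<le> 1" and x: "x \<in> K" for js and h x :: "real ^ 'n"
  proof -
    let ?L = "\<lambda>x. \<i> * complex_of_real (h \<bullet> x)"
    have hx: "\<bar>h \<bullet> x\<bar> \<le> norm h * B"
      using Cauchy_Schwarz_ineq2[of h x] B(2)[OF x] by (meson mult_left_mono norm_ge_zero order_trans)
    have le: "a \<le> (1 + B + B\<^sup>2) * (norm h)\<^sup>2" if "a \<le> b * (norm h)\<^sup>2" "b \<le> 1 + B + B\<^sup>2" for a b
      using that by (meson mult_right_mono order_trans zero_le_power2)
    have eq: "iter_deriv js (\<lambda>x. exp_char h x - (1 + ?L x)) x =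
        iter_deriv js (exp_char h) x - (iter_deriv js (\<lambda>_. 1) x + iter_deriv js ?L x)"
      by (simp add: iter_deriv_diff iter_deriv_add smooth_linear_char smooth_add)
    have prod: "cmod (\<Prod>j\<leftarrow>js. \<i> * complex_of_real (h $ j)) \<le> norm h ^ length js" for js :: "'n list"
      by (induction js) (auto simp: norm_mult intro!: mult_mono component_le_norm_cart)
    show ?thesis
    proof (cases js rule: rev_cases)
      case Nil
      have "cmod (exp_char h x - 1 - ?L x) \<le> (norm h * B)\<^sup>2"
        using cmod_exp_i_minus_linear[of "h \<bullet> x"] power_mono[OF hx, of 2]
        by (simp add: exp_char_def)
      then show ?thesis using B by (intro le[of _ "B\<^sup>2"]) (simp_all add: Nil power_mult_distrib mult.commute diff_diff_eq)
    next
      case (snoc ks j)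
      show ?thesis
      proof (cases "ks = []")
        case True
        have "iter_deriv js (\<lambda>x. exp_char h x - (1 + ?L x)) x = \<i> * complex_of_real (h $ j) * (exp_char h x - 1)"
          unfolding eq by (simp add: snoc True partial_deriv_exp_char partial_deriv_const partial_deriv_linear_char algebra_simps)
        also have "cmod \<dots> \<le> norm h * (norm h * B)"
          using cmod_exp_i_minus_1[of "h \<bullet> x"] hx component_le_norm_cart[of h j]
          by (auto simp: norm_mult exp_char_def intro!: mult_mono)
        finally show ?thesis using B by (intro le[of _ B]) (simp_all add: power2_eq_square mult_ac)
      next
        case False
        have c0: "iter_deriv ks (\<lambda>_. c) = (\<lambda>_. 0)" for c
          using False by (induction ks) (case_tac ks; simp add: partial_deriv_const)+
        have "iter_deriv js (\<lambda>x. exp_char h x - (1 + ?L x)) x = (\<Prod>j\<leftarrow>js. \<i> * complex_of_real (h $ j)) * exp_char h x"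
          unfolding eq iter_deriv_exp_char
          by (simp add: snoc partial_deriv_const partial_deriv_linear_char c0)
        also have "cmod \<dots> \<le> norm h ^ length js"
          using prod[of js] by (simp add: norm_mult exp_char_def)
        also have "\<dots> \<le> norm h ^ 2"
          using h False by (intro power_decreasing) (cases ks; simp add: snoc)+
        finally show ?thesis using B by (intro le[of _ 1]) simp_all
      qed
    qed
  qed
  then show ?thesis
    using B by (intro that[of "1 + B + B\<^sup>2"]) (auto simp: deriv_bound_def add_pos_nonneg)
qed

definition trig_approx :: "(real ^ 'n::finite) set \<Rightarrow> nat \<Rightarrow> (real ^ 'n::finite \<Rightarrow> complex) \<Rightarrow> bool" where
  "trig_approx K m f \<longleftrightarrow> smooth f \<and> (\<forall>\<epsilon>>0. \<exists>g\<in>trig_span. deriv_bound K m \<epsilon> (\<lambda>x. f x - g x))"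

lemma trig_approx_trig_span: "f \<in> trig_span \<Longrightarrow> trig_approx K m f"
  unfolding trig_approx_def
  by (auto simp: smooth_trig_span deriv_bound_def iter_deriv_zero intro!: bexI[of _ f])

lemma trig_approx_add:
  assumes "trig_approx K m f" "trig_approx K m g"
  shows "trig_approx K m (\<lambda>x. f x + g x)"
  unfolding trig_approx_def
proof (intro conjI allI impI)
  show "smooth (\<lambda>x. f x + g x)" using assms by (auto simp: trig_approx_def intro: smooth_add)
  fix \<epsilon> :: real assume "\<epsilon> > 0"
  then obtain f' g' where f': "f' \<in> trig_span" "deriv_bound K m (\<epsilon>/2) (\<lambda>x. f x - f' x)"
    and g': "g' \<in> trig_span" "deriv_bound K m (\<epsilon>/2) (\<lambda>x. g x - g' x)"
    using assms unfolding trig_approx_def by (meson half_gt_zero)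
  have "deriv_bound K m (\<epsilon>/2 + \<epsilon>/2) (\<lambda>x. (f x - f' x) + (g x - g' x))"
    using assms f' g' by (intro deriv_bound_add) (auto simp: trig_approx_def intro: smooth_diff smooth_trig_span)
  then show "\<exists>h\<in>trig_span. deriv_bound K m \<epsilon> (\<lambda>x. f x + g x - h x)"
    using f' g' by (intro bexI[of _ "\<lambda>x. f' x + g' x"] trig_span_add) (simp_all add: algebra_simps)
qed

text \<open>The error is (f - f') g + f' (g - g'). The approximant f' is fixed before g', since the
  accuracy required of g' depends on a derivative bound for f'. Each summand gets \<epsilon>/2 after
  the Leibniz factor 2^m.\<close>

lemma trig_approx_mult:
  assumes K: "compact K" and f: "trig_approx K m f" and g: "trig_approx K m g"
  shows "trig_approx K m (\<lambda>x. f x * g x)"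
  unfolding trig_approx_def
proof (intro conjI allI impI)
  have sm: "smooth f" "smooth g" using f g by (auto simp: trig_approx_def)
  then show "smooth (\<lambda>x. f x * g x)" by (rule smooth_mult)
  fix \<epsilon> :: real assume \<epsilon>: "\<epsilon> > 0"
  obtain b where b: "b > 0" "deriv_bound K m b g" using deriv_bound_exists[OF sm(2) K] by blast
  define \<delta> where "\<delta> = \<epsilon> / (2 * 2 ^ m * b)"
  have \<delta>: "\<delta> > 0" using \<epsilon> b by (simp add: \<delta>_def)
  obtain f' where f': "f' \<in> trig_span" "deriv_bound K m \<delta> (\<lambda>x. f x - f' x)"
    using f \<delta> unfolding trig_approx_def by meson
  note smf' = smooth_trig_span[OF f'(1)]
  obtain a where a: "a > 0" "deriv_bound K m a f'" using deriv_bound_exists[OF smf' K] by blast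
  define \<eta> where "\<eta> = \<epsilon> / (2 * 2 ^ m * a)"
  have \<eta>: "\<eta> > 0" using \<epsilon> a by (simp add: \<eta>_def)
  obtain g' where g': "g' \<in> trig_span" "deriv_bound K m \<eta> (\<lambda>x. g x - g' x)"
    using g \<eta> unfolding trig_approx_def by meson
  note smg' = smooth_trig_span[OF g'(1)]
  have "deriv_bound K m (2 ^ m * \<delta> * b + 2 ^ m * a * \<eta>) (\<lambda>x. (f x - f' x) * g x + f' x * (g x - g' x))"
    by (intro deriv_bound_add deriv_bound_mult smooth_mult smooth_diff sm smf' smg' f' g' a b)
  moreover have "2 ^ m * \<delta> * b + 2 ^ m * a * \<eta> = \<epsilon>" using a b by (simp add: \<delta>_def \<eta>_def)
  moreover have "(f x - f' x) * g x + f' x * (g x - g' x) = f x * g x - f' x * g' x" for x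
    by (simp add: algebra_simps)
  ultimately have "deriv_bound K m \<epsilon> (\<lambda>x. f x * g x - f' x * g' x)" by simp
  then show "\<exists>h\<in>trig_span. deriv_bound K m \<epsilon> (\<lambda>x. f x * g x - h x)"
    using trig_span_mult[OF f'(1) g'(1)] by (intro bexI)
qed

lemma trig_approx_const: "trig_approx K m (\<lambda>_. c)"
  by (rule trig_approx_trig_span[OF trig_span_const])

lemma trig_approx_sum:
  "(\<And>i. i \<in> I \<Longrightarrow> trig_approx K m (f i)) \<Longrightarrow> trig_approx K m (\<lambda>x. \<Sum>i\<in>I. f i x)"
  by (induction I rule: infinite_finite_induct) (auto intro: trig_approx_const trig_approx_add)

lemma trig_approx_limit:
  assumes "smooth f" and "\<And>\<epsilon>. \<epsilon> > 0 \<Longrightarrow> \<exists>g. trig_approx K m g \<and> deriv_bound K m \<epsilon> (\<lambda>x. f x - g x)"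
  shows "trig_approx K m f"
  unfolding trig_approx_def
proof (intro conjI allI impI)
  fix \<epsilon> :: real assume "\<epsilon> > 0"
  then obtain g where g: "trig_approx K m g" "deriv_bound K m (\<epsilon>/2) (\<lambda>x. f x - g x)"
    using assms(2) half_gt_zero by blast
  then obtain h where h: "h \<in> trig_span" "deriv_bound K m (\<epsilon>/2) (\<lambda>x. g x - h x)"
    using \<open>\<epsilon> > 0\<close> unfolding trig_approx_def by (meson half_gt_zero)
  have "deriv_bound K m (\<epsilon>/2 + \<epsilon>/2) (\<lambda>x. (f x - g x) + (g x - h x))"
    using assms(1) g h by (intro deriv_bound_add) (auto simp: trig_approx_def intro: smooth_diff smooth_trig_span)
  then show "\<exists>g\<in>trig_span. deriv_bound K m \<epsilon> (\<lambda>x. f x - g x)" using h(1) by auto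
qed (rule assms(1))

text \<open>The difference quotient (exp(i t x_j) - 1) / (i t) tends to x_j: the quadratic remainder
  C t^2, divided by t, leaves C t.\<close>

lemma trig_approx_coord:
  fixes K :: "(real ^ 'n::finite) set"
  assumes "compact K"
  shows "trig_approx K m (\<lambda>x. complex_of_real (x $ j))"
proof (rule trig_approx_limit[OF smooth_coord])
  fix \<epsilon> :: real assume "\<epsilon> > 0"
  obtain C where C: "C > 0" "\<And>h :: real ^ 'n. norm h \<le> 1 \<Longrightarrow>
    deriv_bound K m (C * (norm h)\<^sup>2) (\<lambda>x. exp_char h x - (1 + \<i> * complex_of_real (h \<bullet> x)))"
    using exp_char_second_order[OF assms] by blast
  define t where "t = min 1 (\<epsilon> / C)"
  have t: "t > 0" "t \<le> 1" "C * t \<le> \<epsilon>" using C(1) \<open>\<epsilon> > 0\<close> by (auto simp: t_def min_def field_simps)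
  let ?h = "axis j t :: real ^ 'n"
  let ?c = "- (1 / (\<i> * complex_of_real t))"
  have nh: "norm ?h = t" using t(1) by (simp add: norm_eq_sqrt_inner inner_axis_axis)
  have sm: "smooth (\<lambda>x. exp_char ?h x - (1 + \<i> * complex_of_real (?h \<bullet> x)))"
    by (intro smooth_diff smooth_add smooth_linear_char smooth_const smooth_exp_char)
  have "deriv_bound K m (C * t\<^sup>2) (\<lambda>x. exp_char ?h x - (1 + \<i> * complex_of_real (?h \<bullet> x)))"
    using C(2)[of ?h] t nh by simp
  note bd = deriv_bound_cmult[OF sm this, of ?c]
  have c_eq: "cmod ?c * (C * t\<^sup>2) = C * t" using t by (simp add: norm_divide norm_mult power2_eq_square)
  have f_eq: "?c * (exp_char ?h x - (1 + \<i> * complex_of_real (?h \<bullet> x))) =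
      complex_of_real (x $ j) - (?c + - ?c * exp_char ?h x)" for x
    using t(1) by (simp add: inner_axis' field_simps)
  have "deriv_bound K m \<epsilon> (\<lambda>x. complex_of_real (x $ j) - (?c + - ?c * exp_char ?h x))"
    by (rule deriv_bound_mono[OF bd[unfolded c_eq f_eq] subset_refl order_refl t(3)])
  moreover have "(\<lambda>x. ?c + - ?c * exp_char ?h x) \<in> trig_span"
    by (intro trig_span_add trig_span_const trig_span_single)
  ultimately show "\<exists>g. trig_approx K m g \<and> deriv_bound K m \<epsilon> (\<lambda>x. complex_of_real (x $ j) - g x)"
    using trig_approx_trig_span by blast
qed

lemma trig_approx_poly_coord:
  assumes "compact K"
  shows "trig_approx K m (\<lambda>x. complex_of_real (poly q (x $ j)))"
proof (induction q)
  case (pCons a q)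
  have "trig_approx K m (\<lambda>x. complex_of_real a + complex_of_real (x $ j) * complex_of_real (poly q (x $ j)))"
    by (intro trig_approx_add trig_approx_mult trig_approx_const trig_approx_coord pCons assms)
  then show ?case by simp
qed (simp add: trig_approx_const)

section \<open>Density of trigonometric sums\<close>

definition set_coord :: "'n::finite \<Rightarrow> real \<Rightarrow> real ^ 'n::finite \<Rightarrow> real ^ 'n::finite" where
  "set_coord j s x = x + (s - x $ j) *\<^sub>R axis j 1"

lemma set_coord_nth: "set_coord j s x $ i = (if i = j then s else x $ i)"
  by (simp add: set_coord_def axis_def)

lemma set_coord_set_coord: "set_coord j s (set_coord j t x) = set_coord j s x"
  by (simp add: vec_eq_iff set_coord_nth)

lemma set_coord_self: "set_coord j (x $ j) x = x"
  by (simp add: vec_eq_iff set_coord_nth)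

lemma set_coord_line: "set_coord j s x = set_coord j 0 x + s *\<^sub>R axis j 1"
  by (simp add: vec_eq_iff set_coord_nth axis_def)

lemma has_derivative_set_coord: "(set_coord j s has_derivative set_coord j 0) (at x)"
proof -
  have "((\<lambda>x. x + (s - x $ j) *\<^sub>R axis j 1) has_derivative (\<lambda>h. h + (0 - h $ j) *\<^sub>R axis j 1)) (at x)"
    by (intro derivative_intros bounded_linear_imp_has_derivative bounded_linear_vec_nth)
  then show ?thesis by (simp add: set_coord_def[abs_def])
qed

lemma differentiable_set_coord:
  assumes "\<And>x. f differentiable (at x)"
  shows "(\<lambda>x. f (set_coord j s x)) differentiable (at x)"
proof -
  have "set_coord j s differentiable (at x)"
    using has_derivative_set_coord by (auto simp: differentiable_def)
  from differentiable_chain_at[OF this assms] show ?thesis by (simp add: o_def)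
qed

lemma partial_deriv_set_coord:
  assumes "\<And>x. f differentiable (at x)"
  shows "partial_deriv i (\<lambda>x. f (set_coord j s x)) = (if i = j then (\<lambda>_. 0) else (\<lambda>x. partial_deriv i f (set_coord j s x)))"
proof
  fix x
  obtain f' where f': "(f has_derivative f') (at (set_coord j s x))"
    using assms unfolding differentiable_def by blast
  have "((\<lambda>x. f (set_coord j s x)) has_derivative (\<lambda>h. f' (set_coord j 0 h))) (at x)"
    by (rule has_derivative_compose[OF has_derivative_set_coord f'])
  then have "partial_deriv i (\<lambda>x. f (set_coord j s x)) x = f' (set_coord j 0 (axis i 1))"
    by (rule has_derivative_partial_deriv)
  also have "set_coord j 0 (axis i 1) = (if i = j then 0 else axis i (1 :: real))"
    by (auto simp: vec_eq_iff set_coord_nth axis_def)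
  finally show "partial_deriv i (\<lambda>x. f (set_coord j s x)) x =
      (if i = j then (\<lambda>_. 0) else (\<lambda>x. partial_deriv i f (set_coord j s x))) x"
    using has_derivative_partial_deriv[OF f', of i] linear_0[OF has_derivative_linear[OF f']] by auto
qed

lemma smooth_set_coord: "smooth f \<Longrightarrow> smooth (\<lambda>x. f (set_coord j s x))"
proof (rule smooth_coinduct[of _ "insert (\<lambda>_. 0) ((\<lambda>f x. f (set_coord j s x)) ` Collect smooth)"])
  let ?S = "insert (\<lambda>_. 0) ((\<lambda>f x. f (set_coord j s x)) ` Collect smooth)"
  show "g differentiable (at x)" if "g \<in> ?S" for g x
    using that by (auto intro: differentiable_set_coord smooth_differentiable)
  show "partial_deriv i g \<in> ?S" if "g \<in> ?S" for g i
    using that by (auto simp: partial_deriv_const partial_deriv_set_coord smooth_differentiable smooth_partial_deriv)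
qed auto

lemma iter_deriv_set_coord:
  assumes "smooth f" "j \<notin> set js"
  shows "iter_deriv js (\<lambda>x. f (set_coord j s x)) = (\<lambda>x. iter_deriv js f (set_coord j s x))"
  using assms(2)
  by (induction js) (auto simp: partial_deriv_set_coord smooth_differentiable smooth_iter_deriv assms(1))

lemma set_coord_derivative_bound:
  assumes sm: "smooth h" and L: "\<And>s. \<bar>s\<bar> \<le> P \<Longrightarrow> cmod (partial_deriv j h (set_coord j s x)) \<le> L"
    and "\<bar>s\<bar> \<le> P" "\<bar>t\<bar> \<le> P"
  shows "cmod (h (set_coord j s x) - h (set_coord j t x)) \<le> L * \<bar>s - t\<bar>"
proof -
  let ?f = "\<lambda>s. h (set_coord j s x)" and ?f' = "\<lambda>s. partial_deriv j h (set_coord j s x)"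
  have "norm (?f s - ?f t) \<le> L * norm (s - t)"
  proof (rule differentiable_bound[of "{-P..P}" ?f "\<lambda>s u. u *\<^sub>R ?f' s"])
    show "(?f has_derivative (\<lambda>u. u *\<^sub>R ?f' r)) (at r within {-P..P})" for r
      using has_vector_derivative_partial_deriv[of h "set_coord j 0 x" r j] smooth_differentiable[OF sm]
      unfolding set_coord_line[symmetric] has_vector_derivative_def by (auto intro: has_derivative_at_withinI)
    show "onorm (\<lambda>u. u *\<^sub>R ?f' r) \<le> L" if "r \<in> {-P..P}" for r
    proof (rule onorm_le)
      show "norm (u *\<^sub>R ?f' r) \<le> L * norm u" for u
        using mult_left_mono[OF L[of r], of "\<bar>u\<bar>"] that by (auto simp: mult.commute)
    qed
  qed (use assms in auto)
  then show ?thesis by simp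
qed

text \<open>The rate matters, not only convergence: the error depends on \<phi> only through L, so a
  single N serves all base points x and all derivatives in the other directions.\<close>

lemma Bernstein_Lipschitz:
  fixes \<phi> :: "real \<Rightarrow> complex"
  assumes lip: "\<And>u v. u \<in> {0..1} \<Longrightarrow> v \<in> {0..1} \<Longrightarrow> cmod (\<phi> u - \<phi> v) \<le> L * \<bar>u - v\<bar>"
    and "L \<ge> 0" "N > 0" and u: "u \<in> {0..1}"
  shows "cmod (\<phi> u - (\<Sum>k\<le>N. \<phi> (real k / real N) * complex_of_real (Bernstein N k u))) \<le> 2 * L / sqrt (real N)"
proof -
  let ?B = "\<lambda>k. Bernstein N k u" and ?r = "sqrt (real N)"
  have r: "?r > 0" "?r * ?r = real N" using \<open>N > 0\<close> by simp_all
  have B0: "?B k \<ge> 0" for k using u by (intro Bernstein_nonneg) auto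
  \<comment> \<open>The threshold is 1 / sqrt N: a distance beyond it is at most sqrt N times its
    own square. Averaging the squares against the Bernstein weights then gives the binomial variance
    u (1 - u) / N.\<close>
  have dist: "\<bar>u - real k / real N\<bar> \<le> 1 / ?r + ?r * (u - real k / real N)\<^sup>2" for k
  proof (cases "\<bar>u - real k / real N\<bar> \<le> 1 / ?r")
    case False
    then have "1 * \<bar>u - real k / real N\<bar> \<le> (?r * \<bar>u - real k / real N\<bar>) * \<bar>u - real k / real N\<bar>"
      using r(1) by (intro mult_right_mono) (auto simp: field_simps)
    then show ?thesis using r(1) by (simp add: power2_eq_square mult.assoc abs_mult[symmetric] add_increasing)
  qed (use r in \<open>simp add: add_increasing2\<close>)
  have var: "(\<Sum>k\<le>N. (u - real k / real N)\<^sup>2 * ?B k) = u * (1 - u) / real N"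
  proof -
    have "(u - real k / real N)\<^sup>2 * ?B k * (real N)\<^sup>2 =
        (real N * u)\<^sup>2 * ?B k + (1 - 2 * real N * u) * (real k * ?B k) + real k * (real k - 1) * ?B k" for k
      using \<open>N > 0\<close> by (simp add: power2_eq_square field_simps)
    then have "(\<Sum>k\<le>N. (u - real k / real N)\<^sup>2 * ?B k) * (real N)\<^sup>2 =
        (real N * u)\<^sup>2 * (\<Sum>k\<le>N. ?B k) + (1 - 2 * real N * u) * (\<Sum>k\<le>N. real k * ?B k)
          + (\<Sum>k\<le>N. real k * (real k - 1) * ?B k)"
      unfolding sum_distrib_left sum_distrib_right by (simp only: sum.distrib)
    also have "\<dots> = real N * (u * (1 - u))"
      unfolding sum_Bernstein sum_k_Bernstein sum_kk_Bernstein by (simp add: power2_eq_square algebra_simps)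
    finally have eq: "(\<Sum>k\<le>N. (u - real k / real N)\<^sup>2 * ?B k) * (real N)\<^sup>2 = real N * (u * (1 - u))" .
    have "(real N)\<^sup>2 \<noteq> 0" using \<open>N > 0\<close> by simp
    from nonzero_mult_div_cancel_right[OF this, of "\<Sum>k\<le>N. (u - real k / real N)\<^sup>2 * ?B k"]
    show ?thesis unfolding eq using \<open>N > 0\<close> by (simp add: power2_eq_square)
  qed
  have "\<phi> u = (\<Sum>k\<le>N. \<phi> u * complex_of_real (?B k))"
    using sum_Bernstein[of N u] by (simp add: sum_distrib_left[symmetric] of_real_sum[symmetric] del: of_real_sum sum_Bernstein)
  then have "cmod (\<phi> u - (\<Sum>k\<le>N. \<phi> (real k / real N) * complex_of_real (?B k))) =
      cmod (\<Sum>k\<le>N. (\<phi> u - \<phi> (real k / real N)) * complex_of_real (?B k))"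
    by (simp add: left_diff_distrib sum_subtractf)
  also have "\<dots> \<le> (\<Sum>k\<le>N. L * (1 / ?r * ?B k + ?r * ((u - real k / real N)\<^sup>2 * ?B k)))"
  proof (rule sum_norm_le)
    fix k assume "k \<in> {..N}"
    then have "cmod (\<phi> u - \<phi> (real k / real N)) \<le> L * \<bar>u - real k / real N\<bar>"
      using u \<open>N > 0\<close> by (intro lip) (auto simp: field_simps)
    also have "\<dots> \<le> L * (1 / ?r + ?r * (u - real k / real N)\<^sup>2)"
      using dist \<open>L \<ge> 0\<close> by (intro mult_left_mono)
    finally have "cmod (\<phi> u - \<phi> (real k / real N)) * ?B k \<le> L * (1 / ?r + ?r * (u - real k / real N)\<^sup>2) * ?B k"
      using B0 by (rule mult_right_mono)
    then show "cmod ((\<phi> u - \<phi> (real k / real N)) * complex_of_real (?B k))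
        \<le> L * (1 / ?r * ?B k + ?r * ((u - real k / real N)\<^sup>2 * ?B k))"
      using B0[of k] unfolding norm_mult by (simp add: algebra_simps)
  qed
  also have "\<dots> = L * (1 / ?r * (\<Sum>k\<le>N. ?B k) + ?r * (\<Sum>k\<le>N. (u - real k / real N)\<^sup>2 * ?B k))"
    by (simp only: sum_distrib_left sum.distrib[symmetric])
  also have "\<dots> = L * (1 / ?r + ?r * (u * (1 - u) / real N))" by (simp add: var)
  also have "\<dots> \<le> L * (1 / ?r + ?r * (1 / real N))"
  proof -
    have "u * (1 - u) \<le> 1 * 1" using u by (intro mult_mono) auto
    then show ?thesis using \<open>L \<ge> 0\<close> r by (intro mult_left_mono add_left_mono divide_right_mono) auto
  qed
  also have "?r * (1 / real N) = 1 / ?r" using r by (simp add: field_simps)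
  finally show ?thesis by (simp add: mult.commute)
qed

section \<open>Polynomials in one coordinate with smooth coefficients\<close>

lemma real_poly_antiderivative: "\<exists>Q :: real poly. pderiv Q = q \<and> poly Q 0 = 0"
proof -
  let ?Q = "\<Sum>i\<le>degree q. monom (coeff q i / real (Suc i)) (Suc i)"
  have "pderiv (sum f I) = (\<Sum>i\<in>I. pderiv (f i))" for f :: "nat \<Rightarrow> real poly" and I
    by (induction I rule: infinite_finite_induct) (simp_all add: pderiv_add)
  then have "pderiv ?Q = (\<Sum>i\<le>degree q. monom (coeff q i) i)"
    by (simp add: pderiv_monom del: of_nat_Suc)
  also have "\<dots> = q" by (rule poly_as_sum_of_monoms)
  finally show ?thesis by (intro exI[of _ ?Q]) (simp add: poly_sum poly_monom)
qed

lemma has_derivative_poly_coord: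
  "((\<lambda>x :: real ^ 'n::finite. complex_of_real (poly q (x $ j))) has_derivative
     (\<lambda>h. complex_of_real (h $ j * poly (pderiv q) (x $ j)))) (at x)"
proof (rule has_derivative_of_real)
  show "((\<lambda>x. poly q (x $ j)) has_derivative (\<lambda>h. h $ j * poly (pderiv q) (x $ j))) (at x)"
    using has_derivative_compose[OF bounded_linear_imp_has_derivative[OF bounded_linear_vec_nth[of j]]
        poly_DERIV[of q "x $ j", unfolded has_field_derivative_def]]
    by (simp add: mult.commute)
qed

lemma partial_deriv_poly_coord:
  "partial_deriv i (\<lambda>x :: real ^ 'n::finite. complex_of_real (poly q (x $ j))) =
     (if i = j then (\<lambda>x. complex_of_real (poly (pderiv q) (x $ j))) else (\<lambda>_. 0))"
proof
  show "partial_deriv i (\<lambda>x. complex_of_real (poly q (x $ j))) x =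
     (if i = j then (\<lambda>x. complex_of_real (poly (pderiv q) (x $ j))) else (\<lambda>_. 0)) x" for x :: "real ^ 'n"
    by (subst has_derivative_partial_deriv[OF has_derivative_poly_coord]) (simp add: axis_def)
qed

lemma smooth_poly_coord: "smooth (\<lambda>x. complex_of_real (poly q (x $ j)))"
proof (induction q)
  case (pCons a q)
  then have "smooth (\<lambda>x. complex_of_real a + complex_of_real (x $ j) * complex_of_real (poly q (x $ j)))"
    by (intro smooth_add smooth_mult smooth_coord smooth_const)
  then show ?case by simp
qed simp

lemma iter_deriv_poly_coord_mult:
  assumes "smooth \<psi>" "j \<notin> set js"
  shows "iter_deriv js (\<lambda>x. complex_of_real (poly q (x $ j)) * \<psi> x) =
    (\<lambda>x. complex_of_real (poly q (x $ j)) * iter_deriv js \<psi> x)"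
  using assms(2)
  by (induction js)
     (auto simp: partial_deriv_mult smooth_differentiable smooth_poly_coord smooth_iter_deriv
        assms(1) partial_deriv_poly_coord)

definition depends_on :: "'n::finite set \<Rightarrow> (real ^ 'n::finite \<Rightarrow> complex) \<Rightarrow> bool" where
  "depends_on J f \<longleftrightarrow> (\<forall>x y. (\<forall>j\<in>J. x $ j = y $ j) \<longrightarrow> f x = f y)"

lemma depends_on_partial_deriv:
  assumes "smooth f" "depends_on J f"
  shows "depends_on J (partial_deriv j f)" "j \<notin> J \<Longrightarrow> partial_deriv j f = (\<lambda>_. 0)"
proof -
  show "depends_on J (partial_deriv j f)"
    unfolding depends_on_def partial_deriv_def
  proof (intro allI impI)
    fix x y :: "real ^ 'a" assume xy: "\<forall>j\<in>J. x $ j = y $ j"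
    have "f (x + t *\<^sub>R axis j 1) = f (y + t *\<^sub>R axis j 1)" for t
      using assms(2) xy unfolding depends_on_def by simp
    then show "vector_derivative (\<lambda>t. f (x + t *\<^sub>R axis j 1)) (at 0) = vector_derivative (\<lambda>t. f (y + t *\<^sub>R axis j 1)) (at 0)"
      by simp
  qed
  assume "j \<notin> J"
  then have "f (x + t *\<^sub>R axis j 1) = f x" for x t
  proof -
    have "\<forall>i\<in>J. (x + t *\<^sub>R axis j 1) $ i = x $ i" using \<open>j \<notin> J\<close> by (auto simp: axis_def)
    then show ?thesis using assms(2) unfolding depends_on_def by blast
  qed
  then show "partial_deriv j f = (\<lambda>_. 0)"
    unfolding partial_deriv_def by simp
qed

text \<open>Variable j has been made polynomial, while the coefficients remain arbitrary smooth
  functions of the coordinates in J; this is how the density proof passes from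
  \<open>insert j J\<close> to J.\<close>

definition poly_mixed :: "'n::finite set \<Rightarrow> 'n::finite \<Rightarrow> (real ^ 'n::finite \<Rightarrow> complex) set" where
  "poly_mixed J j = {g. \<exists>(d :: nat) q \<psi>. (\<forall>k. smooth (\<psi> k) \<and> depends_on J (\<psi> k)) \<and>
     g = (\<lambda>x. \<Sum>k<d. complex_of_real (poly (q k) (x $ j)) * \<psi> k x)}"

lemma smooth_poly_mixed: "g \<in> poly_mixed J j \<Longrightarrow> smooth g"
  unfolding poly_mixed_def by (auto intro!: smooth_sum smooth_mult smooth_poly_coord)

lemma poly_mixed_add:
  assumes "g \<in> poly_mixed J j" "smooth \<psi>" "depends_on J \<psi>"
  shows "(\<lambda>x. g x + \<psi> x) \<in> poly_mixed J j"
proof -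
  obtain d :: nat and q \<psi>' where *: "\<And>k. smooth (\<psi>' k) \<and> depends_on J (\<psi>' k)"
    "g = (\<lambda>x. \<Sum>k<d. complex_of_real (poly (q k) (x $ j)) * \<psi>' k x)"
    using assms(1) unfolding poly_mixed_def by blast
  show ?thesis
    unfolding poly_mixed_def mem_Collect_eq
    by (rule exI[of _ "Suc d"], rule exI[of _ "q(d := 1)"], rule exI[of _ "\<psi>'(d := \<psi>)"])
       (use * assms in auto)
qed

text \<open>Only the polynomial factors are integrated, since the coefficients do not depend on x_j.
  Vanishing at x_j = 0 leaves the values on that hyperplane free to be prescribed by a further
  summand.\<close>

lemma poly_mixed_antiderivative:
  assumes "g \<in> poly_mixed J j" "j \<notin> J"
  shows "\<exists>G\<in>poly_mixed J j. partial_deriv j G = g \<and> (\<forall>x. G (set_coord j 0 x) = 0)"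
proof -
  obtain d :: nat and q \<psi> where *: "\<And>k. smooth (\<psi> k)" "\<And>k. depends_on J (\<psi> k)"
    "g = (\<lambda>x. \<Sum>k<d. complex_of_real (poly (q k) (x $ j)) * \<psi> k x)"
    using assms(1) unfolding poly_mixed_def by blast
  have "\<forall>k. \<exists>Q. pderiv Q = q k \<and> poly Q 0 = 0" using real_poly_antiderivative by blast
  then obtain Q where Q: "\<And>k. pderiv (Q k) = q k" "\<And>k. poly (Q k) 0 = 0" by metis
  let ?G = "\<lambda>x. \<Sum>k<d. complex_of_real (poly (Q k) (x $ j)) * \<psi> k x"
  have "partial_deriv j ?G = (\<lambda>x. \<Sum>k<d. partial_deriv j (\<lambda>x. complex_of_real (poly (Q k) (x $ j)) * \<psi> k x) x)"
    using iter_deriv_sum[of "{..<d}" "\<lambda>k x. complex_of_real (poly (Q k) (x $ j)) * \<psi> k x" "[j]"]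
    by (simp add: smooth_mult smooth_poly_coord *(1))
  also have "\<dots> = g"
    by (simp add: partial_deriv_mult smooth_differentiable smooth_poly_coord *(1) partial_deriv_poly_coord
        depends_on_partial_deriv(2)[OF *(1,2) assms(2)] Q *(3))
  finally have "partial_deriv j ?G = g" .
  moreover have "?G \<in> poly_mixed J j" unfolding poly_mixed_def using * by blast
  moreover have "?G (set_coord j 0 x) = 0" for x by (simp add: set_coord_nth Q)
  ultimately show ?thesis by blast
qed

abbreviation cube :: "real \<Rightarrow> (real ^ 'n::finite) set" where
  "cube P \<equiv> {x. \<forall>j. \<bar>x $ j\<bar> \<le> P}"

lemma compact_cube: "compact (cube P :: (real ^ 'n::finite) set)"
proof -
  have "cube P = cbox (\<chi> j. - P) (\<chi> j :: 'n. P)"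
    by (auto simp: mem_box_cart abs_le_iff) (metis minus_le_iff)+
  then show ?thesis by simp
qed

text \<open>Bernstein approximation in x_j alone, with the values of f at the nodes as coefficients.
  Derivatives in the other directions commute with it, and one further derivative in direction j
  supplies the Lipschitz constant, hence the order \<open>Suc l\<close>.\<close>

lemma poly_mixed_approx_0:
  fixes f :: "real ^ 'n::finite \<Rightarrow> complex"
  assumes sm: "smooth f" and dep: "depends_on (insert j J) f" and "P > 0" "\<epsilon> > 0"
  shows "\<exists>g\<in>poly_mixed J j. \<forall>js. j \<notin> set js \<longrightarrow> length js \<le> l \<longrightarrow>
           (\<forall>x\<in>cube P. cmod (iter_deriv js (\<lambda>x. f x - g x) x) \<le> \<epsilon>)"
proof -
  obtain L where L: "L > 0" "deriv_bound (cube P) (Suc l) L f"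
    using deriv_bound_exists[OF sm compact_cube] by blast
  obtain N :: nat where N: "(4 * P * L / \<epsilon>)\<^sup>2 < real N" using reals_Archimedean2 by blast
  then have "N > 0" using order_le_less_trans[OF zero_le_power2 N] by simp
  have "4 * P * L / \<epsilon> < sqrt (real N)" by (rule real_less_rsqrt[OF N])
  then have small: "2 * (2 * P * L) / sqrt (real N) \<le> \<epsilon>"
    using \<open>\<epsilon> > 0\<close> \<open>N > 0\<close> by (simp add: field_simps)
  \<comment> \<open>The Bernstein polynomials and their nodes k / N, transported from [0, 1] to
    [-P, P].\<close>
  define q where "q k = smult (real (N choose k)) ([:1/2, 1/(2*P):] ^ k * [:1/2, - 1/(2*P):] ^ (N - k))" for k
  define node where "node k = 2 * P * (real k / real N) - P" for k
  have q: "poly (q k) s = Bernstein N k ((s + P) / (2 * P))" for k s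
  proof -
    have 1: "poly [:1/2, 1/(2*P):] s = (s + P) / (2 * P)" and 2: "poly [:1/2, - 1/(2*P):] s = 1 - (s + P) / (2 * P)"
      using \<open>P > 0\<close> by (simp_all add: field_simps)
    show ?thesis unfolding q_def Bernstein_def poly_smult poly_mult poly_power 1 2 by (simp only: mult.assoc)
  qed
  define g where "g x = (\<Sum>k<Suc N. complex_of_real (poly (q k) (x $ j)) * f (set_coord j (node k) x))" for x
  have "depends_on J (\<lambda>x. f (set_coord j s x))" for s
    using dep unfolding depends_on_def by (simp add: set_coord_nth)
  then have g_mem: "g \<in> poly_mixed J j"
    unfolding poly_mixed_def g_def[abs_def] mem_Collect_eq using smooth_set_coord[OF sm]
    by (intro exI[of _ "Suc N"] exI[of _ q] exI[of _ "\<lambda>k x. f (set_coord j (node k) x)"]) simp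
  have "cmod (iter_deriv js (\<lambda>x. f x - g x) x) \<le> \<epsilon>"
    if js: "j \<notin> set js" "length js \<le> l" and x: "x \<in> cube P" for js x
  proof -
    let ?F = "iter_deriv js f"
    have "iter_deriv js g = (\<lambda>x. \<Sum>k<Suc N. complex_of_real (poly (q k) (x $ j)) * ?F (set_coord j (node k) x))"
      unfolding g_def[abs_def]
      by (subst iter_deriv_sum)
         (auto intro!: smooth_mult smooth_poly_coord smooth_set_coord sm
           simp: iter_deriv_poly_coord_mult iter_deriv_set_coord js smooth_set_coord sm simp del: sum.lessThan_Suc)
    then have eq: "iter_deriv js (\<lambda>x. f x - g x) x =
        ?F x - (\<Sum>k\<le>N. ?F (set_coord j (node k) x) * complex_of_real (Bernstein N k ((x $ j + P) / (2 * P))))"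
      by (simp add: iter_deriv_diff sm smooth_poly_mixed[OF g_mem] q lessThan_Suc_atMost mult.commute del: sum.lessThan_Suc)
    let ?\<phi> = "\<lambda>u. ?F (set_coord j (2 * P * u - P) x)"
    have "cmod (?\<phi> u - ?\<phi> v) \<le> (2 * P * L) * \<bar>u - v\<bar>" if "u \<in> {0..1}" "v \<in> {0..1}" for u v
    proof -
      have b: "\<bar>2 * P * u - P\<bar> \<le> P" if "u \<in> {0..1}" for u
        using that \<open>P > 0\<close> by (auto simp: abs_le_iff mult_left_le algebra_simps)
      have "cmod (?\<phi> u - ?\<phi> v) \<le> L * \<bar>(2 * P * u - P) - (2 * P * v - P)\<bar>"
      proof (rule set_coord_derivative_bound[OF smooth_iter_deriv[OF sm] _ b[OF that(1)] b[OF that(2)]])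
        fix s assume "\<bar>s\<bar> \<le> P"
        then have "set_coord j s x \<in> cube P" using x by (simp add: set_coord_nth)
        then show "cmod (partial_deriv j ?F (set_coord j s x)) \<le> L"
          using deriv_boundD[OF L(2), of "j # js"] js by simp
      qed
      also have "(2 * P * u - P) - (2 * P * v - P) = 2 * P * (u - v)" by (simp add: algebra_simps)
      also have "L * \<bar>2 * P * (u - v)\<bar> = (2 * P * L) * \<bar>u - v\<bar>"
        using \<open>P > 0\<close> by (simp only: abs_mult) simp
      finally show ?thesis .
    qed
    moreover have "(x $ j + P) / (2 * P) \<in> {0..1}"
    proof -
      have "\<bar>x $ j\<bar> \<le> P" using x by simp
      then show ?thesis using \<open>P > 0\<close> by (auto simp: field_simps abs_le_iff)
    qed
    ultimately have "cmod (?\<phi> ((x $ j + P) / (2 * P)) - (\<Sum>k\<le>N. ?\<phi> (real k / real N) *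
        complex_of_real (Bernstein N k ((x $ j + P) / (2 * P))))) \<le> 2 * (2 * P * L) / sqrt (real N)"
      using L(1) \<open>P > 0\<close> \<open>N > 0\<close> by (intro Bernstein_Lipschitz) auto
    moreover have "2 * P * ((x $ j + P) / (2 * P)) - P = x $ j" using \<open>P > 0\<close> by simp
    ultimately show ?thesis using small unfolding eq node_def by (simp add: set_coord_self)
  qed
  then show ?thesis using g_mem by blast
qed

text \<open>
  Induction on the order \<open>r\<close> of differentiation in direction \<open>j\<close>: an approximation of
  \<open>\<partial>\<^sub>j f\<close> is integrated in \<open>x\<^sub>j\<close>, starting from the exact values on the hyperplane \<open>x\<^sub>j = 0\<close>.
\<close>

lemma poly_mixed_approx:
  fixes f :: "real ^ 'n::finite \<Rightarrow> complex"
  assumes "smooth f" "depends_on (insert j J) f" "P > 0" "\<epsilon> > 0" "j \<notin> J"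
  shows "\<exists>g\<in>poly_mixed J j. \<forall>js p. j \<notin> set js \<longrightarrow> length js \<le> l \<longrightarrow> p \<le> r \<longrightarrow>
           (\<forall>x\<in>cube P. cmod (iter_deriv (js @ replicate p j) (\<lambda>x. f x - g x) x) \<le> \<epsilon>)"
  using assms
proof (induction r arbitrary: f \<epsilon>)
  case 0
  then show ?case using poly_mixed_approx_0[of f j J P \<epsilon> l] by simp
next
  case (Suc r)
  \<comment> \<open>Two demands are met: \<delta> \<le> \<epsilon> for the orders p \<ge> 1, and
    \<delta> P \<le> \<epsilon> for p = 0, where the error is integrated over a segment of length at
    most P.\<close>
  define \<delta> where "\<delta> = \<epsilon> / (1 + P)"
  have \<delta>: "\<delta> > 0" "\<delta> \<le> \<epsilon>" "\<delta> * P \<le> \<epsilon>"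
    using \<open>P > 0\<close> \<open>\<epsilon> > 0\<close> by (auto simp: \<delta>_def field_simps)
  note sm = \<open>smooth f\<close>
  obtain g where g: "g \<in> poly_mixed J j"
    and "\<forall>js p. j \<notin> set js \<longrightarrow> length js \<le> l \<longrightarrow> p \<le> r \<longrightarrow> (\<forall>x\<in>cube P.
      cmod (iter_deriv (js @ replicate p j) (\<lambda>x. partial_deriv j f x - g x) x) \<le> \<delta>)"
    using Suc.IH[OF smooth_partial_deriv[OF sm] depends_on_partial_deriv(1)[OF sm Suc.prems(2), of j] \<open>P > 0\<close> \<delta>(1) \<open>j \<notin> J\<close>]
    by (elim bexE)
  then have g_le: "cmod (iter_deriv (js @ replicate p j) (\<lambda>x. partial_deriv j f x - g x) x) \<le> \<delta>"
    if "j \<notin> set js" "length js \<le> l" "p \<le> r" "x \<in> cube P" for js p x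
    using that by simp
  obtain G where G: "G \<in> poly_mixed J j" "partial_deriv j G = g" "\<And>x. G (set_coord j 0 x) = 0"
    using poly_mixed_antiderivative[OF g \<open>j \<notin> J\<close>] by blast
  define H where "H x = G x + f (set_coord j 0 x)" for x
  have "depends_on J (\<lambda>x. f (set_coord j 0 x))"
    using Suc.prems(2) unfolding depends_on_def by (simp add: set_coord_nth)
  then have H: "H \<in> poly_mixed J j"
    unfolding H_def[abs_def] using smooth_set_coord[OF sm] by (intro poly_mixed_add G)
  define D where "D x = f x - H x" for x
  have smD: "smooth D" unfolding D_def[abs_def] by (intro smooth_diff sm smooth_poly_mixed[OF H])
  have "partial_deriv j H = g"
    unfolding H_def[abs_def]
    by (simp add: partial_deriv_add smooth_differentiable smooth_poly_mixed[OF G(1)] smooth_set_coord[OF sm]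
        partial_deriv_set_coord[OF smooth_differentiable[OF sm]] G(2))
  then have D': "partial_deriv j D = (\<lambda>x. partial_deriv j f x - g x)"
    using iter_deriv_diff[OF sm smooth_poly_mixed[OF H], of "[j]"] by (simp add: D_def[abs_def])
  have "cmod (iter_deriv (js @ replicate p j) D x) \<le> \<epsilon>"
    if js: "j \<notin> set js" "length js \<le> l" and p: "p \<le> Suc r" and x: "x \<in> cube P" for js p x
  proof (cases p)
    case (Suc p')
    then have "iter_deriv (js @ replicate p j) D = iter_deriv (js @ replicate p' j) (partial_deriv j D)"
      by (simp add: replicate_append_same[symmetric] del: replicate_append_same)
    then show ?thesis using g_le[OF js _ x, of p'] p \<delta>(2) unfolding D' Suc by simp
  next
    case 0
    let ?h = "iter_deriv js D"
    \<comment> \<open>\<open>H\<close> agrees with f on the hyperplane x_j = 0, so D and its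
      derivatives along the hyperplane vanish there.\<close>
    have "?h (set_coord j 0 x) = 0"
    proof -
      have "D (set_coord j 0 x) = 0" for x by (simp add: D_def H_def G(3) set_coord_set_coord)
      then have "iter_deriv js (\<lambda>x. D (set_coord j 0 x)) = (\<lambda>_. 0)" by (simp add: iter_deriv_zero)
      then show ?thesis by (metis iter_deriv_set_coord[OF smD js(1)])
    qed
    moreover have "cmod (?h (set_coord j (x $ j) x) - ?h (set_coord j 0 x)) \<le> \<delta> * \<bar>x $ j - 0\<bar>"
    proof (rule set_coord_derivative_bound[OF smooth_iter_deriv[OF smD]])
      fix s assume "\<bar>s\<bar> \<le> P"
      then have "set_coord j s x \<in> cube P" using x by (simp add: set_coord_nth)
      moreover have "partial_deriv j ?h = iter_deriv (js @ []) (partial_deriv j D)"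
        using iter_deriv_perm[OF smD, of "j # js" "js @ [j]"] by simp
      ultimately show "cmod (partial_deriv j ?h (set_coord j s x)) \<le> \<delta>"
        using g_le[OF js, of 0 "set_coord j s x"] unfolding D' by simp
    qed (use x \<open>P > 0\<close> in auto)
    moreover have "\<delta> * \<bar>x $ j\<bar> \<le> \<delta> * P" using x \<delta> by (intro mult_left_mono) auto
    ultimately show ?thesis using \<delta>(3) 0 by (simp add: set_coord_self)
  qed
  then show ?case unfolding D_def[abs_def] using H by blast
qed

text \<open>Making f polynomial in x_j leaves coefficients that depend on one coordinate less and
  fall under the induction hypothesis, while polynomials in x_j are themselves approximable;
  products and limits of approximable functions stay approximable.\<close>

lemma smooth_trig_approx_cube:
  fixes f :: "real ^ 'n::finite \<Rightarrow> complex"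
  assumes "finite J" "smooth f" "depends_on J f" "P > 0"
  shows "trig_approx (cube P) m f"
  using assms
proof (induction J arbitrary: f rule: finite_induct)
  case empty
  then have f0: "f 0 = f x" for x unfolding depends_on_def by blast
  have eq: "(\<lambda>_. f 0) = f" by (rule ext) (rule f0)
  show ?case by (subst eq[symmetric]) (rule trig_approx_const)
next
  case (insert j J)
  show ?case
  proof (rule trig_approx_limit[OF \<open>smooth f\<close>])
    fix \<epsilon> :: real assume "\<epsilon> > 0"
    obtain g where g: "g \<in> poly_mixed J j"
      and "\<forall>js p. j \<notin> set js \<longrightarrow> length js \<le> m \<longrightarrow> p \<le> m \<longrightarrow> (\<forall>x\<in>cube P.
        cmod (iter_deriv (js @ replicate p j) (\<lambda>x. f x - g x) x) \<le> \<epsilon>)"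
      using poly_mixed_approx[OF insert.prems(1,2,3) \<open>\<epsilon> > 0\<close> \<open>j \<notin> J\<close>, of m m]
      by (elim bexE)
    then have g_le: "cmod (iter_deriv (js @ replicate p j) (\<lambda>x. f x - g x) x) \<le> \<epsilon>"
      if "j \<notin> set js" "length js \<le> m" "p \<le> m" "x \<in> cube P" for js p x
      using that by simp
    have "trig_approx (cube P) m g"
    proof -
      obtain d :: nat and q \<psi> where *: "\<And>k. smooth (\<psi> k)" "\<And>k. depends_on J (\<psi> k)"
        "g = (\<lambda>x. \<Sum>k<d. complex_of_real (poly (q k) (x $ j)) * \<psi> k x)"
        using g unfolding poly_mixed_def by blast
      show ?thesis
        unfolding *(3)
        by (intro trig_approx_sum trig_approx_mult compact_cube trig_approx_poly_coord insert.IH * \<open>P > 0\<close>)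
    qed
    moreover have "deriv_bound (cube P) m \<epsilon> (\<lambda>x. f x - g x)"
      unfolding deriv_bound_def
    proof (intro allI impI)
      fix js :: "'n list" and x :: "real ^ 'n" assume js: "length js \<le> m" and x: "x \<in> cube P"
      \<comment> \<open>Mixed derivatives may be sorted so that all differentiations in direction j
        are innermost, which is the form required by \<open>g_le\<close>.\<close>
      let ?ks = "filter (\<lambda>i. i \<noteq> j) js" and ?p = "length (filter (\<lambda>i. \<not> i \<noteq> j) js)"
      have rep: "filter (\<lambda>i. \<not> i \<noteq> j) js = replicate ?p j"
        by (induction js) auto
      have "mset js = mset (?ks @ replicate ?p j)"
        unfolding rep[symmetric] mset_append mset_filter by (rule multiset_partition)
      then have "iter_deriv js (\<lambda>x. f x - g x) = iter_deriv (?ks @ replicate ?p j) (\<lambda>x. f x - g x)"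
        by (intro iter_deriv_perm smooth_diff insert.prems smooth_poly_mixed[OF g])
      then show "cmod (iter_deriv js (\<lambda>x. f x - g x) x) \<le> \<epsilon>"
        using g_le[of ?ks ?p x] x js order_trans[OF length_filter_le js] by simp
    qed
    ultimately show "\<exists>g. trig_approx (cube P) m g \<and> deriv_bound (cube P) m \<epsilon> (\<lambda>x. f x - g x)" by blast
  qed
qed

theorem trig_span_dense:
  fixes f :: "real ^ 'n::finite \<Rightarrow> complex"
  assumes "smooth f" "compact K" "\<epsilon> > 0"
  shows "\<exists>g\<in>trig_span. deriv_bound K m \<epsilon> (\<lambda>x. f x - g x)"
proof -
  obtain P where P: "P > 0" "\<And>x. x \<in> K \<Longrightarrow> norm x \<le> P"
    using compact_imp_bounded[OF assms(2)] by (auto simp: bounded_pos)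
  have "K \<subseteq> cube P" using P(2) component_le_norm_cart order_trans by blast
  moreover have "trig_approx (cube P) m f"
    by (rule smooth_trig_approx_cube[of UNIV]) (auto simp: assms P depends_on_def vec_eq_iff[symmetric])
  ultimately show ?thesis
    using assms(3) deriv_bound_mono[of "cube P" m \<epsilon> _ K m \<epsilon>] unfolding trig_approx_def by blast
qed

section \<open>Compactly supported distributions\<close>

lemma distribution_fourier_exp_char: "distribution_fourier u \<theta> = u (exp_char \<theta>)"
  by (simp add: distribution_fourier_def exp_char_def[abs_def])

lemma complex_eq_if_close:
  fixes y z :: complex
  assumes "\<And>\<epsilon>. \<epsilon> > 0 \<Longrightarrow> cmod (y - z) \<le> D * \<epsilon>"
  shows "y = z"
proof -
  have "cmod (y - z) \<le> 0 + \<epsilon>" if "\<epsilon> > 0" for \<epsilon>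
  proof -
    have "cmod (y - z) \<le> D * (\<epsilon> / (\<bar>D\<bar> + 1))" using that by (intro assms) simp
    also have "\<dots> \<le> (\<bar>D\<bar> + 1) * (\<epsilon> / (\<bar>D\<bar> + 1))" using that by (intro mult_right_mono) auto
    also have "\<dots> = \<epsilon>" by simp
    finally show ?thesis by simp
  qed
  then have "cmod (y - z) \<le> 0" by (rule field_le_epsilon)
  then show ?thesis by simp
qed

lemma iter_deriv_zero_on_open:
  assumes "smooth f" "open V" "\<And>x. x \<in> V \<Longrightarrow> f x = 0" "x \<in> V"
  shows "iter_deriv js f x = 0"
  using assms(4)
proof (induction js arbitrary: x)
  case (Cons j js)
  have "(iter_deriv js f has_derivative (\<lambda>_. 0)) (at x)"
    by (rule has_derivative_transform_within_open[OF has_derivative_const assms(2) Cons.prems]) (simp add: Cons.IH)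
  from has_derivative_partial_deriv[OF this, of j] show ?case by simp
qed (simp add: assms(3))

context
  fixes u :: "(real ^ 'n::{finite,linorder} \<Rightarrow> complex) \<Rightarrow> complex"
  assumes u: "u \<in> compact_distributions"
begin

lemma distribution_add: "smooth \<phi> \<Longrightarrow> smooth \<psi> \<Longrightarrow> u (\<lambda>x. \<phi> x + \<psi> x) = u \<phi> + u \<psi>"
  using u by (simp add: compact_distributions_def)

lemma distribution_cmult: "smooth \<phi> \<Longrightarrow> u (\<lambda>x. c * \<phi> x) = c * u \<phi>"
  using u by (simp add: compact_distributions_def)

lemma distribution_zero: "u (\<lambda>_. 0) = 0"
  using distribution_cmult[of "\<lambda>_. 0" 0] by simp

lemma distribution_diff:
  assumes "smooth \<phi>" "smooth \<psi>"
  shows "u (\<lambda>x. \<phi> x - \<psi> x) = u \<phi> - u \<psi>"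
  using distribution_add[OF assms(1) smooth_cmult[OF assms(2), of "-1"]] distribution_cmult[OF assms(2), of "-1"]
  by simp

lemma distribution_sum:
  "(\<And>i. i \<in> I \<Longrightarrow> smooth (\<phi> i)) \<Longrightarrow> u (\<lambda>x. \<Sum>i\<in>I. \<phi> i x) = (\<Sum>i\<in>I. u (\<phi> i))"
  by (induction I rule: infinite_finite_induct) (simp_all add: distribution_zero distribution_add smooth_sum)

text \<open>The number of multi-indices pays for the sum in the seminorm. The given constant may
  have either sign, so its absolute value is taken, and adding 1 makes the result positive.\<close>

lemma distribution_bound:
  "\<exists>K m D. compact K \<and> D > 0 \<and>
     (\<forall>\<phi> a. smooth \<phi> \<longrightarrow> deriv_bound K m a \<phi> \<longrightarrow> cmod (u \<phi>) \<le> D * a)"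
proof -
  obtain K m C where K: "compact K" "K \<noteq> {}"
    and C: "\<And>\<phi>. smooth \<phi> \<Longrightarrow> cmod (u \<phi>) \<le> C * smooth_seminorm K m \<phi>"
    using u unfolding compact_distributions_def by blast
  obtain x where x: "x \<in> K" using K(2) by blast
  let ?N = "real (card {\<alpha> :: 'n \<Rightarrow> nat. (\<Sum>j\<in>UNIV. \<alpha> j) \<le> m})"
  have "cmod (u \<phi>) \<le> (\<bar>C\<bar> * ?N + 1) * a" if sm: "smooth \<phi>" and a: "deriv_bound K m a \<phi>" for \<phi> a
  proof -
    have S0: "0 \<le> smooth_seminorm K m \<phi>"
      using deriv_boundD[OF deriv_bound_smooth_seminorm[OF sm K(1)], of "[]" m x] x
      by (auto intro: order_trans[OF norm_ge_zero])
    have a0: "0 \<le> a" using deriv_boundD[OF a, of "[]" x] x by (auto intro: order_trans[OF norm_ge_zero])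
    have "cmod (u \<phi>) \<le> C * smooth_seminorm K m \<phi>" by (rule C[OF sm])
    also have "\<dots> \<le> \<bar>C\<bar> * smooth_seminorm K m \<phi>" using S0 by (intro mult_right_mono) auto
    also have "\<dots> \<le> \<bar>C\<bar> * (?N * a)" by (intro mult_left_mono smooth_seminorm_le K(2) a) simp
    also have "\<dots> \<le> (\<bar>C\<bar> * ?N + 1) * a" using a0 by (simp add: algebra_simps)
    finally show ?thesis .
  qed
  then show ?thesis
    using K(1) by (intro exI[of _ K] exI[of _ m] exI[of _ "\<bar>C\<bar> * ?N + 1"]) (auto intro: add_nonneg_pos)
qed

end

text \<open>Agreement on characters extends to trigonometric sums by linearity and to smooth
  functions by density. The approximation is made on the union of the two compact sets and in the
  larger of the two orders, so that it is good for both functionals.\<close>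

lemma compact_distribution_eqI:
  fixes u v :: "(real ^ 'n::{finite,linorder} \<Rightarrow> complex) \<Rightarrow> complex"
  assumes u: "u \<in> compact_distributions" and v: "v \<in> compact_distributions"
    and eq: "\<And>\<theta>. u (exp_char \<theta>) = v (exp_char \<theta>)"
  shows "u = v"
proof (rule extensionalityI[of u "Collect smooth"])
  show "u \<in> extensional (Collect smooth)" "v \<in> extensional (Collect smooth)"
    using u v by (simp_all add: compact_distributions_def)
  fix \<phi> :: "(real, 'n) vec \<Rightarrow> complex" assume "\<phi> \<in> Collect smooth"
  then have sm: "smooth \<phi>" by simp
  have trig: "u g = v g" if "g \<in> trig_span" for g
    using that
  proof induction
    case (step g c \<theta>)
    then show ?case
      using distribution_add[OF u smooth_trig_span[OF step(1)] smooth_cmult[OF smooth_exp_char]]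
        distribution_add[OF v smooth_trig_span[OF step(1)] smooth_cmult[OF smooth_exp_char]]
        distribution_cmult[OF u smooth_exp_char] distribution_cmult[OF v smooth_exp_char]
      by (simp add: eq)
  qed (simp add: distribution_zero u v)
  obtain K m C where C0: "compact K" "C > 0"
    "\<forall>\<phi> a. smooth \<phi> \<longrightarrow> deriv_bound K m a \<phi> \<longrightarrow> cmod (u \<phi>) \<le> C * a"
    using distribution_bound[OF u] by blast
  note C = C0(1,2) C0(3)[rule_format]
  obtain L l D where D0: "compact L" "D > 0"
    "\<forall>\<phi> a. smooth \<phi> \<longrightarrow> deriv_bound L l a \<phi> \<longrightarrow> cmod (v \<phi>) \<le> D * a"
    using distribution_bound[OF v] by blast
  note D = D0(1,2) D0(3)[rule_format]
  show "u \<phi> = v \<phi>"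
  proof (rule complex_eq_if_close)
    fix \<epsilon> :: real assume "\<epsilon> > 0"
    then obtain g where g: "g \<in> trig_span" "deriv_bound (K \<union> L) (max m l) \<epsilon> (\<lambda>x. \<phi> x - g x)"
      using trig_span_dense[OF sm compact_Un[OF C(1) D(1)]] by blast
    note smg = smooth_trig_span[OF g(1)]
    have "u \<phi> - v \<phi> = u (\<lambda>x. \<phi> x - g x) - v (\<lambda>x. \<phi> x - g x)"
      by (simp add: distribution_diff u v sm smg trig[OF g(1)])
    also have "cmod \<dots> \<le> C * \<epsilon> + D * \<epsilon>"
      using deriv_bound_mono[OF g(2), of K m \<epsilon>] deriv_bound_mono[OF g(2), of L l \<epsilon>]
      by (intro order_trans[OF norm_triangle_ineq4] add_mono C D smooth_diff sm smg) auto
    finally show "cmod (u \<phi> - v \<phi>) \<le> (C + D) * \<epsilon>" by (simp add: distrib_right)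
  qed
qed

section \<open>Fourier transforms of compactly supported distributions\<close>

text \<open>The Fourier transform of the product of \<phi> and u. Differentiation in \<theta> merely
  replaces \<phi> by i x_j \<phi>, so these functions form a stable family; \<phi> = 1 gives the
  Fourier transform of u.\<close>

definition modulated :: "((real ^ 'n::finite \<Rightarrow> complex) \<Rightarrow> complex) \<Rightarrow> (real ^ 'n::finite \<Rightarrow> complex) \<Rightarrow>
    real ^ 'n::finite \<Rightarrow> complex" where
  "modulated u \<phi> \<theta> = u (\<lambda>x. \<phi> x * exp_char \<theta> x)"

context
  fixes u :: "(real ^ 'n::{finite,linorder} \<Rightarrow> complex) \<Rightarrow> complex"
  assumes u: "u \<in> compact_distributions"
begin

text \<open>The error is u applied to \<psi> times the second order remainder of exp(i h.x);
  continuity of u and the Leibniz bound make it of order |h|^2.\<close>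

lemma has_derivative_modulated:
  assumes sm: "smooth \<phi>"
  shows "(modulated u \<phi> has_derivative
    (\<lambda>h. \<Sum>j\<in>UNIV. complex_of_real (h $ j) * modulated u (\<lambda>x. \<i> * complex_of_real (x $ j) * \<phi> x) \<theta>)) (at \<theta>)"
proof -
  obtain K m D where D0: "compact K" "D > 0"
    "\<forall>\<phi> a. smooth \<phi> \<longrightarrow> deriv_bound K m a \<phi> \<longrightarrow> cmod (u \<phi>) \<le> D * a"
    using distribution_bound[OF u] by blast
  note D = D0(1,2) D0(3)[rule_format]
  obtain C where C: "C > 0" "\<And>h :: (real, 'n) vec. norm h \<le> 1 \<Longrightarrow>
    deriv_bound K m (C * (norm h)\<^sup>2) (\<lambda>x. exp_char h x - (1 + \<i> * complex_of_real (h \<bullet> x)))"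
    using exp_char_second_order[OF D(1)] by blast
  define \<psi> where "\<psi> x = \<phi> x * exp_char \<theta> x" for x
  have sm\<psi>: "smooth \<psi>" unfolding \<psi>_def[abs_def] by (intro smooth_mult sm smooth_exp_char)
  obtain b where b: "b > 0" "deriv_bound K m b \<psi>" using deriv_bound_exists[OF sm\<psi> D(1)] by blast
  let ?f' = "\<lambda>h. \<Sum>j\<in>UNIV. complex_of_real (h $ j) * modulated u (\<lambda>x. \<i> * complex_of_real (x $ j) * \<phi> x) \<theta>"
  have f': "?f' h = u (\<lambda>x. \<psi> x * (\<i> * complex_of_real (h \<bullet> x)))" for h
  proof -
    have eq: "\<psi> x * (\<i> * complex_of_real (h \<bullet> x)) =
        (\<Sum>j\<in>UNIV. complex_of_real (h $ j) * (\<i> * complex_of_real (x $ j) * \<phi> x * exp_char \<theta> x))" for x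
      by (simp add: inner_vec_def \<psi>_def sum_distrib_left mult_ac)
    have sm': "smooth (\<lambda>x. \<i> * complex_of_real (x $ j) * \<phi> x * exp_char \<theta> x)" for j
      by (intro smooth_mult smooth_const smooth_coord sm smooth_exp_char)
    show ?thesis
      unfolding eq modulated_def
      by (simp add: distribution_sum[OF u smooth_cmult[OF sm']] distribution_cmult[OF u sm'])
  qed
  have rem: "cmod (modulated u \<phi> (\<theta> + h) - modulated u \<phi> \<theta> - ?f' h) \<le> D * (2 ^ m * b * (C * (norm h)\<^sup>2))"
    if "norm h \<le> 1" for h
  proof -
    note sms = sm\<psi> smooth_linear_char smooth_exp_char smooth_const
    have "modulated u \<phi> (\<theta> + h) = u (\<lambda>x. \<psi> x * exp_char h x)" "modulated u \<phi> \<theta> = u \<psi>"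
      by (simp_all add: modulated_def \<psi>_def[abs_def] exp_char_add mult.assoc)
    then have "modulated u \<phi> (\<theta> + h) - modulated u \<phi> \<theta> - ?f' h =
        u (\<lambda>x. \<psi> x * exp_char h x - \<psi> x - \<psi> x * (\<i> * complex_of_real (h \<bullet> x)))"
      unfolding f' by (subst distribution_diff[OF u])
        (auto intro!: smooth_diff smooth_mult sms simp: distribution_diff[OF u] smooth_mult sms)
    also have "\<dots> = u (\<lambda>x. \<psi> x * (exp_char h x - (1 + \<i> * complex_of_real (h \<bullet> x))))"
      by (simp add: algebra_simps)
    also have "cmod \<dots> \<le> D * (2 ^ m * b * (C * (norm h)\<^sup>2))"
      by (intro D(3) deriv_bound_mult smooth_mult smooth_diff smooth_add sms b C(2) that)
    finally show ?thesis .
  qed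
  show ?thesis
    unfolding has_derivative_at
  proof (intro conjI)
    show "bounded_linear ?f'"
      by (intro bounded_linear_sum bounded_linear_compose[OF bounded_linear_mult_left]
          bounded_linear_compose[OF bounded_linear_of_real] bounded_linear_vec_nth)
    show "(\<lambda>h. cmod (modulated u \<phi> (\<theta> + h) - modulated u \<phi> \<theta> - ?f' h) / norm h) \<midarrow>0\<rightarrow> 0"
    proof (rule tendsto_sandwich[of "\<lambda>_. 0" _ _ "\<lambda>h. D * (2 ^ m * b * C) * norm h"])
      show "\<forall>\<^sub>F h in at 0. cmod (modulated u \<phi> (\<theta> + h) - modulated u \<phi> \<theta> - ?f' h) / norm h \<le> D * (2 ^ m * b * C) * norm h"
        unfolding eventually_at
      proof (intro exI[of _ 1] conjI ballI impI)
        fix h :: "(real, 'n) vec" assume "h \<noteq> 0 \<and> dist h 0 < 1"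
        then have "h \<noteq> 0" "norm h \<le> 1" by auto
        then show "cmod (modulated u \<phi> (\<theta> + h) - modulated u \<phi> \<theta> - ?f' h) / norm h \<le> D * (2 ^ m * b * C) * norm h"
          using rem[of h] by (simp add: divide_le_eq power2_eq_square mult_ac)
      qed simp
      show "((\<lambda>h. D * (2 ^ m * b * C) * norm h) \<longlongrightarrow> 0) (at 0)"
        by (intro tendsto_mult_right_zero tendsto_norm_zero tendsto_ident_at)
    qed auto
  qed
qed

lemma partial_deriv_modulated:
  "smooth \<phi> \<Longrightarrow> partial_deriv j (modulated u \<phi>) = modulated u (\<lambda>x. \<i> * complex_of_real (x $ j) * \<phi> x)"
proof
  fix \<theta> assume "smooth \<phi>"
  have "partial_deriv j (modulated u \<phi>) \<theta> =
      (\<Sum>i\<in>UNIV. if i = j then modulated u (\<lambda>x. \<i> * complex_of_real (x $ i) * \<phi> x) \<theta> else 0)"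
    unfolding has_derivative_partial_deriv[OF has_derivative_modulated[OF \<open>smooth \<phi>\<close>]]
    by (rule sum.cong) (auto simp: axis_def)
  then show "partial_deriv j (modulated u \<phi>) \<theta> = modulated u (\<lambda>x. \<i> * complex_of_real (x $ j) * \<phi> x) \<theta>"
    by simp
qed

lemma smooth_modulated:
  assumes "smooth \<phi>"
  shows "smooth (modulated u \<phi>)"
proof (rule smooth_coinduct[of _ "modulated u ` Collect smooth"])
  show "g differentiable (at x)" if "g \<in> modulated u ` Collect smooth" for g x
    using that has_derivative_modulated unfolding differentiable_def by blast
  have "smooth (\<lambda>x. \<i> * complex_of_real (x $ j) * \<phi> x)" if "smooth \<phi>" for j \<phi>
    by (intro smooth_mult smooth_const smooth_coord that)
  then show "partial_deriv j g \<in> modulated u ` Collect smooth" if "g \<in> modulated u ` Collect smooth" for g j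
    using that by (force simp: partial_deriv_modulated)
qed (use assms in simp)

lemma iter_deriv_modulated:
  assumes "smooth \<phi>"
  shows "iter_deriv js (modulated u \<phi>) = modulated u (\<lambda>x. (\<Prod>j\<leftarrow>js. \<i> * complex_of_real (x $ j)) * \<phi> x)"
proof (induction js)
  case (Cons j js)
  have "smooth (\<lambda>x. (\<Prod>j\<leftarrow>js. \<i> * complex_of_real (x $ j)))"
    by (induction js) (auto intro!: smooth_mult[of "\<lambda>x. _ * complex_of_real (x $ _)"] smooth_cmult smooth_coord)
  then show ?case
    by (simp add: Cons partial_deriv_modulated smooth_mult assms mult.assoc)
qed simp

lemma fourier_eq_modulated: "u (exp_char \<theta>) = modulated u (\<lambda>_. 1) \<theta>"
proof -
  have "exp_char \<theta> = (\<lambda>x. exp_char \<theta> x)" ..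
  then show ?thesis by (simp add: modulated_def)
qed

lemma smooth_fourier: "smooth (\<lambda>\<theta>. u (exp_char \<theta>))"
  unfolding fourier_eq_modulated by (rule smooth_modulated) simp

lemma distribution_moments:
  "u (\<lambda>x. complex_of_real (\<Prod>j\<in>UNIV. (x $ j) ^ \<alpha> j)) =
     1 / \<i> ^ (\<Sum>j\<in>UNIV. \<alpha> j) * multi_deriv \<alpha> (\<lambda>\<theta>. u (exp_char \<theta>)) 0"
proof -
  have list: "(\<Prod>j\<leftarrow>multi_list \<alpha>. f j) = (\<Prod>j\<in>UNIV. f j ^ \<alpha> j)" for f :: "'n \<Rightarrow> complex"
  proof -
    have "(\<Prod>j\<leftarrow>concat (map (\<lambda>j. replicate (\<alpha> j) j) js). f j) = (\<Prod>j\<leftarrow>js. f j ^ \<alpha> j)" for js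
      by (induction js) (simp_all add: prod_list_replicate)
    then show ?thesis by (simp add: prod.distinct_set_conv_list[symmetric])
  qed
  have "multi_deriv \<alpha> (\<lambda>\<theta>. u (exp_char \<theta>)) 0 = u (\<lambda>x. \<Prod>j\<in>UNIV. (\<i> * complex_of_real (x $ j)) ^ \<alpha> j)"
    unfolding fourier_eq_modulated multi_deriv_eq_iter_deriv
    by (subst iter_deriv_modulated) (simp_all add: modulated_def list)
  also have "\<dots> = u (\<lambda>x. \<i> ^ (\<Sum>j\<in>UNIV. \<alpha> j) * complex_of_real (\<Prod>j\<in>UNIV. (x $ j) ^ \<alpha> j))"
    by (simp add: power_mult_distrib prod.distrib power_sum)
  also have "\<dots> = \<i> ^ (\<Sum>j\<in>UNIV. \<alpha> j) * u (\<lambda>x. complex_of_real (\<Prod>j\<in>UNIV. (x $ j) ^ \<alpha> j))"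
  proof (rule distribution_cmult[OF u])
    show "smooth (\<lambda>x. complex_of_real (\<Prod>j\<in>UNIV. (x $ j) ^ \<alpha> j))"
      unfolding of_real_prod of_real_power by (intro smooth_prod smooth_power smooth_coord)
  qed
  finally show ?thesis by simp
qed

section \<open>Reality and non-negativity in terms of the Fourier transform\<close>

lemma conj_distribution:
  defines "v \<equiv> (\<lambda>\<phi>. if smooth \<phi> then cnj (u (\<lambda>x. cnj (\<phi> x))) else undefined)"
  shows "v \<in> compact_distributions"
  unfolding compact_distributions_def mem_Collect_eq
proof (intro conjI allI impI)
  show "v \<in> extensional {\<phi>. smooth \<phi>}" by (auto simp: extensional_def v_def)
  show "v (\<lambda>x. \<phi> x + \<psi> x) = v \<phi> + v \<psi>" if "smooth \<phi>" "smooth \<psi>" for \<phi> \<psi>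
    using that by (simp add: v_def smooth_add smooth_cnj distribution_add[OF u])
  show "v (\<lambda>x. c * \<phi> x) = c * v \<phi>" if "smooth \<phi>" for c \<phi>
    using that by (simp add: v_def smooth_cmult smooth_cnj distribution_cmult[OF u])
  obtain K m C where K: "compact K" "K \<noteq> {}"
    and C: "\<And>\<phi>. smooth \<phi> \<Longrightarrow> cmod (u \<phi>) \<le> C * smooth_seminorm K m \<phi>"
    using u unfolding compact_distributions_def by blast
  have "cmod (v \<phi>) \<le> C * smooth_seminorm K m \<phi>" if "smooth \<phi>" for \<phi>
    using C[OF smooth_cnj[OF that]] that
    by (simp add: v_def smooth_seminorm_def multi_deriv_eq_iter_deriv iter_deriv_cnj)
  then show "\<exists>K m C. compact K \<and> K \<noteq> {} \<and> (\<forall>\<phi>. smooth \<phi> \<longrightarrow> cmod (v \<phi>) \<le> C * smooth_seminorm K m \<phi>)"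
    using K by blast
qed

text \<open>Reality gives real values on cosines and sines, hence the symmetry. Conversely, the
  Fourier transform of the conjugate distribution at \<theta> is the conjugate of that of u at
  -\<theta>; under the symmetry the two transforms agree, and uniqueness makes the distributions
  equal.\<close>

lemma real_distribution_iff:
  "real_distribution u \<longleftrightarrow> (\<forall>\<theta>. u (exp_char (- \<theta>)) = cnj (u (exp_char \<theta>)))"
proof
  assume real: "real_distribution u"
  show "\<forall>\<theta>. u (exp_char (- \<theta>)) = cnj (u (exp_char \<theta>))"
  proof
    fix \<theta>
    let ?c = "\<lambda>x :: (real, 'n) vec. (1/2) * (exp_char \<theta> x + exp_char (- \<theta>) x)" and ?s = "\<lambda>x :: (real, 'n) vec. (1/(2*\<i>)) * (exp_char \<theta> x - exp_char (- \<theta>) x)"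
    have sm: "smooth ?c" "smooth ?s" "smooth (\<lambda>x. \<i> * ?s x)"
      by (intro smooth_cmult smooth_add smooth_diff smooth_exp_char)+
    have "cnj (?c x) = ?c x" "cnj (?s x) = ?s x" for x
      by (simp_all add: cnj_exp_char add.commute divide_simps algebra_simps)
    then have "u ?c \<in> \<real>" "u ?s \<in> \<real>"
      using real sm unfolding real_distribution_def by (simp_all add: Reals_cnj_iff)
    moreover have "u (exp_char \<theta>) = u ?c + \<i> * u ?s"
    proof -
      have "exp_char \<theta> = (\<lambda>x. ?c x + \<i> * ?s x)" by (rule ext) (simp add: field_simps)
      then have "u (exp_char \<theta>) = u (\<lambda>x. ?c x + \<i> * ?s x)" by (rule arg_cong)
      also have "\<dots> = u ?c + \<i> * u ?s"
        unfolding distribution_add[OF u sm(1,3)] distribution_cmult[OF u sm(2)] ..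
      finally show ?thesis .
    qed
    moreover have "u (exp_char (- \<theta>)) = u ?c - \<i> * u ?s"
    proof -
      have "exp_char (- \<theta>) = (\<lambda>x. ?c x - \<i> * ?s x)" by (rule ext) (simp add: field_simps)
      then have "u (exp_char (- \<theta>)) = u (\<lambda>x. ?c x - \<i> * ?s x)" by (rule arg_cong)
      also have "\<dots> = u ?c - \<i> * u ?s"
        unfolding distribution_diff[OF u sm(1,3)] distribution_cmult[OF u sm(2)] ..
      finally show ?thesis .
    qed
    ultimately show "u (exp_char (- \<theta>)) = cnj (u (exp_char \<theta>))" by (simp add: Reals_cnj_iff)
  qed
next
  assume herm: "\<forall>\<theta>. u (exp_char (- \<theta>)) = cnj (u (exp_char \<theta>))"
  let ?v = "\<lambda>\<phi>. if smooth \<phi> then cnj (u (\<lambda>x. cnj (\<phi> x))) else undefined"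
  have "?v (exp_char \<theta>) = u (exp_char \<theta>)" for \<theta>
  proof -
    have "(\<lambda>x. cnj (exp_char \<theta> x)) = exp_char (- \<theta>)" by (rule ext) (simp add: cnj_exp_char)
    then show ?thesis using herm by simp
  qed
  then have "?v = u" by (intro compact_distribution_eqI conj_distribution u)
  show "real_distribution u"
    unfolding real_distribution_def
  proof (intro allI impI)
    fix \<phi> :: "(real, 'n) vec \<Rightarrow> complex" assume \<phi>: "smooth \<phi> \<and> (\<forall>x. \<phi> x \<in> \<real>)"
    then have "(\<lambda>x. cnj (\<phi> x)) = \<phi>" by (auto simp: Reals_cnj_iff)
    then have "?v \<phi> = cnj (u \<phi>)" using \<phi> by simp
    then have "cnj (u \<phi>) = u \<phi>" using fun_cong[OF \<open>?v = u\<close>, of \<phi>] by (simp only:)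
    then show "u \<phi> \<in> \<real>" by (simp add: Reals_cnj_iff)
  qed
qed

text \<open>Links positive definiteness with the values of u on squared moduli, since one character
  times the conjugate of another is the character of the difference.\<close>

lemma distribution_trig_square:
  "u (\<lambda>x. (\<Sum>j<n. c j * exp_char (t j) x) * cnj (\<Sum>j<n. c j * exp_char (t j) x)) =
     (\<Sum>j<n. \<Sum>k<n. c j * cnj (c k) * u (exp_char (t j - t k)))"
proof -
  have eq: "(\<Sum>j<n. c j * exp_char (t j) x) * cnj (\<Sum>j<n. c j * exp_char (t j) x) =
      (\<Sum>j<n. \<Sum>k<n. c j * cnj (c k) * exp_char (t j - t k) x)" for x
    using exp_char_add[of _ "- _" x]
    by (simp add: sum_product cnj_exp_char diff_conv_add_uminus mult_ac del: add_uminus_conv_diff)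
  have sm: "smooth (\<lambda>x. c j * cnj (c k) * exp_char (t j - t k) x)" for j k
    by (intro smooth_cmult smooth_exp_char)
  show ?thesis
    unfolding eq
    by (simp add: distribution_sum[OF u] smooth_sum sm distribution_cmult[OF u])
qed

lemma nonneg_distribution_iff:
  "nonneg_distribution u \<longleftrightarrow> positive_definite_fun (\<lambda>\<theta>. u (exp_char \<theta>))"
proof
  assume nn: "nonneg_distribution u"
  show "positive_definite_fun (\<lambda>\<theta>. u (exp_char \<theta>))"
    unfolding positive_definite_fun_def
  proof (intro conjI allI)
    show "continuous_on UNIV (\<lambda>\<theta>. u (exp_char \<theta>))" by (rule smooth_continuous[OF smooth_fourier])
    fix m :: nat and t :: "nat \<Rightarrow> (real, 'n) vec" and c :: "nat \<Rightarrow> complex"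
    let ?f = "\<lambda>x. \<Sum>j<m. c j * exp_char (t j) x"
    have "smooth ?f" by (intro smooth_sum smooth_cmult smooth_exp_char)
    then have "smooth (\<lambda>x. ?f x * cnj (?f x))" by (intro smooth_mult smooth_cnj)
    moreover have "?f x * cnj (?f x) \<in> \<real>\<^sub>\<ge>\<^sub>0" for x
      by (simp only: complex_norm_square[symmetric] nonneg_Reals_of_real_iff) simp
    ultimately have "u (\<lambda>x. ?f x * cnj (?f x)) \<in> \<real>\<^sub>\<ge>\<^sub>0"
      using nn unfolding nonneg_distribution_def by blast
    then show "(\<Sum>j<m. \<Sum>k<m. c j * cnj (c k) * u (exp_char (t j - t k))) \<in> \<real>\<^sub>\<ge>\<^sub>0"
      unfolding distribution_trig_square .
  qed
next
  assume pd: "positive_definite_fun (\<lambda>\<theta>. u (exp_char \<theta>))"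
  obtain K m D where D0: "compact K" "D > 0"
    "\<forall>\<phi> a. smooth \<phi> \<longrightarrow> deriv_bound K m a \<phi> \<longrightarrow> cmod (u \<phi>) \<le> D * a"
    using distribution_bound[OF u] by blast
  note D = D0(1,2) D0(3)[rule_format]
  have trig: "u (\<lambda>x. f x * cnj (f x)) \<in> \<real>\<^sub>\<ge>\<^sub>0" if trig: "f \<in> trig_span" for f
  proof -
    obtain n :: nat and c t where f: "f = (\<lambda>x. \<Sum>a<n. c a * exp_char (t a) x)"
      using trig_span_repr[OF trig] by blast
    show ?thesis
      unfolding f distribution_trig_square using pd unfolding positive_definite_fun_def by blast
  qed
  have square: "u (\<lambda>x. \<psi> x * cnj (\<psi> x)) \<in> \<real>\<^sub>\<ge>\<^sub>0" if sm: "smooth \<psi>" for \<psi>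
  proof -
    obtain b where b: "b > 0" "deriv_bound K m b \<psi>" using deriv_bound_exists[OF sm D(1)] by blast
    have cnj: "deriv_bound K m a (\<lambda>x. cnj (f x))" if "smooth f" "deriv_bound K m a f" for f a
      using that by (simp add: deriv_bound_def iter_deriv_cnj)
    have "\<exists>z\<in>\<real>\<^sub>\<ge>\<^sub>0. dist z (u (\<lambda>x. \<psi> x * cnj (\<psi> x))) < \<epsilon>" if "\<epsilon> > 0" for \<epsilon>
    proof -
      \<comment> \<open>The error found below is D 2^m (2 b + \<delta>) \<delta>; since \<delta>
        \<le> 1, the inner \<delta> may be replaced by 1.\<close>
      define B where "B = D * (2 ^ m * (2 * b + 1))"
      have B: "B > 0" using D b by (simp add: B_def)
      define \<delta> where "\<delta> = min 1 (\<epsilon> / (2 * B))"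
      have \<delta>: "\<delta> > 0" "\<delta> \<le> 1" "B * \<delta> < \<epsilon>"
        using B \<open>\<epsilon> > 0\<close> by (auto simp: \<delta>_def min_def field_simps)
      obtain f where f: "f \<in> trig_span" "deriv_bound K m \<delta> (\<lambda>x. \<psi> x - f x)"
        using trig_span_dense[OF sm D(1) \<delta>(1)] by blast
      note smf = smooth_trig_span[OF f(1)]
      note sms = sm smf smooth_cnj smooth_diff smooth_mult
      have bf: "deriv_bound K m (b + \<delta>) f"
        using deriv_bound_diff[OF sm smooth_diff[OF sm smf] b(2) f(2)] by simp
      have "u (\<lambda>x. \<psi> x * cnj (\<psi> x)) - u (\<lambda>x. f x * cnj (f x)) = u (\<lambda>x. \<psi> x * cnj (\<psi> x) - f x * cnj (f x))"
        by (simp add: distribution_diff[OF u] sms)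
      also have "(\<lambda>x. \<psi> x * cnj (\<psi> x) - f x * cnj (f x)) = (\<lambda>x. (\<psi> x - f x) * cnj (\<psi> x) + f x * cnj (\<psi> x - f x))"
        by (simp add: algebra_simps)
      also have "cmod (u (\<lambda>x. (\<psi> x - f x) * cnj (\<psi> x) + f x * cnj (\<psi> x - f x))) \<le>
          D * (2 ^ m * \<delta> * b + 2 ^ m * (b + \<delta>) * \<delta>)"
        by (intro D(3) deriv_bound_add deriv_bound_mult cnj smooth_add smooth_mult smooth_cnj smooth_diff sm smf f b bf)
      also have "\<dots> = D * (2 ^ m * (2 * b + \<delta>)) * \<delta>" by (simp add: algebra_simps)
      also have "\<dots> \<le> B * \<delta>"
        unfolding B_def using \<delta> D(2) by (intro mult_right_mono mult_left_mono) auto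
      also have "\<dots> < \<epsilon>" by (rule \<delta>(3))
      finally show ?thesis
        using trig[OF f(1)] by (intro bexI[of _ "u (\<lambda>x. f x * cnj (f x))"]) (simp_all add: dist_norm norm_minus_commute)
    qed
    then have "u (\<lambda>x. \<psi> x * cnj (\<psi> x)) \<in> closure \<real>\<^sub>\<ge>\<^sub>0" unfolding closure_approachable by blast
    then show ?thesis by (simp add: closure_closed closed_nonneg_Reals_complex)
  qed
  show "nonneg_distribution u"
    unfolding nonneg_distribution_def
  proof (intro allI impI, elim conjE)
    fix \<phi> :: "(real, 'n) vec \<Rightarrow> complex" assume sm: "smooth \<phi>" and nn: "\<forall>x. \<phi> x \<in> \<real>\<^sub>\<ge>\<^sub>0"
    define p where "p x = Re (\<phi> x)" for x
    have p: "\<phi> x = complex_of_real (p x)" "p x \<ge> 0" for x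
      using nn[rule_format, of x] by (auto simp: p_def complex_nonneg_Reals_iff complex_eq_iff)
    have "u \<phi> + complex_of_real \<epsilon> * u (\<lambda>_. 1) \<in> \<real>\<^sub>\<ge>\<^sub>0" if "\<epsilon> > 0" for \<epsilon>
    proof -
      \<comment> \<open>The shift by \<epsilon> keeps the root smooth where \<phi> vanishes. It is
        removed at the end by a limit, the non-negative reals being closed.\<close>
      let ?\<psi> = "\<lambda>x. complex_of_real (sqrt (p x + \<epsilon>))"
      have "smooth (\<lambda>x. \<phi> x + complex_of_real \<epsilon>)" by (intro smooth_add sm smooth_const)
      then have "smooth ?\<psi>"
        by (rule smooth_sqrt) (use p that in \<open>auto intro: add_nonneg_pos\<close>)
      moreover have "?\<psi> x * cnj (?\<psi> x) = \<phi> x + complex_of_real \<epsilon> * 1" for x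
        using p[of x] that by (simp add: of_real_mult[symmetric] del: of_real_mult)
      ultimately have "u (\<lambda>x. \<phi> x + complex_of_real \<epsilon> * 1) \<in> \<real>\<^sub>\<ge>\<^sub>0"
        using square[of ?\<psi>] by (simp only:)
      then show ?thesis
        using distribution_add[OF u sm smooth_cmult[OF smooth_const]] distribution_cmult[OF u smooth_const, of "of_real \<epsilon>" 1]
        by metis
    qed
    then have ev: "\<forall>\<^sub>F \<epsilon> in at_right 0. u \<phi> + complex_of_real \<epsilon> * u (\<lambda>_. 1) \<in> \<real>\<^sub>\<ge>\<^sub>0"
      by (auto simp: eventually_at_right_less intro: eventually_mono[OF eventually_at_right_less])
    have "((\<lambda>\<epsilon>. u \<phi> + complex_of_real \<epsilon> * u (\<lambda>_. 1)) \<longlongrightarrow> u \<phi> + complex_of_real 0 * u (\<lambda>_. 1)) (at_right 0)"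
      by (intro tendsto_intros)
    from Lim_in_closed_set[OF closed_nonneg_Reals_complex ev _ this]
    show "u \<phi> \<in> \<real>\<^sub>\<ge>\<^sub>0" by simp
  qed
qed

text \<open>A function supported off B vanishes on B with all its derivatives, so the bound applies
  with a = 0 and u annihilates the open complement of B.\<close>

lemma distribution_support_subset:
  assumes B: "compact B" and bd: "\<And>\<phi> a. smooth \<phi> \<Longrightarrow> deriv_bound B m a \<phi> \<Longrightarrow> cmod (u \<phi>) \<le> D * a"
  shows "distribution_support u \<subseteq> B"
proof -
  have "u \<phi> = 0" if "smooth \<phi>" "closure {x. \<phi> x \<noteq> 0} \<subseteq> - B" for \<phi>
  proof -
    have "iter_deriv js \<phi> x = 0" if "x \<in> B" for js x
    proof (rule iter_deriv_zero_on_open[of \<phi> "- closure {x. \<phi> x \<noteq> 0}"])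
      show "\<And>x. x \<in> - closure {x. \<phi> x \<noteq> 0} \<Longrightarrow> \<phi> x = 0" using closure_subset[of "{x. \<phi> x \<noteq> 0}"] by blast
    qed (use that \<open>closure _ \<subseteq> _\<close> \<open>smooth \<phi>\<close> in auto)
    then have "deriv_bound B m 0 \<phi>" by (simp add: deriv_bound_def)
    then show ?thesis using bd[OF that(1), of 0] by simp
  qed
  moreover have "open (- B)" using B compact_imp_closed by blast
  ultimately show ?thesis unfolding distribution_support_def by blast
qed

end

section \<open>Extension from trigonometric sums\<close>

text \<open>Values of the linear extension of g, attached to a particular way of building the
  trigonometric sum. Independence of the way is not derived from linear independence of characters;
  the boundedness assumption below forces it.\<close>

inductive trig_val :: "(real ^ 'n::finite \<Rightarrow> complex) \<Rightarrow> (real ^ 'n::finite \<Rightarrow> complex) \<Rightarrow> complex \<Rightarrow> bool" for g where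
  zero: "trig_val g (\<lambda>_. 0) 0"
| step: "trig_val g f z \<Longrightarrow> trig_val g (\<lambda>x. f x + c * exp_char \<theta> x) (z + c * g \<theta>)"

lemma trig_val_exists: "f \<in> trig_span \<Longrightarrow> \<exists>z. trig_val g f z"
  by (induction rule: trig_span.induct) (blast intro: trig_val.intros)+

lemma trig_val_trig_span: "trig_val g f z \<Longrightarrow> f \<in> trig_span"
  by (induction rule: trig_val.induct) (auto intro: trig_span.intros)

lemma trig_val_exp_char: "trig_val g (exp_char \<theta>) (g \<theta>)"
  using trig_val.step[OF trig_val.zero, of g 1 \<theta>] by (simp add: exp_char_def[abs_def])

lemma trig_val_add:
  assumes "trig_val g f z" "trig_val g h y"
  shows "trig_val g (\<lambda>x. f x + h x) (z + y)"
  using assms(2)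
proof induction
  case (step h y c \<theta>)
  then show ?case using trig_val.step[OF step.IH, of c \<theta>] by (simp add: add.assoc)
qed (use assms(1) in simp)

lemma trig_val_cmult: "trig_val g f z \<Longrightarrow> trig_val g (\<lambda>x. d * f x) (d * z)"
proof (induction rule: trig_val.induct)
  case (step f z c \<theta>)
  then show ?case using trig_val.step[OF step.IH, of "d * c" \<theta>] by (simp add: distrib_left mult.assoc)
qed (simp add: trig_val.zero)

lemma trig_val_repr:
  assumes "trig_val g f z"
  shows "\<exists>(n :: nat) c \<theta>. f = (\<lambda>x. \<Sum>a<n. c a * exp_char (\<theta> a) x) \<and> z = (\<Sum>a<n. c a * g (\<theta> a))"
  using assms
proof (induction rule: trig_val.induct)
  case zero
  show ?case by (rule exI[of _ 0]) simp
next
  case (step f z d \<eta>)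
  then obtain n :: nat and c \<theta> where f: "f = (\<lambda>x. \<Sum>a<n. c a * exp_char (\<theta> a) x)" "z = (\<Sum>a<n. c a * g (\<theta> a))" by blast
  show ?case
    by (rule exI[of _ "Suc n"], rule exI[of _ "c(n := d)"], rule exI[of _ "\<theta>(n := \<eta>)"]) (simp add: f)
qed

theorem distribution_of_bounded_functional:
  fixes g :: "real ^ 'n::{finite,linorder} \<Rightarrow> complex"
  assumes B: "compact B" "B \<noteq> {}"
    and bd: "\<And>(n :: nat) c \<theta> M. deriv_bound B m M (\<lambda>x. \<Sum>a<n. c a * exp_char (\<theta> a) x) \<Longrightarrow>
       cmod (\<Sum>a<n. c a * g (\<theta> a)) \<le> C * M"
  shows "\<exists>u D. u \<in> compact_distributions \<and> (\<forall>\<theta>. u (exp_char \<theta>) = g \<theta>) \<and>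
     (\<forall>\<phi> a. smooth \<phi> \<longrightarrow> deriv_bound B m a \<phi> \<longrightarrow> cmod (u \<phi>) \<le> D * a)"
proof -
  define D where "D = \<bar>C\<bar>"
  have D0: "D \<ge> 0" by (simp add: D_def)
  have val: "cmod z \<le> D * a" if f: "trig_val g f z" "deriv_bound B m a f" for f z a
  proof -
    obtain x where "x \<in> B" using B(2) by blast
    then have a0: "0 \<le> a" using deriv_boundD[OF f(2), of "[]" x] by (auto intro: order_trans[OF norm_ge_zero])
    obtain n :: nat and c \<theta> where r: "f = (\<lambda>x. \<Sum>a<n. c a * exp_char (\<theta> a) x)" "z = (\<Sum>a<n. c a * g (\<theta> a))"
      using trig_val_repr[OF f(1)] by blast
    have "cmod z \<le> C * a" unfolding r(2) by (rule bd) (use f(2) r(1) in simp)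
    also have "\<dots> \<le> D * a" unfolding D_def using a0 by (intro mult_right_mono) auto
    finally show ?thesis .
  qed
  have val_diff: "cmod (z - y) \<le> D * (a + b)"
    if "smooth \<phi>" "trig_val g f z" "trig_val g h y" "deriv_bound B m a (\<lambda>x. \<phi> x - f x)" "deriv_bound B m b (\<lambda>x. \<phi> x - h x)"
    for \<phi> f h z y a b
  proof -
    note sm = that(1) trig_val_trig_span[OF that(2), THEN smooth_trig_span] trig_val_trig_span[OF that(3), THEN smooth_trig_span]
    have "trig_val g (\<lambda>x. f x + (-1) * h x) (z + (-1) * y)"
      by (intro trig_val_add trig_val_cmult that)
    moreover have "deriv_bound B m (b + a) (\<lambda>x. (\<phi> x - h x) - (\<phi> x - f x))"
      by (intro deriv_bound_diff smooth_diff sm that)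
    ultimately show ?thesis using val[of "\<lambda>x. f x + (-1) * h x" "z + (-1) * y" "b + a"] by (simp add: add.commute)
  qed
  \<comment> \<open>All estimates are required at once: z lies within D a of the value of every
    trigonometric sum that is a-close to \<phi>. By density this determines z, and additivity and
    homogeneity become triangle inequalities.\<close>
  define is_val where "is_val \<phi> z \<longleftrightarrow> (\<forall>f y a. trig_val g f y \<longrightarrow> deriv_bound B m a (\<lambda>x. \<phi> x - f x) \<longrightarrow> cmod (z - y) \<le> D * a)" for \<phi> z
  have is_valD: "cmod (z - y) \<le> D * a" if "is_val \<phi> z" "trig_val g f y" "deriv_bound B m a (\<lambda>x. \<phi> x - f x)" for \<phi> z f y a
    using that unfolding is_val_def by blast
  have approx: "\<exists>f y. trig_val g f y \<and> deriv_bound B m \<epsilon> (\<lambda>x. \<phi> x - f x)" if "smooth \<phi>" "\<epsilon> > 0" for \<phi> \<epsilon>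
    using trig_span_dense[OF that(1) B(1) that(2)] trig_val_exists by blast
  have ex: "\<exists>z. is_val \<phi> z" if sm: "smooth \<phi>" for \<phi>
  proof -
    define \<delta> :: "nat \<Rightarrow> real" where "\<delta> i = 1 / real (Suc i)" for i
    have \<delta>: "\<delta> i > 0" for i by (simp add: \<delta>_def)
    have \<delta>_lim: "\<delta> \<longlonglongrightarrow> 0" unfolding \<delta>_def[abs_def] by (rule LIMSEQ_Suc[OF lim_1_over_n])
    have "\<forall>i. \<exists>f y. trig_val g f y \<and> deriv_bound B m (\<delta> i) (\<lambda>x. \<phi> x - f x)" using approx[OF sm \<delta>] by blast
    then obtain f y where fy: "\<And>i. trig_val g (f i) (y i)" "\<And>i. deriv_bound B m (\<delta> i) (\<lambda>x. \<phi> x - f i x)" by metis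
    \<comment> \<open>The values of two approximants of \<phi> differ by at most D times the sum of
      their accuracies; \<open>D + 1\<close> allows division when D = 0.\<close>
    have "Cauchy y"
    proof (rule metric_CauchyI)
      fix e :: real assume "e > 0"
      then have "e / (2 * (D + 1)) > 0" using D0 by simp
      with \<delta>_lim have "\<forall>\<^sub>F i in sequentially. \<delta> i < e / (2 * (D + 1))" by (rule order_tendstoD(2))
      then obtain M where M: "\<And>i. i \<ge> M \<Longrightarrow> \<delta> i < e / (2 * (D + 1))"
        unfolding eventually_sequentially by blast
      have "dist (y i) (y j) < e" if "i \<ge> M" "j \<ge> M" for i j
      proof -
        have "dist (y i) (y j) \<le> D * (\<delta> i + \<delta> j)"
          unfolding dist_norm by (rule val_diff[OF sm fy(1) fy(1) fy(2) fy(2)])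
        also have "\<dots> \<le> (D + 1) * (\<delta> i + \<delta> j)" using \<delta>[of i] \<delta>[of j] by (intro mult_right_mono) auto
        also have "\<dots> < (D + 1) * (e / (2 * (D + 1)) + e / (2 * (D + 1)))"
          using M[OF that(1)] M[OF that(2)] D0 by (intro mult_strict_left_mono add_strict_mono) auto
        also have "\<dots> = e"
        proof -
          have "(D + 1) * (e / (2 * (D + 1))) = e / 2" using D0 by (simp add: divide_simps)
          then show ?thesis by (simp only: distrib_left[of "D + 1"] field_sum_of_halves)
        qed
        finally show ?thesis .
      qed
      then show "\<exists>M. \<forall>i\<ge>M. \<forall>j\<ge>M. dist (y i) (y j) < e" by blast
    qed
    then obtain z where z: "y \<longlonglongrightarrow> z" using Cauchy_convergent_iff convergent_def by blast
    have "is_val \<phi> z"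
      unfolding is_val_def
    proof (intro allI impI)
      fix h w a assume h: "trig_val g h w" "deriv_bound B m a (\<lambda>x. \<phi> x - h x)"
      have "(\<lambda>i. cmod (y i - w)) \<longlonglongrightarrow> cmod (z - w)" by (intro tendsto_intros z)
      moreover have "(\<lambda>i. D * (\<delta> i + a)) \<longlonglongrightarrow> D * (0 + a)" by (intro tendsto_intros \<delta>_lim)
      moreover have "cmod (y i - w) \<le> D * (\<delta> i + a)" for i by (rule val_diff[OF sm fy(1) h(1) fy(2) h(2)])
      ultimately have "cmod (z - w) \<le> D * (0 + a)" by (intro LIMSEQ_le) auto
      then show "cmod (z - w) \<le> D * a" by simp
    qed
    then show ?thesis by blast
  qed
  define u where "u \<phi> = (if smooth \<phi> then SOME z. is_val \<phi> z else undefined)" for \<phi>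
  have u_val: "is_val \<phi> (u \<phi>)" if "smooth \<phi>" for \<phi>
    using someI_ex[OF ex[OF that]] that by (simp add: u_def)
  have u_le: "cmod (u \<phi>) \<le> D * a" if "smooth \<phi>" "deriv_bound B m a \<phi>" for \<phi> a
    using is_valD[OF u_val[OF that(1)] trig_val.zero, of a] that(2) by simp
  \<comment> \<open>A character approximates itself with error 0, so its value is exact.\<close>
  have u_exp: "u (exp_char \<theta>) = g \<theta>" for \<theta>
    using is_valD[OF u_val[OF smooth_exp_char] trig_val_exp_char, of 0 \<theta>]
    by (simp add: deriv_bound_def iter_deriv_zero)
  have "u \<in> compact_distributions"
    unfolding compact_distributions_def mem_Collect_eq
  proof (intro conjI allI impI)
    show "u \<in> extensional {\<phi>. smooth \<phi>}" by (auto simp: extensional_def u_def)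
    show "u (\<lambda>x. \<phi> x + \<psi> x) = u \<phi> + u \<psi>" if sm: "smooth \<phi>" "smooth \<psi>" for \<phi> \<psi>
    proof (rule complex_eq_if_close)
      fix \<epsilon> :: real assume "\<epsilon> > 0"
      obtain f y where f: "trig_val g f y" "deriv_bound B m \<epsilon> (\<lambda>x. \<phi> x - f x)" using approx[OF sm(1) \<open>\<epsilon> > 0\<close>] by blast
      obtain h w where h: "trig_val g h w" "deriv_bound B m \<epsilon> (\<lambda>x. \<psi> x - h x)" using approx[OF sm(2) \<open>\<epsilon> > 0\<close>] by blast
      note sms = sm trig_val_trig_span[OF f(1), THEN smooth_trig_span] trig_val_trig_span[OF h(1), THEN smooth_trig_span]
      have "deriv_bound B m (\<epsilon> + \<epsilon>) (\<lambda>x. (\<phi> x - f x) + (\<psi> x - h x))"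
        by (intro deriv_bound_add smooth_diff sms f h)
      then have "deriv_bound B m (\<epsilon> + \<epsilon>) (\<lambda>x. (\<phi> x + \<psi> x) - (f x + h x))" by (simp add: algebra_simps)
      then have "cmod (u (\<lambda>x. \<phi> x + \<psi> x) - (y + w)) \<le> D * (\<epsilon> + \<epsilon>)"
        by (rule is_valD[OF u_val[OF smooth_add[OF sm]] trig_val_add[OF f(1) h(1)]])
      moreover have "cmod (u \<phi> - y) \<le> D * \<epsilon>" by (rule is_valD[OF u_val[OF sm(1)] f])
      moreover have "cmod (u \<psi> - w) \<le> D * \<epsilon>" by (rule is_valD[OF u_val[OF sm(2)] h])
      moreover have "u (\<lambda>x. \<phi> x + \<psi> x) - (u \<phi> + u \<psi>) = (u (\<lambda>x. \<phi> x + \<psi> x) - (y + w)) - ((u \<phi> - y) + (u \<psi> - w))"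
        by simp
      ultimately have "cmod (u (\<lambda>x. \<phi> x + \<psi> x) - (u \<phi> + u \<psi>)) \<le> D * (\<epsilon> + \<epsilon>) + (D * \<epsilon> + D * \<epsilon>)"
        using norm_triangle_ineq4[of "u (\<lambda>x. \<phi> x + \<psi> x) - (y + w)" "(u \<phi> - y) + (u \<psi> - w)"]
          norm_triangle_ineq[of "u \<phi> - y" "u \<psi> - w"] by (simp only:)
      then show "cmod (u (\<lambda>x. \<phi> x + \<psi> x) - (u \<phi> + u \<psi>)) \<le> (4 * D) * \<epsilon>" by (simp add: algebra_simps)
    qed
    show "u (\<lambda>x. c * \<phi> x) = c * u \<phi>" if sm: "smooth \<phi>" for c \<phi>
    proof (rule complex_eq_if_close)
      fix \<epsilon> :: real assume "\<epsilon> > 0"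
      obtain f y where f: "trig_val g f y" "deriv_bound B m \<epsilon> (\<lambda>x. \<phi> x - f x)" using approx[OF sm \<open>\<epsilon> > 0\<close>] by blast
      note smf = trig_val_trig_span[OF f(1), THEN smooth_trig_span]
      have "deriv_bound B m (cmod c * \<epsilon>) (\<lambda>x. c * (\<phi> x - f x))"
        by (intro deriv_bound_cmult smooth_diff sm smf f)
      then have "deriv_bound B m (cmod c * \<epsilon>) (\<lambda>x. c * \<phi> x - c * f x)" by (simp add: algebra_simps)
      then have "cmod (u (\<lambda>x. c * \<phi> x) - c * y) \<le> D * (cmod c * \<epsilon>)"
        by (rule is_valD[OF u_val[OF smooth_cmult[OF sm]] trig_val_cmult[OF f(1)]])
      moreover have "cmod (c * (u \<phi> - y)) \<le> cmod c * (D * \<epsilon>)"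
        unfolding norm_mult by (intro mult_left_mono is_valD[OF u_val[OF sm] f]) simp
      moreover have "u (\<lambda>x. c * \<phi> x) - c * u \<phi> = (u (\<lambda>x. c * \<phi> x) - c * y) - c * (u \<phi> - y)"
        by (simp add: algebra_simps)
      ultimately have "cmod (u (\<lambda>x. c * \<phi> x) - c * u \<phi>) \<le> D * (cmod c * \<epsilon>) + cmod c * (D * \<epsilon>)"
        using norm_triangle_ineq4[of "u (\<lambda>x. c * \<phi> x) - c * y" "c * (u \<phi> - y)"] by (simp only:)
      then show "cmod (u (\<lambda>x. c * \<phi> x) - c * u \<phi>) \<le> (2 * D * cmod c) * \<epsilon>" by (simp add: algebra_simps)
    qed
    show "\<exists>K m C. compact K \<and> K \<noteq> {} \<and> (\<forall>\<phi>. smooth \<phi> \<longrightarrow> cmod (u \<phi>) \<le> C * smooth_seminorm K m \<phi>)"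
      using B u_le[OF _ deriv_bound_smooth_seminorm[OF _ B(1)]]
      by (intro exI[of _ B] exI[of _ m] exI[of _ D]) simp
  qed
  then show ?thesis using u_exp u_le by blast
qed

section \<open>The quasiprobability distribution\<close>

lemma iter_deriv_trig_sum:
  "iter_deriv js (\<lambda>x. \<Sum>a<n. c a * exp_char (\<theta> a) x) y = (\<Sum>a<n. c a * exp_deriv js (\<theta> a) y)"
proof -
  have "exp_deriv js \<eta> y = iter_deriv js (exp_char \<eta>) y" for \<eta>
    unfolding iter_deriv_exp_char by (simp add: exp_deriv_def exp_char_def)
  then show ?thesis by (simp add: iter_deriv_sum iter_deriv_cmult smooth_cmult)
qed

theorem theorem1:
  fixes A :: "'n::{finite,linorder} \<Rightarrow> ('h::complex_hilbert_space \<Rightarrow>\<^sub>L 'h)"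
    and \<rho> :: "'h \<Rightarrow>\<^sub>L 'h"
    and N :: nat
    and w :: "('n \<Rightarrow> 'n) \<Rightarrow> complex"
  assumes "density_operator \<rho>"
    and "\<And>j. selfadjoint_op (A j)"
    and "N \<ge> 1"
    and "(\<Sum>\<sigma> | \<sigma> permutes UNIV. w \<sigma>) = 1"
    and "(\<Sum>\<sigma> | \<sigma> permutes UNIV. norm (w \<sigma>)) = 1"
  shows "bounded (range (quantum_char_fun N w A \<rho>)) \<and>
    smooth (quantum_char_fun N w A \<rho>) \<and>
    (\<exists>!Pr. quasiprobability_distribution Pr \<and>
       (\<forall>\<theta>. quantum_char_fun N w A \<rho> \<theta> = distribution_fourier Pr \<theta>)) \<and>
    (\<forall>Pr. quasiprobability_distribution Pr \<and>
       (\<forall>\<theta>. quantum_char_fun N w A \<rho> \<theta> = distribution_fourier Pr \<theta>) \<longrightarrow>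
         distribution_support Pr \<subseteq> cbox (\<chi> j. - norm (A j)) (\<chi> j. norm (A j)) \<and>
         (Pr (\<lambda>_. 1) = quantum_char_fun N w A \<rho> 0 \<and> quantum_char_fun N w A \<rho> 0 = 1) \<and>
         (\<forall>\<alpha> :: 'n \<Rightarrow> nat.
            Pr (\<lambda>x. complex_of_real (\<Prod>j\<in>UNIV. (x $ j) ^ \<alpha> j)) =
              1 / \<i> ^ (\<Sum>j\<in>UNIV. \<alpha> j) * multi_deriv \<alpha> (quantum_char_fun N w A \<rho>) 0) \<and>
         (real_distribution Pr \<longleftrightarrow>
            (\<forall>\<theta>. quantum_char_fun N w A \<rho> (- \<theta>) = cnj (quantum_char_fun N w A \<rho> \<theta>))) \<and>
         (nonneg_distribution Pr \<longleftrightarrow> positive_definite_fun (quantum_char_fun N w A \<rho>)))"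
proof -
  let ?g = "quantum_char_fun N w A \<rho>"
  let ?B = "cbox (\<chi> j. - norm (A j)) (\<chi> j. norm (A j))"
  note hyps = assms(2-5) assms(1)
  have "0 \<in> ?B" by (simp add: mem_box_cart)
  then have B: "compact ?B" "?B \<noteq> {}" by (simp, blast)
  obtain k C where bound: "\<And>(n :: nat) c \<theta> M.
     (\<forall>js y. length js \<le> k \<longrightarrow> y \<in> ?B \<longrightarrow> cmod (\<Sum>a<n. c a * exp_deriv js (\<theta> a) y) \<le> M) \<Longrightarrow>
     cmod (\<Sum>a<n. c a * ?g (\<theta> a)) \<le> C * M"
    using quantum_char_fun_bound[of A N w \<rho>, OF hyps] by blast
  have bd: "cmod (\<Sum>a<n. c a * ?g (\<theta> a)) \<le> C * M"
    if "deriv_bound ?B k M (\<lambda>x. \<Sum>a<n. c a * exp_char (\<theta> a) x)" for n :: nat and c \<theta> M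
    using that unfolding deriv_bound_def iter_deriv_trig_sum by (rule bound)
  have "\<exists>u D. u \<in> compact_distributions \<and> (\<forall>\<theta>. u (exp_char \<theta>) = ?g \<theta>) \<and>
     (\<forall>\<phi> a. smooth \<phi> \<longrightarrow> deriv_bound ?B k a \<phi> \<longrightarrow> cmod (u \<phi>) \<le> D * a)"
    by (rule distribution_of_bounded_functional[OF B]) (rule bd)
  then obtain u D where *: "u \<in> compact_distributions \<and> (\<forall>\<theta>. u (exp_char \<theta>) = ?g \<theta>) \<and>
     (\<forall>\<phi> a. smooth \<phi> \<longrightarrow> deriv_bound ?B k a \<phi> \<longrightarrow> cmod (u \<phi>) \<le> D * a)"
    by (elim exE)
  then have u: "u \<in> compact_distributions" and FT: "\<And>\<theta>. u (exp_char \<theta>) = ?g \<theta>" by simp_all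
  have u_le: "\<And>\<phi> a. smooth \<phi> \<Longrightarrow> deriv_bound ?B k a \<phi> \<Longrightarrow> cmod (u \<phi>) \<le> D * a"
    using * by simp
  have g_0: "?g 0 = 1" by (rule quantum_char_fun_0[of A N w \<rho>, OF hyps])
  have one: "exp_char 0 = (\<lambda>_. 1)" by (rule ext) simp
  have g_eq: "(\<lambda>\<theta>. u (exp_char \<theta>)) = ?g" using FT by blast
  \<comment> \<open>Competitors are compactly supported distributions with arbitrary support. Since
    each of them equals u, all properties are proved for u and then transferred.\<close>
  have unique: "v = u" if "quasiprobability_distribution v" "\<forall>\<theta>. ?g \<theta> = distribution_fourier v \<theta>" for v
    using that unfolding quasiprobability_distribution_def distribution_fourier_exp_char
    by (intro compact_distribution_eqI u) (simp_all add: FT)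
  have quasi: "quasiprobability_distribution u" "\<forall>\<theta>. ?g \<theta> = distribution_fourier u \<theta>"
    using u FT[of 0] g_0 by (simp_all add: quasiprobability_distribution_def distribution_fourier_exp_char FT one)
  have bounded: "bounded (range ?g)"
    using norm_quantum_char_fun_le[of A N w \<rho>, OF hyps] unfolding bounded_iff by blast
  have smooth: "smooth ?g" using smooth_fourier[OF u] unfolding g_eq .
  have properties: "distribution_support u \<subseteq> ?B" "u (\<lambda>_. 1) = ?g 0"
    "\<And>\<alpha>. u (\<lambda>x. complex_of_real (\<Prod>j\<in>UNIV. (x $ j) ^ \<alpha> j)) =
       1 / \<i> ^ (\<Sum>j\<in>UNIV. \<alpha> j) * multi_deriv \<alpha> ?g 0"
    "real_distribution u \<longleftrightarrow> (\<forall>\<theta>. ?g (- \<theta>) = cnj (?g \<theta>))"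
    "nonneg_distribution u \<longleftrightarrow> positive_definite_fun ?g"
    using distribution_support_subset[OF u B(1) u_le] FT[of 0] distribution_moments[OF u] real_distribution_iff[OF u]
      nonneg_distribution_iff[OF u]
    by (simp_all only: one FT g_eq)
  have "\<exists>!Pr. quasiprobability_distribution Pr \<and> (\<forall>\<theta>. ?g \<theta> = distribution_fourier Pr \<theta>)"
  proof (rule ex1I)
    show "quasiprobability_distribution u \<and> (\<forall>\<theta>. ?g \<theta> = distribution_fourier u \<theta>)"
      using quasi by (rule conjI)
    show "v = u" if "quasiprobability_distribution v \<and> (\<forall>\<theta>. ?g \<theta> = distribution_fourier v \<theta>)" for v
      using that by (elim conjE) (rule unique)
  qed
  with bounded smooth show ?thesis
  proof (intro conjI allI impI; (elim conjE)?)
    fix v assume "quasiprobability_distribution v" "\<forall>\<theta>. ?g \<theta> = distribution_fourier v \<theta>"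
    then have v: "v = u" by (rule unique)
    show "distribution_support v \<subseteq> ?B" "v (\<lambda>_. 1) = ?g 0" "?g 0 = 1"
      "v (\<lambda>x. complex_of_real (\<Prod>j\<in>UNIV. (x $ j) ^ \<alpha> j)) =
        1 / \<i> ^ (\<Sum>j\<in>UNIV. \<alpha> j) * multi_deriv \<alpha> ?g 0"
      "real_distribution v \<longleftrightarrow> (\<forall>\<theta>. ?g (- \<theta>) = cnj (?g \<theta>))"
      "nonneg_distribution v \<longleftrightarrow> positive_definite_fun ?g" for \<alpha>
      unfolding v by (rule properties g_0)+
  qed
qed

end
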